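(* Let $X$ be a set. The free Ehresmann monoid $\mathrm{FE}(X)$ embeds, as a monoid, into the semidirect product $Y_X\rtimes F_X$, where $F_X$ is the free group on $X$ and $Y_X$ is the semilattice with identity defined in the context.
   Context: Free Ehresmann monoid. An $X$-tree is a finite directed graph $T$ whose underlying undirected graph is a tree, with edges labelled by elements of $X$, together with two distinguished (possibly equal) vertices (start and end) such that there is a (possibly empty) directed path from the start to the end vertex. Morphisms preserve incidence, orientation, labels, start and end vertices. A retraction is an idempotent endomorphism; $T$ is pruned if its only retraction is the identity. Each $X$-tree $T$ has a unique (up to isomorphism) pruned tree $\overline T$ that is the image of a retraction of $T$. $S\times T$ is obtained by gluing the end vertex of $S$ to the start vertex of $T$ (start vertex that of $S$, end vertex that of $T$); $T^{(+)}$ is $T$ with end vertex moved to its start vertex; $T^{( * )}$ is $T$ with start vertex moved to its end vertex. $\mathrm{FE}(X)$ is the set of isomorphism types of pruned $X$-trees with $ST=\overline{S\times T}$, $T^+=\overline{T^{(+)}}$, $T^*=\overline{T^{( * )}}$, with identity the single-vertex tree. It is the free Ehresmann monoid on $X$ ($x\in X$ being the tree with a single edge labelled $x$ from start to end), and it contains the free monoid $X^*$ generated by these. Let $E(X)$ be its semilattice of idempotents (the pruned trees with start vertex equal to end vertex) and $\mathcal E_X=E(X)\setminus\{1\}$. Put $X^+=X^*\setminus\{1\}$. The free product $C_X$. Let $C_X$ be the monoid free product of $X^*$ and $E(X)$ (with identities identified); $E(X)$ and $X^*$ are viewed as submonoids of $C_X$. $C_X$ acts on the left and on the right of the set $E(X)$: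 the actions are determined by $w\cdot f=(wf)^+$, $f\circ w=(fw)^*$ for $w\in X^*$, and $e\cdot f=ef=f\circ e$ for $e\in E(X)$, for all $f\in E(X)$, with right-hand sides computed in $\mathrm{FE}(X)$. For $\gamma\in C_X$ put $\gamma^+=\gamma\cdot 1\in E(X)\subseteq C_X$ and $\gamma^*=1\circ\gamma\in E(X)\subseteq C_X$. The semilattice $Z_X$. Let $S_X$ be the free monoid semilattice (free commutative idempotent monoid) on symbols $y_{x,h}$ and $e_{f,h}$ with $x\in X$, $f\in\mathcal E_X$, $h\in F_X$, and let $Z_X$ be the quotient of $S_X$ by the congruence generated by all pairs $(e_{f',h}e_{f'',h},\,e_{f'f'',h})$ with $f',f''\in\mathcal E_X$, $h\in F_X$. $F_X$ acts on the left of $Z_X$ by monoid morphisms determined by $g\cdot y_{x,h}=y_{x,gh}$, $g\cdot e_{f,h}=e_{f,gh}$. For $w=x_1\cdots x_n\in X^+$ (with $x_i\in X$) and $h\in F_X$ let $\tau_{w,h}=y_{x_1,h}\,y_{x_2,hx_1}\cdots y_{x_n,hx_1\cdots x_{n-1}}\in Z_X$. If a monoid $S$ acts on the left of a semilattice with identity $Y$ by monoid morphisms, $Y\rtimes S$ is the set $Y\times S$ with product $(y,s)(z,t)=(y\,(s\cdot z),st)$ and identity $(1_Y,1_S)$. The morphism $\theta$. Let $\theta:C_X\to Z_X\rtimes F_X$ be the monoid morphism determined by $1\mapsto(1,1)$, $w\mapsto(\tau_{w,1},w)$ for $w\in X^+$, and $f\mapsto(e_{f,1},1)$ for $f\in\mathcal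 E_X$. Write $\gamma\theta=(\gamma\theta_1,\gamma\theta_2)$. The semilattice $Y_X$. Let $Y_X$ be the quotient of $Z_X$ by the congruence generated by all pairs $\big(h\cdot(\gamma^+\theta_1\,\gamma\theta_1),\ h\cdot(\gamma\theta_1)\big)$ and $\big(h\cdot(\gamma\theta_1\,(\gamma\theta_2\cdot(\gamma^*\theta_1))),\ h\cdot(\gamma\theta_1)\big)$, for $\gamma\in C_X$, $h\in F_X$. The action of $F_X$ on $Z_X$ induces an action of $F_X$ on $Y_X$ by monoid morphisms, and $Y_X\rtimes F_X$ is formed with respect to this action. *)

theory Defs
  imports "HOL-Algebra.Group"
begin

section \<open>Generic monoid constructions\<close>

definition free_mon :: "'a set \<Rightarrow> 'a list monoid" where
  "free_mon A = \<lparr>carrier = lists A, mult = (@), one = []\<rparr>"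

text \<open>The least congruence on the monoid \<open>M\<close> containing those pairs of \<open>R\<close> that lie in \<open>M\<close>.\<close>

inductive_set gen_cong :: "('a, 'b) monoid_scheme \<Rightarrow> ('a \<times> 'a) set \<Rightarrow> ('a \<times> 'a) set"
  for M (structure) and R where
  base: "(a, b) \<in> R \<Longrightarrow> a \<in> carrier M \<Longrightarrow> b \<in> carrier M \<Longrightarrow> (a, b) \<in> gen_cong M R"
| refl: "a \<in> carrier M \<Longrightarrow> (a, a) \<in> gen_cong M R"
| sym: "(a, b) \<in> gen_cong M R \<Longrightarrow> (b, a) \<in> gen_cong M R"
| trans: "(a, b) \<in> gen_cong M R \<Longrightarrow> (b, c) \<in> gen_cong M R \<Longrightarrow> (a, c) \<in> gen_cong M R"
| mult: "(a, b) \<in> gen_cong M R \<Longrightarrow> (c, d) \<in> gen_cong M R \<Longrightarrow> (a \<otimes> c, b \<otimes> d) \<in> gen_cong M R"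

definition cong_class :: "('a, 'b) monoid_scheme \<Rightarrow> ('a \<times> 'a) set \<Rightarrow> 'a \<Rightarrow> 'a set" where
  "cong_class M R a = gen_cong M R `` {a}"

definition quot_mon :: "('a, 'b) monoid_scheme \<Rightarrow> ('a \<times> 'a) set \<Rightarrow> 'a set monoid" where
  "quot_mon M R = \<lparr>carrier = carrier M // gen_cong M R,
     mult = (\<lambda>A B. \<Union>a\<in>A. \<Union>b\<in>B. cong_class M R (a \<otimes>\<^bsub>M\<^esub> b)),
     one = cong_class M R \<one>\<^bsub>M\<^esub>\<rparr>"

text \<open>The self-map of a quotient induced by a map \<open>\<phi>\<close> that respects the congruence.\<close>

definition quot_map :: "('a, 'b) monoid_scheme \<Rightarrow> ('a \<times> 'a) set \<Rightarrow> ('a \<Rightarrow> 'a) \<Rightarrow> 'a set \<Rightarrow> 'a set" where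
  "quot_map M R \<phi> A = (\<Union>a\<in>A. cong_class M R (\<phi> a))"

definition free_product_rel ::
  "('a, 'm) monoid_scheme \<Rightarrow> ('b, 'n) monoid_scheme \<Rightarrow> (('a + 'b) list \<times> ('a + 'b) list) set" where
  "free_product_rel M N =
     {([Inl a, Inl b], [Inl (a \<otimes>\<^bsub>M\<^esub> b)]) | a b. a \<in> carrier M \<and> b \<in> carrier M}
   \<union> {([Inr a, Inr b], [Inr (a \<otimes>\<^bsub>N\<^esub> b)]) | a b. a \<in> carrier N \<and> b \<in> carrier N}
   \<union> {([Inl \<one>\<^bsub>M\<^esub>], []), ([Inr \<one>\<^bsub>N\<^esub>], [])}"

definition free_product ::
  "('a, 'm) monoid_scheme \<Rightarrow> ('b, 'n) monoid_scheme \<Rightarrow> ('a + 'b) list set monoid" where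
  "free_product M N = quot_mon (free_mon (carrier M <+> carrier N)) (free_product_rel M N)"

text \<open>The free commutative idempotent monoid on \<open>A\<close>: finite subsets of \<open>A\<close> under union.\<close>

definition free_semilattice :: "'a set \<Rightarrow> 'a set monoid" where
  "free_semilattice A = \<lparr>carrier = {B. finite B \<and> B \<subseteq> A}, mult = (\<union>), one = {}\<rparr>"

definition semidirect ::
  "('y, 'm) monoid_scheme \<Rightarrow> ('s, 'n) monoid_scheme \<Rightarrow> ('s \<Rightarrow> 'y \<Rightarrow> 'y) \<Rightarrow> ('y \<times> 's) monoid" where
  "semidirect Y S act = \<lparr>carrier = carrier Y \<times> carrier S,
     mult = (\<lambda>(y, s) (z, t). (y \<otimes>\<^bsub>Y\<^esub> act s z, s \<otimes>\<^bsub>S\<^esub> t)),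
     one = (\<one>\<^bsub>Y\<^esub>, \<one>\<^bsub>S\<^esub>)\<rparr>"


section \<open>The free group\<close>

text \<open>Letters are signed: \<open>(True, x)\<close> stands for \<open>x\<close> and \<open>(False, x)\<close> for its inverse.\<close>

type_synonym 'a fgrp = "(bool \<times> 'a) list set"

definition fgrp_rel :: "'a set \<Rightarrow> ((bool \<times> 'a) list \<times> (bool \<times> 'a) list) set" where
  "fgrp_rel X = {([(b, x), (\<not> b, x)], []) | b x. x \<in> X}"

definition FG :: "'a set \<Rightarrow> 'a fgrp monoid" where
  "FG X = quot_mon (free_mon (UNIV \<times> X)) (fgrp_rel X)"

definition fgrp_word :: "'a set \<Rightarrow> 'a list \<Rightarrow> 'a fgrp" where
  "fgrp_word X w = cong_class (free_mon (UNIV \<times> X)) (fgrp_rel X) (map (Pair True) w)"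


section \<open>Trees\<close>

text \<open>
  An edge \<open>(u, x, v)\<close> goes from \<open>u\<close> to \<open>v\<close> and has label \<open>x\<close>.  In a graph whose underlying
  undirected (multi)graph is a tree, distinct edges have distinct pairs of endpoints.  So a set of
  such triples represents every tree, and a graph morphism is determined by its action on vertices.
\<close>

record ('v, 'a) xtree =
  verts :: "'v set"
  edges :: "('v \<times> 'a \<times> 'v) set"
  src :: 'v
  tgt :: 'v

definition dir_adj :: "('v, 'a) xtree \<Rightarrow> ('v \<times> 'v) set" where
  "dir_adj T = {(u, v). \<exists>x. (u, x, v) \<in> edges T}"

definition undir_adj :: "('v, 'a) xtree \<Rightarrow> ('v \<times> 'v) set" where
  "undir_adj T = dir_adj T \<union> (dir_adj T)\<inverse>"

definition joins :: "'v \<times> 'a \<times> 'v \<Rightarrow> 'v \<Rightarrow> 'v \<Rightarrow> bool" where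
  "joins e u v \<longleftrightarrow> (\<exists>x. e = (u, x, v) \<or> e = (v, x, u))"

text \<open>
  Cycles of the underlying undirected multigraph: a loop is a cycle of length 1, and a pair of
  parallel or antiparallel edges gives a cycle of length 2.
\<close>

definition undir_cycle :: "('v, 'a) xtree \<Rightarrow> ('v \<times> 'a \<times> 'v) list \<Rightarrow> 'v list \<Rightarrow> bool" where
  "undir_cycle T es vs \<longleftrightarrow> es \<noteq> [] \<and> length vs = length es \<and> distinct es \<and> distinct vs \<and>
     set es \<subseteq> edges T \<and>
     (\<forall>i < length es. joins (es ! i) (vs ! i) (vs ! (Suc i mod length es)))"

definition is_xtree :: "'a set \<Rightarrow> ('v, 'a) xtree \<Rightarrow> bool" where
  "is_xtree X T \<longleftrightarrow>
     finite (verts T) \<and> finite (edges T) \<and> edges T \<subseteq> verts T \<times> X \<times> verts T \<and>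
     src T \<in> verts T \<and> tgt T \<in> verts T \<and>
     (\<forall>u\<in>verts T. \<forall>v\<in>verts T. (u, v) \<in> (undir_adj T)\<^sup>*) \<and>
     (\<nexists>es vs. undir_cycle T es vs) \<and>
     (src T, tgt T) \<in> (dir_adj T)\<^sup>*"

definition map_xtree :: "('v \<Rightarrow> 'w) \<Rightarrow> ('v, 'a) xtree \<Rightarrow> ('w, 'a) xtree" where
  "map_xtree f T = \<lparr>verts = f ` verts T, edges = (\<lambda>(u, x, v). (f u, x, f v)) ` edges T,
     src = f (src T), tgt = f (tgt T)\<rparr>"

definition xtree_mor :: "('v, 'a) xtree \<Rightarrow> ('w, 'a) xtree \<Rightarrow> ('v \<Rightarrow> 'w) \<Rightarrow> bool" where
  "xtree_mor S T f \<longleftrightarrow> f ` verts S \<subseteq> verts T \<and>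
     (\<forall>u x v. (u, x, v) \<in> edges S \<longrightarrow> (f u, x, f v) \<in> edges T) \<and>
     f (src S) = src T \<and> f (tgt S) = tgt T"

definition xtree_iso :: "('v, 'a) xtree \<Rightarrow> ('w, 'a) xtree \<Rightarrow> bool" where
  "xtree_iso S T \<longleftrightarrow> (\<exists>f. inj_on f (verts S) \<and> T = map_xtree f S)"

definition retraction :: "('v, 'a) xtree \<Rightarrow> ('v \<Rightarrow> 'v) \<Rightarrow> bool" where
  "retraction T r \<longleftrightarrow> xtree_mor T T r \<and> (\<forall>v\<in>verts T. r (r v) = r v)"

definition pruned :: "('v, 'a) xtree \<Rightarrow> bool" where
  "pruned T \<longleftrightarrow> (\<forall>r. retraction T r \<longrightarrow> (\<forall>v\<in>verts T. r v = v))"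

text \<open>Isomorphism types of finite trees are represented by sets of trees with vertices in \<open>nat\<close>.\<close>

type_synonym 'a fe = "(nat, 'a) xtree set"

definition iso_type :: "('v, 'a) xtree \<Rightarrow> 'a fe" where
  "iso_type T = {R. xtree_iso T R}"

text \<open>The isomorphism type of the pruned retract of \<open>T\<close>, which is unique up to isomorphism.\<close>

definition pruning :: "('v, 'a) xtree \<Rightarrow> 'a fe" where
  "pruning T = \<Union>{iso_type (map_xtree r T) | r. retraction T r \<and> pruned (map_xtree r T)}"

definition glue :: "('v, 'a) xtree \<Rightarrow> ('w, 'a) xtree \<Rightarrow> ('v + 'w, 'a) xtree" where
  "glue S T =
     (let S' = map_xtree Inl S;
          T' = map_xtree (\<lambda>v. if v = src T then Inl (tgt S) else Inr v) T
      in \<lparr>verts = verts S' \<union> verts T', edges = edges S' \<union> edges T',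
          src = src S', tgt = tgt T'\<rparr>)"


section \<open>The free Ehresmann monoid\<close>

definition FE :: "'a set \<Rightarrow> 'a fe monoid" where
  "FE X = \<lparr>carrier = {iso_type T | T :: (nat, 'a) xtree. is_xtree X T \<and> pruned T},
     mult = (\<lambda>A B. \<Union>S\<in>A. \<Union>T\<in>B. pruning (glue S T)),
     one = iso_type (\<lparr>verts = {0}, edges = {}, src = 0, tgt = 0\<rparr> :: (nat, 'a) xtree)\<rparr>"

definition fe_plus :: "'a fe \<Rightarrow> 'a fe" where
  "fe_plus A = (\<Union>T\<in>A. pruning (T\<lparr>tgt := src T\<rparr>))"

definition fe_star :: "'a fe \<Rightarrow> 'a fe" where
  "fe_star A = (\<Union>T\<in>A. pruning (T\<lparr>src := tgt T\<rparr>))"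

definition fe_gen :: "'a \<Rightarrow> 'a fe" where
  "fe_gen x = iso_type (\<lparr>verts = {0, 1}, edges = {(0, x, 1)}, src = 0, tgt = 1\<rparr> :: (nat, 'a) xtree)"

definition fe_word :: "'a set \<Rightarrow> 'a list \<Rightarrow> 'a fe" where
  "fe_word X w = foldr (\<lambda>x A. fe_gen x \<otimes>\<^bsub>FE X\<^esub> A) w \<one>\<^bsub>FE X\<^esub>"

definition E_sl :: "'a set \<Rightarrow> 'a fe monoid" where
  "E_sl X = (FE X)\<lparr>carrier := {e \<in> carrier (FE X). e \<otimes>\<^bsub>FE X\<^esub> e = e}\<rparr>"

definition E_nontriv :: "'a set \<Rightarrow> 'a fe set" where
  "E_nontriv X = carrier (E_sl X) - {\<one>\<^bsub>FE X\<^esub>}"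


section \<open>The free product and its actions\<close>

type_synonym 'a cword = "('a list + 'a fe) list"

definition C_mon :: "'a set \<Rightarrow> 'a cword set monoid" where
  "C_mon X = free_product (free_mon X) (E_sl X)"

definition C_of_E :: "'a set \<Rightarrow> 'a fe \<Rightarrow> 'a cword set" where
  "C_of_E X f = cong_class (free_mon (carrier (free_mon X) <+> carrier (E_sl X)))
     (free_product_rel (free_mon X) (E_sl X)) [Inr f]"

fun left_gen :: "'a set \<Rightarrow> 'a list + 'a fe \<Rightarrow> 'a fe \<Rightarrow> 'a fe" where
  "left_gen X (Inl w) f = fe_plus (fe_word X w \<otimes>\<^bsub>FE X\<^esub> f)"
| "left_gen X (Inr e) f = e \<otimes>\<^bsub>FE X\<^esub> f"

fun right_gen :: "'a set \<Rightarrow> 'a fe \<Rightarrow> 'a list + 'a fe \<Rightarrow> 'a fe" where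
  "right_gen X f (Inl w) = fe_star (f \<otimes>\<^bsub>FE X\<^esub> fe_word X w)"
| "right_gen X f (Inr e) = f \<otimes>\<^bsub>FE X\<^esub> e"

text \<open>
  The actions are constant on congruence classes of words, so the action of an element of the free
  product is the common value over its representing words (and likewise for \<open>\<theta>\<close> below).
\<close>

definition C_left :: "'a set \<Rightarrow> 'a cword set \<Rightarrow> 'a fe \<Rightarrow> 'a fe" where
  "C_left X \<gamma> f = the_elem ((\<lambda>u. foldr (left_gen X) u f) ` \<gamma>)"

definition C_right :: "'a set \<Rightarrow> 'a fe \<Rightarrow> 'a cword set \<Rightarrow> 'a fe" where
  "C_right X f \<gamma> = the_elem ((\<lambda>u. foldl (right_gen X) f u) ` \<gamma>)"

definition C_plus :: "'a set \<Rightarrow> 'a cword set \<Rightarrow> 'a cword set" where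
  "C_plus X \<gamma> = C_of_E X (C_left X \<gamma> \<one>\<^bsub>FE X\<^esub>)"

definition C_star :: "'a set \<Rightarrow> 'a cword set \<Rightarrow> 'a cword set" where
  "C_star X \<gamma> = C_of_E X (C_right X \<one>\<^bsub>FE X\<^esub> \<gamma>)"


section \<open>The semilattice Z\<close>

datatype 'a zsym = Ysym 'a "'a fgrp" | Esym "'a fe" "'a fgrp"

type_synonym 'a zel = "'a zsym set set"

definition S_sl :: "'a set \<Rightarrow> 'a zsym set monoid" where
  "S_sl X = free_semilattice
     ({Ysym x h | x h. x \<in> X \<and> h \<in> carrier (FG X)} \<union>
      {Esym f h | f h. f \<in> E_nontriv X \<and> h \<in> carrier (FG X)})"

definition Z_rel :: "'a set \<Rightarrow> ('a zsym set \<times> 'a zsym set) set" where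
  "Z_rel X = {({Esym f' h} \<otimes>\<^bsub>S_sl X\<^esub> {Esym f'' h}, {Esym (f' \<otimes>\<^bsub>FE X\<^esub> f'') h}) | f' f'' h.
     f' \<in> E_nontriv X \<and> f'' \<in> E_nontriv X \<and> h \<in> carrier (FG X)}"

definition Z_sl :: "'a set \<Rightarrow> 'a zel monoid" where
  "Z_sl X = quot_mon (S_sl X) (Z_rel X)"

definition z_y :: "'a set \<Rightarrow> 'a \<Rightarrow> 'a fgrp \<Rightarrow> 'a zel" where
  "z_y X x h = cong_class (S_sl X) (Z_rel X) {Ysym x h}"

definition z_e :: "'a set \<Rightarrow> 'a fe \<Rightarrow> 'a fgrp \<Rightarrow> 'a zel" where
  "z_e X f h = cong_class (S_sl X) (Z_rel X) {Esym f h}"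

fun zsym_act :: "'a set \<Rightarrow> 'a fgrp \<Rightarrow> 'a zsym \<Rightarrow> 'a zsym" where
  "zsym_act X g (Ysym x h) = Ysym x (g \<otimes>\<^bsub>FG X\<^esub> h)"
| "zsym_act X g (Esym f h) = Esym f (g \<otimes>\<^bsub>FG X\<^esub> h)"

definition Z_act :: "'a set \<Rightarrow> 'a fgrp \<Rightarrow> 'a zel \<Rightarrow> 'a zel" where
  "Z_act X g = quot_map (S_sl X) (Z_rel X) (\<lambda>B. zsym_act X g ` B)"

fun tau :: "'a set \<Rightarrow> 'a list \<Rightarrow> 'a fgrp \<Rightarrow> 'a zel" where
  "tau X [] h = \<one>\<^bsub>Z_sl X\<^esub>"
| "tau X (x # w) h = z_y X x h \<otimes>\<^bsub>Z_sl X\<^esub> tau X w (h \<otimes>\<^bsub>FG X\<^esub> fgrp_word X [x])"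


section \<open>The morphism \<open>\<theta>\<close> and the semilattice Y\<close>

definition ZF :: "'a set \<Rightarrow> ('a zel \<times> 'a fgrp) monoid" where
  "ZF X = semidirect (Z_sl X) (FG X) (Z_act X)"

fun theta_gen :: "'a set \<Rightarrow> 'a list + 'a fe \<Rightarrow> 'a zel \<times> 'a fgrp" where
  "theta_gen X (Inl w) = (tau X w \<one>\<^bsub>FG X\<^esub>, fgrp_word X w)"
| "theta_gen X (Inr f) = (if f = \<one>\<^bsub>FE X\<^esub> then \<one>\<^bsub>ZF X\<^esub> else (z_e X f \<one>\<^bsub>FG X\<^esub>, \<one>\<^bsub>FG X\<^esub>))"

definition theta :: "'a set \<Rightarrow> 'a cword set \<Rightarrow> 'a zel \<times> 'a fgrp" where
  "theta X \<gamma> = the_elem ((\<lambda>u. foldr (\<lambda>s p. theta_gen X s \<otimes>\<^bsub>ZF X\<^esub> p) u \<one>\<^bsub>ZF X\<^esub>) ` \<gamma>)"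

abbreviation theta1 :: "'a set \<Rightarrow> 'a cword set \<Rightarrow> 'a zel" where
  "theta1 X \<gamma> \<equiv> fst (theta X \<gamma>)"

abbreviation theta2 :: "'a set \<Rightarrow> 'a cword set \<Rightarrow> 'a fgrp" where
  "theta2 X \<gamma> \<equiv> snd (theta X \<gamma>)"

definition Y_rel :: "'a set \<Rightarrow> ('a zel \<times> 'a zel) set" where
  "Y_rel X =
     {(Z_act X h (theta1 X (C_plus X \<gamma>) \<otimes>\<^bsub>Z_sl X\<^esub> theta1 X \<gamma>), Z_act X h (theta1 X \<gamma>)) | \<gamma> h.
        \<gamma> \<in> carrier (C_mon X) \<and> h \<in> carrier (FG X)}
   \<union> {(Z_act X h (theta1 X \<gamma> \<otimes>\<^bsub>Z_sl X\<^esub> Z_act X (theta2 X \<gamma>) (theta1 X (C_star X \<gamma>))),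
       Z_act X h (theta1 X \<gamma>)) | \<gamma> h.
        \<gamma> \<in> carrier (C_mon X) \<and> h \<in> carrier (FG X)}"

definition Y_sl :: "'a set \<Rightarrow> 'a zel set monoid" where
  "Y_sl X = quot_mon (Z_sl X) (Y_rel X)"

definition Y_act :: "'a set \<Rightarrow> 'a fgrp \<Rightarrow> 'a zel set \<Rightarrow> 'a zel set" where
  "Y_act X g = quot_map (Z_sl X) (Y_rel X) (Z_act X g)"

end

theory Submission
  imports Defs "HOL-Library.Transitive_Closure_Table"
begin

text \<open>
  The proof represents everything by binary relations on graphs. For an edge-labelled graph \<open>G\<close>,
  a tree \<open>T\<close> denotes the relation of all pairs (image of the start, image of the end) under the
  homomorphisms from \<open>T\<close> to \<open>G\<close>. Gluing becomes composition of relations, and \<open>T\<^sup>+\<close> and \<open>T\<^sup>*\<close>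
  become the identity on the domain and on the range. Pruned trees are the cores of trees, so two
  pruned trees are isomorphic as soon as there are homomorphisms in both directions. Taking the
  trees themselves as the test graphs, one sees that an element of \<open>FE X\<close> is determined by the
  relations that it denotes (\<open>FE_eqI\<close>). The algebra of \<open>FE X\<close>, such as the fact that \<open>C\<^sub>X\<close> acts on
  \<open>E(X)\<close>, is thus relation algebra.

  Every element of \<open>FE X\<close> is the value of a word in letters and idempotents, obtained by cutting its
  tree along the trunk, the path from start to end (\<open>FE_eval_surj\<close>). A word \<open>u\<close> also has a value
  \<open>u\<theta>\<close> in the semidirect product over \<open>Y\<^sub>X\<close>, and both values are multiplicative in \<open>u\<close>. The theorem
  therefore says that two words have the same value in \<open>FE X\<close> if and only if they have the same
  value in \<open>Y\<^sub>X \<rtimes> F\<^sub>X\<close>: one direction makes the map well defined, and the other makes it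
  injective (\<open>word_embedding_eq_iff\<close>).

  Injectivity. Given a graph \<open>G\<close> and any map \<open>p\<close> from \<open>F\<^sub>X\<close> to its vertices, call \<open>y\<^bsub>x,h\<^esub>\<close> true if there
  is an \<open>x\<close>-edge from \<open>p(h)\<close> to \<open>p(hx)\<close>, and \<open>e\<^bsub>f,h\<^esub>\<close> true if \<open>f\<close> relates \<open>p(h)\<close> to itself. This is
  a morphism from \<open>Y\<^sub>X\<close> to the two-element semilattice (\<open>zel_holds_ycong\<close>). If \<open>(a, b)\<close> lies in the
  relation of \<open>u\<close>, then a walk from \<open>a\<close> to \<open>b\<close> that witnesses this, indexed by the exponent sum
  of elements of \<open>F\<^sub>X\<close>, makes the first component of \<open>u\<theta>\<close> true. It makes that of \<open>v\<theta>\<close> true if the two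
  are equal in \<open>Y\<^sub>X\<close>, and so \<open>(a, b)\<close> lies in the relation of \<open>v\<close>.

  Well-definedness. Equality of \<open>u\<close> and \<open>v\<close> in \<open>FE X\<close> speaks only about the ends of walks, but it
  also controls the vertices in between: in a suitable unrolling of \<open>G\<close> along a walk, that walk is
  the only one between its ends (\<open>sat_transfer\<close>). So if \<open>u\<close> is split as \<open>r t\<close> and \<open>e\<close> occurs in \<open>v\<close>
  at the same place of the trunk, then \<open>r\<^sup>* t\<^sup>+ \<le> e\<close> (\<open>star_plus_le\<close>). The relations
  that define \<open>Y\<^sub>X\<close>, applied to \<open>r\<close> and to \<open>t\<close>, put \<open>u\<theta>\<close> below the symbol of \<open>r\<^sup>* t\<^sup>+\<close> and hence below that
  of \<open>e\<close>. Since the trunks also agree, \<open>u\<theta>\<close> lies below every generator in \<open>v\<theta>\<close>, and conversely.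
\<close>

section \<open>Pruned trees as cores\<close>

definition finite_graph :: "('v, 'a) xtree \<Rightarrow> bool" where
  "finite_graph T \<longleftrightarrow> finite (verts T) \<and> finite (edges T) \<and>
     (\<forall>u x v. (u, x, v) \<in> edges T \<longrightarrow> u \<in> verts T \<and> v \<in> verts T) \<and> src T \<in> verts T \<and> tgt T \<in> verts T"

definition hom_equiv :: "('v, 'a) xtree \<Rightarrow> ('w, 'a) xtree \<Rightarrow> bool" where
  "hom_equiv S T \<longleftrightarrow> (\<exists>f. xtree_mor S T f) \<and> (\<exists>g. xtree_mor T S g)"

lemma xtree_mor_id: "xtree_mor T T (\<lambda>v. v)"
  by (simp add: xtree_mor_def)

lemma xtree_mor_comp: "xtree_mor S T f \<Longrightarrow> xtree_mor T U g \<Longrightarrow> xtree_mor S U (\<lambda>v. g (f v))"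
  by (fastforce simp: xtree_mor_def)

lemma hom_equiv_sym: "hom_equiv S T \<Longrightarrow> hom_equiv T S"
  by (simp add: hom_equiv_def)

lemma hom_equiv_trans: "hom_equiv S T \<Longrightarrow> hom_equiv T U \<Longrightarrow> hom_equiv S U"
  unfolding hom_equiv_def by (blast intro: xtree_mor_comp)

lemma xtree_mor_map_xtree: "xtree_mor T (map_xtree f T) f"
  by (auto simp: xtree_mor_def map_xtree_def image_iff intro: bexI[rotated])

lemma xtree_mor_inv_map_xtree:
  assumes "finite_graph T" "inj_on f (verts T)"
  shows "xtree_mor (map_xtree f T) T (inv_into (verts T) f)"
proof -
  have "inv_into (verts T) f (f v) = v" if "v \<in> verts T" for v
    using assms(2) that by (rule inv_into_f_f)
  then show ?thesis
    using assms(1) by (auto simp: xtree_mor_def map_xtree_def finite_graph_def)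
qed

lemma finite_graph_map_xtree: "finite_graph T \<Longrightarrow> finite_graph (map_xtree f T)"
  by (auto simp: finite_graph_def map_xtree_def)

lemma xtree_iso_finite_graph: "xtree_iso S T \<Longrightarrow> finite_graph S \<Longrightarrow> finite_graph T"
  by (auto simp: xtree_iso_def finite_graph_map_xtree)

lemma xtree_iso_hom_equiv: "xtree_iso S T \<Longrightarrow> finite_graph S \<Longrightarrow> hom_equiv S T"
  unfolding xtree_iso_def hom_equiv_def
  using xtree_mor_map_xtree xtree_mor_inv_map_xtree by blast

text \<open>
  Two powers agree on \<open>V\<close>, so the sequence of powers becomes periodic. A multiple of the period
  behind the start of the periodic part is idempotent.
\<close>

lemma finite_idempotent_power:
  fixes h :: "'v \<Rightarrow> 'v"
  assumes "finite V" "h ` V \<subseteq> V"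
  shows "\<exists>n>0. \<forall>v\<in>V. (h ^^ n) ((h ^^ n) v) = (h ^^ n) v"
proof -
  have V: "(h ^^ k) v \<in> V" if "v \<in> V" for k v
    using that assms(2) by (induction k) auto
  have "finite (PiE V (\<lambda>_. V))"
    using assms(1) by (simp add: finite_PiE)
  moreover have "range (\<lambda>k. restrict (h ^^ k) V) \<subseteq> PiE V (\<lambda>_. V)"
    using V by auto
  ultimately have "\<not> inj (\<lambda>k. restrict (h ^^ k) V)"
    using finite_subset finite_imageD infinite_UNIV_nat by blast
  then obtain i j where "i < j" and ij: "restrict (h ^^ i) V = restrict (h ^^ j) V"
    unfolding inj_on_def using linorder_neqE_nat by (metis (no_types, lifting))
  define p where "p = j - i"
  have "p > 0" "j = i + p" using \<open>i < j\<close> by (auto simp: p_def)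
  have step: "(h ^^ (k + p)) v = (h ^^ k) v" if "k \<ge> i" "v \<in> V" for k v
  proof -
    have "(h ^^ (k + p)) v = (h ^^ (k - i)) ((h ^^ j) v)"
      using that \<open>j = i + p\<close> funpow_add[of "k - i" j h] by simp
    also have "(h ^^ j) v = (h ^^ i) v"
      using ij that(2) by (metis restrict_apply)
    finally show ?thesis
      using that funpow_add[of "k - i" i h] by simp
  qed
  have steps: "(h ^^ (k + m * p)) v = (h ^^ k) v" if "k \<ge> i" "v \<in> V" for k m v
  proof (induction m)
    case (Suc m)
    have "(h ^^ (k + Suc m * p)) v = (h ^^ (k + m * p + p)) v" by (simp add: algebra_simps)
    also have "\<dots> = (h ^^ (k + m * p)) v" using that by (intro step) auto
    finally show ?case using Suc by simp
  qed simp
  \<comment> \<open>a multiple of the period \<open>p\<close> that is at least \<open>i\<close>\<close>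
  define n where "n = Suc i * p"
  have "n \<ge> i" "n > 0" using \<open>p > 0\<close> unfolding n_def
    by (auto intro: order.trans[of i "i * p"])
  moreover have "(h ^^ n) ((h ^^ n) v) = (h ^^ n) v" if "v \<in> V" for v
    using steps[OF \<open>n \<ge> i\<close> that, of "Suc i"] unfolding n_def[symmetric]
    by (simp add: funpow_add)
  ultimately show ?thesis by blast
qed

lemma xtree_mor_funpow: "xtree_mor T T h \<Longrightarrow> xtree_mor T T (h ^^ n)"
proof (induction n)
  case 0
  then show ?case by (simp add: xtree_mor_def)
next
  case (Suc n)
  from xtree_mor_comp[OF Suc.IH[OF Suc.prems] Suc.prems] show ?case by (simp add: comp_def)
qed

text \<open>
  A power of any endomorphism is idempotent, hence a retraction, hence trivial on a pruned tree.
\<close>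

lemma pruned_endo_inj:
  assumes "finite_graph T" "pruned T" "xtree_mor T T h"
  shows "inj_on h (verts T)"
proof -
  have hV: "h ` verts T \<subseteq> verts T" using assms(3) by (simp add: xtree_mor_def)
  have "finite (verts T)" using assms(1) by (simp add: finite_graph_def)
  from finite_idempotent_power[OF this hV] obtain n where
    "n > 0" and n: "\<forall>v\<in>verts T. (h ^^ n) ((h ^^ n) v) = (h ^^ n) v"
    by blast
  then have "retraction T (h ^^ n)"
    unfolding retraction_def using xtree_mor_funpow[OF assms(3)] by blast
  then have id: "(h ^^ n) v = v" if "v \<in> verts T" for v
    using assms(2) that unfolding pruned_def by blast
  obtain m where "n = Suc m" using \<open>n > 0\<close> gr0_conv_Suc by blast
  then have "(h ^^ m) (h v) = v" if "v \<in> verts T" for v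
    using id[OF that] by (simp only: funpow_Suc_right comp_apply)
  then show ?thesis by (rule inj_on_inverseI)
qed

text \<open>
  Both composites of the two homomorphisms are endomorphisms of pruned trees, hence injective. So
  the trees have equally many vertices and edges, and an injective homomorphism is onto.
\<close>

lemma pruned_hom_equiv_iso:
  assumes S: "finite_graph S" "pruned S" and T: "finite_graph T" "pruned T" and "hom_equiv S T"
  shows "xtree_iso S T"
proof -
  obtain f g where f: "xtree_mor S T f" and g: "xtree_mor T S g"
    using assms(5) by (auto simp: hom_equiv_def)
  have injf: "inj_on f (verts S)"
    using pruned_endo_inj[OF S xtree_mor_comp[OF f g]] by (auto simp: inj_on_def)
  have injg: "inj_on g (verts T)"
    using pruned_endo_inj[OF T xtree_mor_comp[OF g f]] by (auto simp: inj_on_def)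
  have fin: "finite (verts S)" "finite (verts T)" "finite (edges S)" "finite (edges T)"
    using S T by (auto simp: finite_graph_def)
  have fV: "f ` verts S \<subseteq> verts T" and gV: "g ` verts T \<subseteq> verts S"
    using f g by (auto simp: xtree_mor_def)
  then have "card (verts S) = card (verts T)"
    using injf injg fin by (meson card_inj_on_le order_antisym)
  then have V: "f ` verts S = verts T"
    using fV fin injf by (simp add: card_image card_subset_eq)
  let ?F = "\<lambda>(u, x, v). (f u, x, f v)" and ?G = "\<lambda>(u, x, v). (g u, x, g v)"
  have "inj_on ?F (edges S)"
    using S(1) inj_onD[OF injf] by (intro inj_onI) (auto simp: finite_graph_def)
  moreover have "inj_on ?G (edges T)"
    using T(1) inj_onD[OF injg] by (intro inj_onI) (auto simp: finite_graph_def)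
  moreover have FE: "?F ` edges S \<subseteq> edges T" and "?G ` edges T \<subseteq> edges S"
    using f g by (auto simp: xtree_mor_def)
  ultimately have "card (edges S) = card (edges T)"
    using fin by (meson card_inj_on_le order_antisym)
  with FE \<open>inj_on ?F (edges S)\<close> have "?F ` edges S = edges T"
    using fin by (simp add: card_image card_subset_eq)
  then have "T = map_xtree f S"
    using V f by (cases T) (auto simp: map_xtree_def xtree_mor_def)
  then show ?thesis using injf by (auto simp: xtree_iso_def)
qed

text \<open>
  A retraction with an image of least size works: retracting its image further would give a
  retraction of the whole tree with a smaller image.
\<close>

lemma pruned_retract_exists:
  assumes "finite_graph T"
  shows "\<exists>r. retraction T r \<and> pruned (map_xtree r T)"
proof -
  have fin: "finite (verts T)" using assms by (simp add: finite_graph_def)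
  have "retraction T (\<lambda>v. v)" by (simp add: retraction_def xtree_mor_id)
  then obtain r where r: "retraction T r"
    and least: "\<And>s. retraction T s \<Longrightarrow> card (r ` verts T) \<le> card (s ` verts T)"
    by (metis (no_types, lifting) ex_has_least_nat[of "retraction T" _ "\<lambda>r. card (r ` verts T)"])
  have "s v = v" if s: "retraction (map_xtree r T) s" and v: "v \<in> verts (map_xtree r T)" for s v
  proof (rule ccontr)
    assume neq: "s v \<noteq> v"
    let ?W = "r ` verts T"
    have W: "verts (map_xtree r T) = ?W" by (simp add: map_xtree_def)
    have sW: "s ` ?W \<subseteq> ?W" and ss: "\<And>w. w \<in> ?W \<Longrightarrow> s (s w) = s w"
      using s by (auto simp: retraction_def xtree_mor_def W)
    have rr: "r w = w" if "w \<in> ?W" for w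
      using r that by (auto simp: retraction_def)
    have "xtree_mor (map_xtree r T) T (\<lambda>v. v)"
      using r by (auto simp: retraction_def xtree_mor_def map_xtree_def)
    with s have "xtree_mor (map_xtree r T) T s"
      unfolding retraction_def by (blast dest: xtree_mor_comp)
    then have "xtree_mor T T (\<lambda>v. s (r v))"
      using xtree_mor_comp[OF xtree_mor_map_xtree] by blast
    moreover have "s (r (s (r v))) = s (r v)" if "v \<in> verts T" for v
      using that sW ss rr by (metis image_eqI image_subset_iff)
    ultimately have "retraction T (\<lambda>v. s (r v))"
      by (simp add: retraction_def)
    from least[OF this] have "card ?W \<le> card (s ` ?W)"
      by (simp add: image_image)
    then have "s ` ?W = ?W"
      using sW fin by (meson card_seteq finite_imageI)
    then show False using neq v ss W by (metis imageE)
  qed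
  then show ?thesis using r by (auto simp: pruned_def)
qed

lemma retraction_hom_equiv: "retraction T r \<Longrightarrow> hom_equiv T (map_xtree r T)"
  unfolding hom_equiv_def
proof (intro conjI exI)
  assume r: "retraction T r"
  show "xtree_mor T (map_xtree r T) r" by (rule xtree_mor_map_xtree)
  show "xtree_mor (map_xtree r T) T (\<lambda>v. v)"
    using r by (auto simp: retraction_def xtree_mor_def map_xtree_def)
qed

lemma pruned_iso:
  assumes "pruned S" "xtree_iso S T" "finite_graph S"
  shows "pruned T"
  unfolding pruned_def
proof (intro allI impI ballI)
  fix r v assume r: "retraction T r" and v: "v \<in> verts T"
  obtain f where f: "inj_on f (verts S)" and T: "T = map_xtree f S"
    using assms(2) by (auto simp: xtree_iso_def)
  let ?g = "inv_into (verts S) f"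
  have VT: "verts T = f ` verts S" by (simp add: T map_xtree_def)
  have g: "xtree_mor T S ?g" unfolding T by (rule xtree_mor_inv_map_xtree[OF assms(3) f])
  have rV: "r w \<in> verts T" if "w \<in> verts T" for w
    using r that by (auto simp: retraction_def xtree_mor_def)
  have fg: "f (?g w) = w" if "w \<in> verts T" for w
    using that VT by (simp add: f_inv_into_f)
  have "xtree_mor S S (\<lambda>v. ?g (r (f v)))"
    using xtree_mor_comp[OF xtree_mor_comp[OF xtree_mor_map_xtree[of S f]] g] r
    unfolding retraction_def T by blast
  moreover have "?g (r (f (?g (r (f w))))) = ?g (r (f w))" if "w \<in> verts S" for w
    using that rV VT fg r by (metis image_eqI retraction_def)
  ultimately have "retraction S (\<lambda>v. ?g (r (f v)))"
    by (simp add: retraction_def)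
  then have "?g (r (f w)) = w" if "w \<in> verts S" for w
    using assms(1) that by (auto simp: pruned_def)
  then show "r v = v"
    using v VT rV fg by (metis imageE)
qed

lemma iso_nat_copy:
  assumes "finite_graph T"
  obtains R :: "(nat, 'a) xtree" where "xtree_iso (T :: ('v, 'a) xtree) R"
proof -
  have "finite (verts T)" using assms by (simp add: finite_graph_def)
  then obtain f :: "'v \<Rightarrow> nat" where "inj_on f (verts T)"
    using finite_imp_inj_to_nat_seg by metis
  then show ?thesis using that by (auto simp: xtree_iso_def)
qed

text \<open>
  Pruned retracts of \<open>T\<close> are homomorphically equivalent to \<open>T\<close>, and for pruned trees homomorphic
  equivalence is isomorphism. Retractions thus disappear from the description of \<open>pruning\<close>.
\<close>

lemma pruning_eq:
  fixes T :: "('v, 'a) xtree"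
  assumes "finite_graph T"
  shows "pruning T = {R. finite_graph R \<and> pruned R \<and> hom_equiv T R}"
proof -
  have fin: "finite_graph (map_xtree r T)" for r
    using assms by (rule finite_graph_map_xtree)
  have 1: "finite_graph R \<and> pruned R \<and> hom_equiv T R"
    if "retraction T r" "pruned (map_xtree r T)" "xtree_iso (map_xtree r T) R" for r and R :: "(nat, 'a) xtree"
    using that fin
    by (meson hom_equiv_trans pruned_iso retraction_hom_equiv xtree_iso_finite_graph xtree_iso_hom_equiv)
  have 2: "\<exists>r. retraction T r \<and> pruned (map_xtree r T) \<and> xtree_iso (map_xtree r T) R"
    if "finite_graph R" "pruned R" "hom_equiv T R" for R :: "(nat, 'a) xtree"
    using pruned_retract_exists[OF assms] that fin
    by (meson hom_equiv_sym hom_equiv_trans pruned_hom_equiv_iso retraction_hom_equiv)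
  show ?thesis
  proof (intro Set.set_eqI iffI)
    fix R :: "(nat, 'a) xtree"
    assume "R \<in> pruning T"
    then obtain r where "retraction T r" "pruned (map_xtree r T)" "xtree_iso (map_xtree r T) R"
      unfolding pruning_def iso_type_def by blast
    from 1[OF this] show "R \<in> {R. finite_graph R \<and> pruned R \<and> hom_equiv T R}" by simp
  next
    fix R :: "(nat, 'a) xtree"
    assume "R \<in> {R. finite_graph R \<and> pruned R \<and> hom_equiv T R}"
    then show "R \<in> pruning T"
      using 2[of R] unfolding pruning_def iso_type_def by auto
  qed
qed

lemma pruning_nonempty: "finite_graph T \<Longrightarrow> pruning T \<noteq> {}"
proof -
  assume T: "finite_graph T"
  then obtain r where r: "retraction T r" "pruned (map_xtree r T)"
    using pruned_retract_exists by blast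
  obtain R :: "(nat, _) xtree" where "xtree_iso (map_xtree r T) R"
    using iso_nat_copy finite_graph_map_xtree[OF T] by metis
  then show ?thesis using r unfolding pruning_def iso_type_def by blast
qed

lemma iso_type_pruned:
  assumes "finite_graph T" "pruned T"
  shows "iso_type T = pruning T"
  unfolding pruning_eq[OF assms(1)] iso_type_def
  using assms by (meson pruned_hom_equiv_iso pruned_iso xtree_iso_finite_graph xtree_iso_hom_equiv)

lemma pruning_cong:
  assumes "finite_graph S" "finite_graph T" "hom_equiv S T"
  shows "pruning S = pruning T"
proof -
  have "hom_equiv S R \<longleftrightarrow> hom_equiv T R" for R :: "(nat, 'b) xtree"
    using hom_equiv_trans[OF assms(3), of R] hom_equiv_trans[OF hom_equiv_sym[OF assms(3)], of R]
    by blast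
  then show ?thesis using assms by (simp add: pruning_eq)
qed


section \<open>Trees are connected graphs all of whose edges are bridges\<close>

text \<open>
  The set \<open>C\<close> is the side of the cut that contains the head of the edge. Such cuts extend easily when
  graphs are mapped or glued, which cycles do not.
\<close>

definition all_bridges :: "('v, 'a) xtree \<Rightarrow> bool" where
  "all_bridges T \<longleftrightarrow> (\<forall>s x v. (s, x, v) \<in> edges T \<longrightarrow> (\<exists>C. v \<in> C \<and> s \<notin> C \<and>
     (\<forall>a y b. (a, y, b) \<in> edges T \<longrightarrow> (a, y, b) \<noteq> (s, x, v) \<longrightarrow> (a \<in> C \<longleftrightarrow> b \<in> C))))"

definition connected_graph :: "('v, 'a) xtree \<Rightarrow> bool" where
  "connected_graph T \<longleftrightarrow> (\<forall>u\<in>verts T. \<forall>v\<in>verts T. (u, v) \<in> (undir_adj T)\<^sup>*)"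

lemma all_bridgesE:
  assumes "all_bridges T" "(s, x, v) \<in> edges T"
  obtains C where "v \<in> C" "s \<notin> C"
    "\<And>a y b. (a, y, b) \<in> edges T \<Longrightarrow> (a, y, b) \<noteq> (s, x, v) \<Longrightarrow> (a \<in> C \<longleftrightarrow> b \<in> C)"
proof -
  have "\<exists>C. v \<in> C \<and> s \<notin> C \<and>
     (\<forall>a y b. (a, y, b) \<in> edges T \<longrightarrow> (a, y, b) \<noteq> (s, x, v) \<longrightarrow> (a \<in> C \<longleftrightarrow> b \<in> C))"
    using assms(1)[unfolded all_bridges_def, rule_format, OF assms(2)] .
  then show ?thesis using that by (elim exE conjE) metis
qed

lemma joins_vertices: "joins e a b \<Longrightarrow> joins e c d \<Longrightarrow> {a, b} = {c, d}"
  by (auto simp: joins_def)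

text \<open>
  A cycle leaves a set of vertices as often as it enters it, so it cannot contain the only edge
  between the set and its complement.
\<close>

lemma all_bridges_imp_acyclic:
  assumes "all_bridges T"
  shows "\<not> undir_cycle T es vs"
proof
  assume cyc: "undir_cycle T es vs"
  define n where "n = length es"
  have n: "n > 0" "length vs = n" and es: "distinct es" "set es \<subseteq> edges T"
    and joins: "\<And>i. i < n \<Longrightarrow> joins (es ! i) (vs ! i) (vs ! (Suc i mod n))"
    using cyc unfolding undir_cycle_def n_def by simp_all
  obtain s x v where e: "es ! 0 = (s, x, v)" by (cases "es ! 0")
  have "(s, x, v) \<in> edges T" using es n e by (metis n_def nth_mem subsetD)
  then obtain C where C: "v \<in> C" "s \<notin> C"
    "\<And>a y b. (a, y, b) \<in> edges T \<Longrightarrow> (a, y, b) \<noteq> (s, x, v) \<Longrightarrow> (a \<in> C \<longleftrightarrow> b \<in> C)"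
    by (rule all_bridgesE[OF assms]) blast
  have step: "vs ! i \<in> C \<longleftrightarrow> vs ! (Suc i mod n) \<in> C" if "0 < i" "i < n" for i
  proof -
    obtain a y b where i: "es ! i = (a, y, b)" by (cases "es ! i")
    have "es ! i \<in> edges T" using es that by (metis n_def nth_mem subsetD)
    moreover have "es ! i \<noteq> es ! 0"
      using es(1) that n by (simp add: nth_eq_iff_index_eq n_def)
    ultimately have "a \<in> C \<longleftrightarrow> b \<in> C" using C(3) i e by metis
    then show ?thesis using joins[OF that(2)] i by (auto simp: joins_def)
  qed
  \<comment> \<open>no edge other than the first one crosses the cut, so all vertices from index 1 around to index 0 are on one side\<close>
  have around: "vs ! (Suc i mod n) \<in> C \<longleftrightarrow> vs ! (Suc 0 mod n) \<in> C" if "i < n" for i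
    using that
  proof (induction i)
    case (Suc i)
    then show ?case using step[of "Suc i"] by simp
  qed simp
  have "vs ! 0 \<in> C \<longleftrightarrow> vs ! (Suc 0 mod n) \<in> C"
    using around[of "n - 1"] n by simp
  then show False
    using joins[OF n(1)] e C by (auto simp: joins_def)
qed

text \<open>
  Conversely, the vertices that can be reached from the head of an edge without using this edge
  form a cut. They do not include the tail, since a simple path to the tail would close to a cycle.
\<close>

lemma acyclic_imp_all_bridges:
  assumes acyc: "\<nexists>es vs. undir_cycle T es vs"
  shows "all_bridges T"
  unfolding all_bridges_def
proof (intro allI impI)
  fix s x v assume e: "(s, x, v) \<in> edges T"
  define r where "r a b \<longleftrightarrow> (\<exists>e'\<in>edges T - {(s, x, v)}. joins e' a b)" for a b
  define C where "C = {z. r\<^sup>*\<^sup>* v z}"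
  have "s \<notin> C"
  proof
    assume "s \<in> C"
    then obtain xs0 where "rtrancl_path r v xs0 s"
      by (auto simp: C_def rtranclp_eq_rtrancl_path)
    then obtain xs where xs: "rtrancl_path r v xs s" "distinct (v # xs)"
      by (rule rtrancl_path_distinct) blast
    let ?vs = "v # xs" and ?n = "length xs"
    have "\<forall>i<?n. \<exists>e'. e' \<in> edges T - {(s, x, v)} \<and> joins e' (?vs ! i) (?vs ! Suc i)"
      using rtrancl_path_nth[OF xs(1)] unfolding r_def Bex_def nth_Cons_Suc by blast
    then obtain d where d: "\<And>i. i < ?n \<Longrightarrow> d i \<in> edges T - {(s, x, v)}"
      "\<And>i. i < ?n \<Longrightarrow> joins (d i) (?vs ! i) (?vs ! Suc i)"
      by metis
    let ?es = "map d [0..<?n] @ [(s, x, v)]"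
    have vs_inj: "?vs ! i = ?vs ! j \<longleftrightarrow> i = j" if "i \<le> ?n" "j \<le> ?n" for i j
      using xs(2) that by (simp add: nth_eq_iff_index_eq del: distinct.simps nth_Cons_Suc)
    have "inj_on d {0..<?n}"
    proof (rule inj_onI)
      fix i j assume ij: "i \<in> {0..<?n}" "j \<in> {0..<?n}" "d i = d j"
      then have "{?vs ! i, ?vs ! Suc i} = {?vs ! j, ?vs ! Suc j}"
        using d(2)[of i] d(2)[of j] joins_vertices by (metis atLeastLessThan_iff)
      then have "?vs ! i = ?vs ! j \<or> ?vs ! i = ?vs ! Suc j \<and> ?vs ! Suc i = ?vs ! j"
        by (auto simp only: doubleton_eq_iff)
      then show "i = j"
        using vs_inj[of i j] vs_inj[of i "Suc j"] vs_inj[of "Suc i" j] ij by auto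
    qed
    moreover have "(s, x, v) \<notin> set (map d [0..<?n])" using d(1) by fastforce
    ultimately have "distinct ?es" by (simp add: distinct_map)
    moreover have "set ?es \<subseteq> edges T" using d(1) e by auto
    moreover have "joins (?es ! i) (?vs ! i) (?vs ! (Suc i mod length ?es))" if "i < length ?es" for i
    proof (cases "i < ?n")
      case True
      then show ?thesis using d(2)[of i] by (simp add: nth_append)
    next
      case False
      then have "i = ?n" using that by simp
      moreover have "?vs ! ?n = s"
        using rtrancl_path_last[OF xs(1)] xs(1)
        by (cases xs rule: rev_cases) (auto simp: nth_append elim: rtrancl_path.cases)
      ultimately show ?thesis by (auto simp: nth_append joins_def)
    qed
    ultimately have "undir_cycle T ?es ?vs"
      using xs(2) by (simp add: undir_cycle_def)
    then show False using acyc by blast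
  qed
  moreover have "v \<in> C" by (simp add: C_def)
  moreover have "a \<in> C \<longleftrightarrow> b \<in> C" if "(a, y, b) \<in> edges T" "(a, y, b) \<noteq> (s, x, v)" for a y b
  proof -
    have "joins (a, y, b) a b" "joins (a, y, b) b a" by (auto simp: joins_def)
    then have "r a b" "r b a" using that by (auto simp only: r_def)
    then show ?thesis unfolding C_def by (auto intro: rtranclp.rtrancl_into_rtrancl)
  qed
  ultimately show "\<exists>C. v \<in> C \<and> s \<notin> C \<and>
     (\<forall>a y b. (a, y, b) \<in> edges T \<longrightarrow> (a, y, b) \<noteq> (s, x, v) \<longrightarrow> (a \<in> C \<longleftrightarrow> b \<in> C))"
    by blast
qed

lemma is_xtree_iff:
  "is_xtree X T \<longleftrightarrow> finite_graph T \<and> (\<forall>u x v. (u, x, v) \<in> edges T \<longrightarrow> x \<in> X) \<and>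
     connected_graph T \<and> all_bridges T \<and> (src T, tgt T) \<in> (dir_adj T)\<^sup>*"
proof -
  have "(\<nexists>es vs. undir_cycle T es vs) \<longleftrightarrow> all_bridges T"
    using all_bridges_imp_acyclic acyclic_imp_all_bridges by blast
  moreover have "edges T \<subseteq> verts T \<times> X \<times> verts T \<longleftrightarrow>
      (\<forall>u x v. (u, x, v) \<in> edges T \<longrightarrow> u \<in> verts T \<and> v \<in> verts T) \<and>
      (\<forall>u x v. (u, x, v) \<in> edges T \<longrightarrow> x \<in> X)"
    by fast
  ultimately show ?thesis
    unfolding is_xtree_def finite_graph_def connected_graph_def by blast
qed

lemma is_xtree_finite_graph: "is_xtree X T \<Longrightarrow> finite_graph T"
  by (simp add: is_xtree_iff)

lemma connected_graph_induct:
  assumes "connected_graph T" "u \<in> verts T" "v \<in> verts T" "P u"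
    and "\<And>a x b. (a, x, b) \<in> edges T \<Longrightarrow> P a \<longleftrightarrow> P b"
  shows "P v"
proof -
  have "(u, v) \<in> (undir_adj T)\<^sup>*" using assms by (simp add: connected_graph_def)
  then show ?thesis
  proof induction
    case base
    show ?case by (rule assms)
  next
    case (step y z)
    then show ?case using assms(5) by (auto simp: undir_adj_def dir_adj_def)
  qed
qed

lemma dir_adj_map: "(u, v) \<in> (dir_adj T)\<^sup>* \<Longrightarrow> (f u, f v) \<in> (dir_adj (map_xtree f T))\<^sup>*"
proof (induction rule: rtrancl_induct)
  case (step y z)
  from step(2) have "(f y, f z) \<in> dir_adj (map_xtree f T)"
    by (force simp: dir_adj_def map_xtree_def)
  with step(3) show ?case by (rule rtrancl_into_rtrancl)
qed simp

lemma undir_adj_map: "(u, v) \<in> (undir_adj T)\<^sup>* \<Longrightarrow> (f u, f v) \<in> (undir_adj (map_xtree f T))\<^sup>*"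
proof (induction rule: rtrancl_induct)
  case (step y z)
  from step(2) have "(f y, f z) \<in> undir_adj (map_xtree f T)"
    by (force simp: undir_adj_def dir_adj_def map_xtree_def)
  with step(3) show ?case by (rule rtrancl_into_rtrancl)
qed simp

text \<open>
  Identifying vertices can only destroy acyclicity; the other conditions pass to images.
\<close>

lemma is_xtree_map_xtree:
  assumes "is_xtree X T" "all_bridges (map_xtree f T)"
  shows "is_xtree X (map_xtree f T)"
proof -
  have "connected_graph (map_xtree f T)"
    using assms(1) undir_adj_map[of _ _ T f]
    by (auto simp: is_xtree_iff connected_graph_def map_xtree_def)
  moreover have "(src (map_xtree f T), tgt (map_xtree f T)) \<in> (dir_adj (map_xtree f T))\<^sup>*"
    using assms(1) dir_adj_map[of "src T" "tgt T" T f] by (simp add: is_xtree_iff map_xtree_def)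
  moreover have "(u, x, v) \<in> edges (map_xtree f T) \<Longrightarrow> x \<in> X" for u x v
    using assms(1) by (auto simp: is_xtree_iff map_xtree_def)
  ultimately show ?thesis
    using assms finite_graph_map_xtree by (auto simp: is_xtree_iff)
qed

lemma is_xtree_iso:
  assumes T: "is_xtree X T" and "xtree_iso T R"
  shows "is_xtree X R"
proof -
  obtain f where f: "inj_on f (verts T)" and R: "R = map_xtree f T"
    using assms(2) by (auto simp: xtree_iso_def)
  have V: "a \<in> verts T \<and> b \<in> verts T" if "(a, y, b) \<in> edges T" for a y b
    using that T by (auto simp: is_xtree_iff finite_graph_def)
  have "all_bridges (map_xtree f T)"
    unfolding all_bridges_def
  proof (intro allI impI)
    fix s' x v' assume "(s', x, v') \<in> edges (map_xtree f T)"
    then obtain s v where e: "(s, x, v) \<in> edges T" and [simp]: "s' = f s" "v' = f v"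
      by (auto simp: map_xtree_def)
    obtain C where C: "v \<in> C" "s \<notin> C"
      "\<And>a y b. (a, y, b) \<in> edges T \<Longrightarrow> (a, y, b) \<noteq> (s, x, v) \<Longrightarrow> (a \<in> C \<longleftrightarrow> b \<in> C)"
      using all_bridgesE[OF _ e] T unfolding is_xtree_iff by metis
    let ?C = "f ` (C \<inter> verts T)"
    have mem: "f a \<in> ?C \<longleftrightarrow> a \<in> C" if "a \<in> verts T" for a
      using that f by (auto dest: inj_onD)
    show "\<exists>C. v' \<in> C \<and> s' \<notin> C \<and> (\<forall>a y b. (a, y, b) \<in> edges (map_xtree f T) \<longrightarrow>
            (a, y, b) \<noteq> (s', x, v') \<longrightarrow> (a \<in> C \<longleftrightarrow> b \<in> C))"
    proof (intro exI[of _ ?C] conjI allI impI)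
      fix a' y b' assume "(a', y, b') \<in> edges (map_xtree f T)" "(a', y, b') \<noteq> (s', x, v')"
      then obtain a b where "(a, y, b) \<in> edges T" "(a, y, b) \<noteq> (s, x, v)" "a' = f a" "b' = f b"
        by (auto simp: map_xtree_def)
      then show "a' \<in> ?C \<longleftrightarrow> b' \<in> ?C" using C(3) V mem by metis
    qed (use C V[OF e] mem in auto)
  qed
  then show ?thesis using is_xtree_map_xtree[OF T] R by simp
qed

lemma is_xtree_retract:
  assumes "is_xtree X T" "retraction T r"
  shows "is_xtree X (map_xtree r T)"
proof -
  have "edges (map_xtree r T) \<subseteq> edges T"
    using assms(2) by (auto simp: retraction_def xtree_mor_def map_xtree_def)
  then have "all_bridges (map_xtree r T)"
    using assms(1) unfolding is_xtree_iff all_bridges_def by (meson subsetD)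
  then show ?thesis using is_xtree_map_xtree assms(1) by blast
qed

lemma is_xtree_pruning: "is_xtree X T \<Longrightarrow> R \<in> pruning T \<Longrightarrow> is_xtree X R"
  unfolding pruning_def iso_type_def using is_xtree_retract is_xtree_iso by blast

lemma is_xtree_reroot:
  assumes "is_xtree X T" "s \<in> verts T" "t \<in> verts T" "(s, t) \<in> (dir_adj T)\<^sup>*"
  shows "is_xtree X (T\<lparr>src := s, tgt := t\<rparr>)"
  using assms by (simp add: is_xtree_def undir_cycle_def dir_adj_def undir_adj_def)

lemma undir_adj_sym: "(u, v) \<in> (undir_adj T)\<^sup>* \<Longrightarrow> (v, u) \<in> (undir_adj T)\<^sup>*"
proof -
  have "(undir_adj T)\<inverse> = undir_adj T" by (auto simp: undir_adj_def)
  then show "(u, v) \<in> (undir_adj T)\<^sup>* \<Longrightarrow> (v, u) \<in> (undir_adj T)\<^sup>*"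
    by (metis rtrancl_converseI)
qed

text \<open>
  A cut for an edge of one tree becomes a cut of the glued tree when the other tree is placed
  entirely on the side of the gluing vertex.
\<close>

lemma is_xtree_glue:
  assumes S: "is_xtree X S" and T: "is_xtree X T"
  shows "is_xtree X (glue S T)"
proof -
  define k where "k = (\<lambda>v. if v = src T then Inl (tgt S) else Inr v)"
  let ?S = "map_xtree Inl S" and ?T = "map_xtree k T" and ?U = "glue S T"
  have U: "verts ?U = verts ?S \<union> verts ?T" "edges ?U = edges ?S \<union> edges ?T"
    "src ?U = Inl (src S)" "tgt ?U = k (tgt T)"
    by (simp_all add: glue_def k_def Let_def map_xtree_def)
  have k0: "k (src T) = Inl (tgt S)" by (simp add: k_def)
  have fin: "tgt S \<in> verts S" "src T \<in> verts T"
    using S T by (auto simp: is_xtree_iff finite_graph_def)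
  have "finite_graph ?S" "finite_graph ?T"
    using S T by (auto intro: finite_graph_map_xtree is_xtree_finite_graph)
  moreover have "src ?U = src ?S" "tgt ?U = tgt ?T"
    by (simp_all add: U map_xtree_def)
  ultimately have "finite_graph ?U"
    by (auto simp: finite_graph_def U(1,2))
  moreover have "(u, x, v) \<in> edges ?U \<Longrightarrow> x \<in> X" for u x v
    using S T unfolding is_xtree_iff U map_xtree_def by auto blast+
  moreover have "(src ?U, tgt ?U) \<in> (dir_adj ?U)\<^sup>*"
  proof -
    have "dir_adj ?S \<subseteq> dir_adj ?U" "dir_adj ?T \<subseteq> dir_adj ?U" by (auto simp: dir_adj_def U)
    moreover have "(Inl (src S), Inl (tgt S)) \<in> (dir_adj ?S)\<^sup>*"
      using S dir_adj_map by (metis is_xtree_iff)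
    moreover have "(k (src T), k (tgt T)) \<in> (dir_adj ?T)\<^sup>*"
      using T dir_adj_map by (metis is_xtree_iff)
    ultimately show ?thesis
      unfolding U k0 by (meson rtrancl_mono rtrancl_trans subsetD)
  qed
  moreover have "connected_graph ?U"
  proof -
    have mono: "(undir_adj ?S)\<^sup>* \<subseteq> (undir_adj ?U)\<^sup>*" "(undir_adj ?T)\<^sup>* \<subseteq> (undir_adj ?U)\<^sup>*"
      by (intro rtrancl_mono; auto simp: dir_adj_def undir_adj_def U)+
    have "(w, Inl (tgt S)) \<in> (undir_adj ?U)\<^sup>*" if w: "w \<in> verts ?U" for w
    proof -
      consider u where "w = Inl u" "u \<in> verts S" | u where "w = k u" "u \<in> verts T"
        using w by (auto simp: U map_xtree_def)
      then show ?thesis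
      proof cases
        case 1
        then have "(u, tgt S) \<in> (undir_adj S)\<^sup>*"
          using S fin by (simp add: is_xtree_iff connected_graph_def)
        from undir_adj_map[OF this, of Inl] show ?thesis using 1 mono by auto
      next
        case 2
        then have "(u, src T) \<in> (undir_adj T)\<^sup>*"
          using T fin by (simp add: is_xtree_iff connected_graph_def)
        from undir_adj_map[OF this, of k] show ?thesis using 2 mono k0 by auto
      qed
    qed
    then show ?thesis
      unfolding connected_graph_def by (meson rtrancl_trans undir_adj_sym)
  qed
  moreover have "all_bridges ?U"
    unfolding all_bridges_def
  proof (intro allI impI)
    fix s' x v' assume "(s', x, v') \<in> edges ?U"
    then consider
      (S) s v where "(s, x, v) \<in> edges S" "s' = Inl s" "v' = Inl v" |
      (T) s v where "(s, x, v) \<in> edges T" "s' = k s" "v' = k v"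
      by (auto simp: U map_xtree_def)
    then show "\<exists>C. v' \<in> C \<and> s' \<notin> C \<and> (\<forall>a y b. (a, y, b) \<in> edges ?U \<longrightarrow>
            (a, y, b) \<noteq> (s', x, v') \<longrightarrow> (a \<in> C \<longleftrightarrow> b \<in> C))"
    proof cases
      case S': S
      obtain C where C: "v \<in> C" "s \<notin> C"
        "\<And>a y b. (a, y, b) \<in> edges S \<Longrightarrow> (a, y, b) \<noteq> (s, x, v) \<Longrightarrow> (a \<in> C \<longleftrightarrow> b \<in> C)"
        using all_bridgesE[OF _ S'(1)] S unfolding is_xtree_iff by metis
      let ?C = "{z. case z of Inl u \<Rightarrow> u \<in> C | Inr w \<Rightarrow> tgt S \<in> C}"
      have kC: "k u \<in> ?C \<longleftrightarrow> tgt S \<in> C" for u by (simp add: k_def)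
      show ?thesis
      proof (intro exI[of _ ?C] conjI allI impI)
        show "v' \<in> ?C" "s' \<notin> ?C" using C(1,2) kC S'(2,3) by auto
        fix a' y b' assume e: "(a', y, b') \<in> edges ?U" and ne: "(a', y, b') \<noteq> (s', x, v')"
        then consider
          (1) a b where "(a, y, b) \<in> edges S" "a' = Inl a" "b' = Inl b" |
          (2) a b where "(a, y, b) \<in> edges T" "a' = k a" "b' = k b"
          by (auto simp: U map_xtree_def)
        then show "a' \<in> ?C \<longleftrightarrow> b' \<in> ?C"
        proof cases
          case 1
          then show ?thesis using C(3)[of a y b] S'(2,3) ne by auto
        next
          case 2
          then show ?thesis unfolding 2 kC by simp
        qed
      qed
    next
      case T': T
      obtain C where C: "v \<in> C" "s \<notin> C"
        "\<And>a y b. (a, y, b) \<in> edges T \<Longrightarrow> (a, y, b) \<noteq> (s, x, v) \<Longrightarrow> (a \<in> C \<longleftrightarrow> b \<in> C)"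
        using all_bridgesE[OF _ T'(1)] T unfolding is_xtree_iff by metis
      let ?C = "{z. case z of Inl u \<Rightarrow> src T \<in> C | Inr w \<Rightarrow> w \<in> C}"
      have kC: "k u \<in> ?C \<longleftrightarrow> u \<in> C" for u by (simp add: k_def)
      show ?thesis
      proof (intro exI[of _ ?C] conjI allI impI)
        show "v' \<in> ?C" "s' \<notin> ?C" using C(1,2) kC T'(2,3) by auto
        fix a' y b' assume e: "(a', y, b') \<in> edges ?U" and ne: "(a', y, b') \<noteq> (s', x, v')"
        then consider
          (1) a b where "(a, y, b) \<in> edges S" "a' = Inl a" "b' = Inl b" |
          (2) a b where "(a, y, b) \<in> edges T" "a' = k a" "b' = k b"
          by (auto simp: U map_xtree_def)
        then show "a' \<in> ?C \<longleftrightarrow> b' \<in> ?C"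
        proof cases
          case 1
          then show ?thesis by simp
        next
          case 2
          then show ?thesis using C(3)[of a y b] T'(2,3) ne unfolding 2 kC by auto
        qed
      qed
    qed
  qed
  ultimately show ?thesis by (simp add: is_xtree_iff)
qed

text \<open>Every edge crosses exactly its own cut, so counting the cuts around a vertex gives a grading.\<close>

lemma xtree_grading:
  assumes "is_xtree X T"
  obtains l :: "'v \<Rightarrow> int" where "\<And>u x v. (u, x, v) \<in> edges (T :: ('v, 'a) xtree) \<Longrightarrow> l v = l u + 1"
proof -
  have "\<forall>e\<in>edges T. \<exists>C. snd (snd e) \<in> C \<and> fst e \<notin> C \<and>
     (\<forall>a y b. (a, y, b) \<in> edges T \<longrightarrow> (a, y, b) \<noteq> e \<longrightarrow> (a \<in> C \<longleftrightarrow> b \<in> C))"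
    using assms unfolding is_xtree_iff all_bridges_def by auto
  then obtain C where C: "\<forall>e\<in>edges T. snd (snd e) \<in> C e \<and> fst e \<notin> C e \<and>
     (\<forall>a y b. (a, y, b) \<in> edges T \<longrightarrow> (a, y, b) \<noteq> e \<longrightarrow> (a \<in> C e \<longleftrightarrow> b \<in> C e))"
    by metis
  define l where "l z = int (card {e \<in> edges T. z \<in> C e})" for z
  have "l v = l u + 1" if e: "(u, x, v) \<in> edges T" for u x v
  proof -
    have "{e \<in> edges T. v \<in> C e} = insert (u, x, v) {e \<in> edges T. u \<in> C e}"
      using C e by fastforce
    moreover have "(u, x, v) \<notin> {e \<in> edges T. u \<in> C e}" using C e by fastforce
    moreover have "finite (edges T)" using assms by (simp add: is_xtree_def)
    ultimately show ?thesis by (simp add: l_def)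
  qed
  then show ?thesis by (rule that)
qed


section \<open>Trees as binary relations on graphs\<close>

text \<open>
  The relation consists of the images of the pair (start, end) under all homomorphisms from \<open>T\<close>
  into the graph with the set \<open>G\<close> of labelled edges. It is enough to record the edges of a graph: a
  connected source whose start goes to a vertex of the graph stays among its vertices.
\<close>

definition den :: "('v, 'a) xtree \<Rightarrow> ('g \<times> 'a \<times> 'g) set \<Rightarrow> ('g \<times> 'g) set" where
  "den T G = {(f (src T), f (tgt T)) | f. \<forall>u x v. (u, x, v) \<in> edges T \<longrightarrow> (f u, x, f v) \<in> G}"

lemma denI: "(\<And>u x v. (u, x, v) \<in> edges T \<Longrightarrow> (f u, x, f v) \<in> G) \<Longrightarrow> f (src T) = p \<Longrightarrow> f (tgt T) = q
    \<Longrightarrow> (p, q) \<in> den T G"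
  by (auto simp: den_def)

lemma denE:
  assumes "(p, q) \<in> den T G"
  obtains f where "\<And>u x v. (u, x, v) \<in> edges T \<Longrightarrow> (f u, x, f v) \<in> G" "f (src T) = p" "f (tgt T) = q"
  using assms by (auto simp: den_def)

lemma den_mor:
  assumes "xtree_mor S T h"
  shows "den T G \<subseteq> den S G"
proof (intro subrelI)
  fix p q assume "(p, q) \<in> den T G"
  then obtain f where "\<And>u x v. (u, x, v) \<in> edges T \<Longrightarrow> (f u, x, f v) \<in> G" "f (src T) = p" "f (tgt T) = q"
    by (rule denE) blast
  then show "(p, q) \<in> den S G"
    using assms by (intro denI[where f = "\<lambda>v. f (h v)"]) (auto simp: xtree_mor_def)
qed

lemma den_hom_equiv: "hom_equiv S T \<Longrightarrow> den S G = den T G"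
  unfolding hom_equiv_def by (elim conjE exE) (intro equalityI den_mor; assumption)

lemma mor_iff_den:
  assumes "is_xtree X S" "finite_graph T"
  shows "(\<exists>f. xtree_mor S T f) \<longleftrightarrow> (src T, tgt T) \<in> den S (edges T)"
proof
  assume "(src T, tgt T) \<in> den S (edges T)"
  then obtain f where f: "\<And>u x v. (u, x, v) \<in> edges S \<Longrightarrow> (f u, x, f v) \<in> edges T"
    "f (src S) = src T" "f (tgt S) = tgt T"
    by (rule denE) blast
  have "f v \<in> verts T" if "v \<in> verts S" for v
  proof (rule connected_graph_induct[where P = "\<lambda>v. f v \<in> verts T" and T = S and u = "src S"])
    show "connected_graph S" "src S \<in> verts S" using assms by (auto simp: is_xtree_iff finite_graph_def)
    show "f a \<in> verts T \<longleftrightarrow> f b \<in> verts T" if "(a, x, b) \<in> edges S" for a x b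
      using f(1)[OF that] assms by (auto simp: finite_graph_def)
  qed (use f assms that in \<open>auto simp: finite_graph_def\<close>)
  then show "\<exists>f. xtree_mor S T f" using f unfolding xtree_mor_def by blast
next
  assume "\<exists>f. xtree_mor S T f"
  then show "(src T, tgt T) \<in> den S (edges T)" by (auto simp: xtree_mor_def den_def) metis
qed

lemma hom_equiv_iff_den:
  assumes "is_xtree X S" "is_xtree X T"
    and "den S (edges S) = den T (edges S)" "den S (edges T) = den T (edges T)"
  shows "hom_equiv S T"
proof -
  have "(src S, tgt S) \<in> den S (edges S)" "(src T, tgt T) \<in> den T (edges T)"
    by (rule denI[where f = "\<lambda>v. v"]; simp)+
  then show ?thesis
    using assms mor_iff_den[of X S T] mor_iff_den[of X T S] is_xtree_finite_graph
    unfolding hom_equiv_def by metis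
qed

text \<open>
  The glued tree is the pushout over the gluing vertex.
\<close>

lemma den_glue: "den (glue S T) G = den S G O den T G"
proof (intro equalityI subrelI)
  let ?k = "\<lambda>v. if v = src T then Inl (tgt S) else Inr v"
  fix p q assume "(p, q) \<in> den (glue S T) G"
  then obtain f where f: "\<And>u x v. (u, x, v) \<in> edges (glue S T) \<Longrightarrow> (f u, x, f v) \<in> G"
    "f (src (glue S T)) = p" "f (tgt (glue S T)) = q"
    by (rule denE) blast
  have "(p, f (Inl (tgt S))) \<in> den S G"
    using f by (intro denI[where f = "\<lambda>v. f (Inl v)"]) (force simp: glue_def map_xtree_def Let_def)+
  moreover have "(f (Inl (tgt S)), q) \<in> den T G"
  proof (rule denI[where f = "\<lambda>v. f (?k v)"])
    show "(f (?k u), x, f (?k v)) \<in> G" if "(u, x, v) \<in> edges T" for u x v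
    proof (rule f(1))
      have "(?k u, x, ?k v) \<in> (\<lambda>(u, x, v). (?k u, x, ?k v)) ` edges T"
        using that by (intro image_eqI[OF _ that]) auto
      then show "(?k u, x, ?k v) \<in> edges (glue S T)"
        by (simp add: glue_def map_xtree_def Let_def)
    qed
  qed (use f in \<open>auto simp: glue_def map_xtree_def Let_def\<close>)
  ultimately show "(p, q) \<in> den S G O den T G" by blast
next
  fix p q assume "(p, q) \<in> den S G O den T G"
  then obtain m where "(p, m) \<in> den S G" "(m, q) \<in> den T G" by blast
  then obtain f g where
    f: "\<And>u x v. (u, x, v) \<in> edges S \<Longrightarrow> (f u, x, f v) \<in> G" "f (src S) = p" "f (tgt S) = m" and
    g: "\<And>u x v. (u, x, v) \<in> edges T \<Longrightarrow> (g u, x, g v) \<in> G" "g (src T) = m" "g (tgt T) = q"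
    by (metis denE)
  have "case_sum f g (if v = src T then Inl (tgt S) else Inr v) = g v" for v
    using f g by simp
  then show "(p, q) \<in> den (glue S T) G"
    using f g by (intro denI[where f = "case_sum f g"]) (auto simp: glue_def map_xtree_def Let_def simp del: if_splits)
qed

lemma den_plus: "den (T\<lparr>tgt := src T\<rparr>) G = Id_on (Domain (den T G))"
  by (auto simp: den_def)

lemma den_star: "den (T\<lparr>src := tgt T\<rparr>) G = Id_on (Range (den T G))"
  by (auto simp: den_def)

text \<open>
  The tree need not be taken apart at the edge from \<open>s\<close> to \<open>v\<close>: two homomorphisms on the whole tree,
  one with a prescribed value at \<open>s\<close> and one at \<open>v\<close>, are combined along the cut of this edge. The
  edge is directed into the cut, so a directed path that starts in the cut stays there. Hence the
  combined map agrees with the second homomorphism at \<open>t\<close>.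
\<close>

lemma den_cut:
  assumes T: "is_xtree X T" and e: "(s, x, v) \<in> edges T" and vt: "(v, t) \<in> (dir_adj T)\<^sup>*"
  shows "den (T\<lparr>src := s, tgt := t\<rparr>) G =
    den (T\<lparr>src := s, tgt := s\<rparr>) G O {(p, q). (p, x, q) \<in> G} O den (T\<lparr>src := v, tgt := t\<rparr>) G"
proof (intro equalityI subrelI)
  fix p q assume "(p, q) \<in> den (T\<lparr>src := s, tgt := t\<rparr>) G"
  then obtain f where f: "\<And>u x v. (u, x, v) \<in> edges T \<Longrightarrow> (f u, x, f v) \<in> G" "f s = p" "f t = q"
    by (auto simp: den_def)
  have "(p, p) \<in> den (T\<lparr>src := s, tgt := s\<rparr>) G" "(f v, q) \<in> den (T\<lparr>src := v, tgt := t\<rparr>) G"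
    using f by (auto intro!: denI[where f = f])
  moreover have "(p, x, f v) \<in> G" using f e by auto
  ultimately show "(p, q) \<in> den (T\<lparr>src := s, tgt := s\<rparr>) G O {(p, q). (p, x, q) \<in> G} O den (T\<lparr>src := v, tgt := t\<rparr>) G"
    by blast
next
  fix p q assume "(p, q) \<in> den (T\<lparr>src := s, tgt := s\<rparr>) G O {(p, q). (p, x, q) \<in> G} O den (T\<lparr>src := v, tgt := t\<rparr>) G"
  then obtain p' m where "(p, p') \<in> den (T\<lparr>src := s, tgt := s\<rparr>) G" "(p', x, m) \<in> G"
    "(m, q) \<in> den (T\<lparr>src := v, tgt := t\<rparr>) G"
    by blast
  then obtain f g where
    f: "\<And>u x v. (u, x, v) \<in> edges T \<Longrightarrow> (f u, x, f v) \<in> G" "f s = p" and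
    g: "\<And>u x v. (u, x, v) \<in> edges T \<Longrightarrow> (g u, x, g v) \<in> G" "g v = m" "g t = q" and
    pm: "(p, x, m) \<in> G"
    by (auto simp: den_def)
  obtain C where C: "v \<in> C" "s \<notin> C"
    "\<And>a y b. (a, y, b) \<in> edges T \<Longrightarrow> (a, y, b) \<noteq> (s, x, v) \<Longrightarrow> (a \<in> C \<longleftrightarrow> b \<in> C)"
    using all_bridgesE[OF _ e] T unfolding is_xtree_iff by metis
  have "t \<in> C"
    using vt
  proof induction
    case (step y z)
    then show ?case using C by (auto simp: dir_adj_def)
  qed (rule C)
  let ?h = "\<lambda>z. if z \<in> C then g z else f z"
  show "(p, q) \<in> den (T\<lparr>src := s, tgt := t\<rparr>) G"
  proof (rule denI[where f = ?h])
    fix a y b assume ab: "(a, y, b) \<in> edges (T\<lparr>src := s, tgt := t\<rparr>)"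
    show "(?h a, y, ?h b) \<in> G"
    proof (cases "(a, y, b) = (s, x, v)")
      case True
      then show ?thesis using C f g pm by auto
    next
      case False
      then show ?thesis using C(3)[of a y b] ab f(1)[of a y b] g(1)[of a y b] by auto
    qed
  qed (use C \<open>t \<in> C\<close> f g in auto)
qed


section \<open>The relational representation of the free Ehresmann monoid\<close>

definition fe_rel :: "'a fe \<Rightarrow> ('g \<times> 'a \<times> 'g) set \<Rightarrow> ('g \<times> 'g) set" where
  "fe_rel A G = (\<Union>T\<in>A. den T G)"

lemma den_pruning: "finite_graph T \<Longrightarrow> R \<in> pruning T \<Longrightarrow> den R G = den T G"
  by (auto simp: pruning_eq dest: den_hom_equiv)

lemma fe_rel_pruning: "finite_graph T \<Longrightarrow> fe_rel (pruning T) G = den T G"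
proof -
  assume T: "finite_graph T"
  have "den R G = den T G" if "R \<in> pruning T" for R
    using den_pruning[OF T that] .
  then show ?thesis
    using pruning_nonempty[OF T] by (auto simp: fe_rel_def)
qed

lemma pruning_member:
  assumes "is_xtree X T" "R \<in> pruning T"
  shows "pruning R = pruning T" "is_xtree X R" "pruned R"
proof -
  have T: "finite_graph T" using assms(1) by (rule is_xtree_finite_graph)
  then have R: "finite_graph R" "pruned R" "hom_equiv T R"
    using assms(2) by (auto simp: pruning_eq)
  show "pruning R = pruning T" using pruning_cong[OF T R(1,3)] by simp
  show "is_xtree X R" "pruned R" using is_xtree_pruning[OF assms] R(2) by auto
qed

lemma pruning_in_FE:
  assumes "is_xtree X T"
  shows "pruning T \<in> carrier (FE X)"
proof -
  obtain R where R: "R \<in> pruning T"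
    using pruning_nonempty[OF is_xtree_finite_graph[OF assms]] by blast
  then have "pruning T = iso_type R" "is_xtree X R" "pruned R"
    using pruning_member[OF assms R] iso_type_pruned[of R] is_xtree_finite_graph by auto
  then show ?thesis by (auto simp: FE_def)
qed

lemma FE_carrierE:
  assumes "A \<in> carrier (FE X)"
  obtains T :: "(nat, 'a) xtree" where "is_xtree X T" "A = pruning T"
proof -
  obtain T :: "(nat, 'a) xtree" where "A = iso_type T" "is_xtree X T" "pruned T"
    using assms by (auto simp: FE_def)
  then show ?thesis using that iso_type_pruned is_xtree_finite_graph by blast
qed

text \<open>
  A tree in one isomorphism type serves as a test graph for a tree in the other, and both are trees
  over the natural numbers. A pair of homomorphisms between pruned trees gives an isomorphism.
\<close>

lemma FE_eqI:
  fixes A :: "'a fe"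
  assumes "A \<in> carrier (FE X)" "B \<in> carrier (FE X)"
    and eq: "\<And>G :: (nat \<times> 'a \<times> nat) set. fe_rel A G = fe_rel B G"
  shows "A = B"
proof -
  obtain S T :: "(nat, 'a) xtree" where S: "is_xtree X S" "A = pruning S" and T: "is_xtree X T" "B = pruning T"
    using assms(1,2) by (metis FE_carrierE)
  note fin = S(1)[THEN is_xtree_finite_graph] T(1)[THEN is_xtree_finite_graph]
  have "den S G = den T G" for G :: "(nat \<times> 'a \<times> nat) set"
    using eq[of G] fin by (simp add: S T fe_rel_pruning)
  then have "hom_equiv S T" using hom_equiv_iff_den S(1) T(1) by blast
  then show ?thesis using pruning_cong fin by (simp add: S T)
qed

lemma pruning_eqI:
  fixes S :: "('v, 'a) xtree" and T :: "('w, 'a) xtree"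
  assumes S: "is_xtree X S" and T: "is_xtree X T"
    and den: "\<And>G :: (nat \<times> 'a \<times> nat) set. den S G = den T G"
  shows "pruning S = pruning T"
proof (rule FE_eqI)
  show "pruning S \<in> carrier (FE X)" "pruning T \<in> carrier (FE X)"
    using S T by (auto intro: pruning_in_FE)
  show "fe_rel (pruning S) G = fe_rel (pruning T) G" for G :: "(nat \<times> 'a \<times> nat) set"
    using den[of G] is_xtree_finite_graph[OF S] is_xtree_finite_graph[OF T] by (simp add: fe_rel_pruning)
qed

lemma FE_mult_pruning:
  fixes S T :: "(nat, 'a) xtree"
  assumes "is_xtree X S" "is_xtree X T"
  shows "pruning S \<otimes>\<^bsub>FE X\<^esub> pruning T = pruning (glue S T)"
proof -
  have "pruning (glue S' T') = pruning (glue S T)" if S': "S' \<in> pruning S" and T': "T' \<in> pruning T" for S' T'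
  proof -
    have x: "is_xtree X (glue S' T')" "is_xtree X (glue S T)"
      using is_xtree_glue pruning_member(2)[OF assms(1) S'] pruning_member(2)[OF assms(2) T'] assms by blast+
    have "den S' G = den S G" "den T' G = den T G" for G :: "(nat \<times> 'a \<times> nat) set"
      using den_pruning[OF is_xtree_finite_graph] assms S' T' by metis+
    then show ?thesis
      by (intro pruning_eqI[OF x]) (simp add: den_glue)
  qed
  then have "(\<Union>S'\<in>pruning S. \<Union>T'\<in>pruning T. pruning (glue S' T')) =
      (\<Union>S'\<in>pruning S. \<Union>T'\<in>pruning T. pruning (glue S T))"
    by (intro SUP_cong[OF HOL.refl]) blast
  then show ?thesis
    using assms[THEN is_xtree_finite_graph, THEN pruning_nonempty] by (simp add: FE_def)
qed

lemma FE_mult: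
  assumes "A \<in> carrier (FE X)" "B \<in> carrier (FE X)"
  shows "A \<otimes>\<^bsub>FE X\<^esub> B \<in> carrier (FE X)" "fe_rel (A \<otimes>\<^bsub>FE X\<^esub> B) G = fe_rel A G O fe_rel B G"
proof -
  obtain S T :: "(nat, 'a) xtree" where S: "is_xtree X S" "A = pruning S" and T: "is_xtree X T" "B = pruning T"
    using assms(1,2) by (metis FE_carrierE)
  have x: "is_xtree X (glue S T)" using is_xtree_glue S T by blast
  show "A \<otimes>\<^bsub>FE X\<^esub> B \<in> carrier (FE X)"
    using FE_mult_pruning[OF S(1) T(1)] pruning_in_FE[OF x] S T by simp
  show "fe_rel (A \<otimes>\<^bsub>FE X\<^esub> B) G = fe_rel A G O fe_rel B G"
    using FE_mult_pruning[OF S(1) T(1)] S T x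
    by (simp add: fe_rel_pruning is_xtree_finite_graph den_glue)
qed

text \<open>
  For an operation \<open>c\<close> on trees that is compatible with homomorphic equivalence, the union in the
  definitions of \<open>fe_plus\<close> and \<open>fe_star\<close> has equal members.
\<close>

lemma UN_const_pruning:
  fixes c :: "(nat, 'a) xtree \<Rightarrow> (nat, 'a) xtree"
  assumes T: "is_xtree X T" and c: "\<And>R. is_xtree X R \<Longrightarrow> is_xtree X (c R)"
    and den: "\<And>R (G :: (nat \<times> 'a \<times> nat) set). den R G = den T G \<Longrightarrow> den (c R) G = den (c T) G"
  shows "(\<Union>R\<in>pruning T. pruning (c R)) = pruning (c T)"
proof -
  have "pruning (c R) = pruning (c T)" if R: "R \<in> pruning T" for R
  proof -
    have x: "is_xtree X (c R)" "is_xtree X (c T)" using c pruning_member(2)[OF T R] T by auto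
    have "den R G = den T G" for G :: "(nat \<times> 'a \<times> nat) set"
      using den_pruning[OF is_xtree_finite_graph[OF T] R] .
    then show ?thesis
      by (intro pruning_eqI[OF x] den)
  qed
  then show ?thesis using pruning_nonempty[OF is_xtree_finite_graph[OF T]] by auto
qed

lemma is_xtree_plus: "is_xtree X T \<Longrightarrow> is_xtree X (T\<lparr>tgt := src T\<rparr>)"
  using is_xtree_reroot[of X T "src T" "src T"] by (simp add: is_xtree_def)

lemma is_xtree_star: "is_xtree X T \<Longrightarrow> is_xtree X (T\<lparr>src := tgt T\<rparr>)"
  using is_xtree_reroot[of X T "tgt T" "tgt T"] by (simp add: is_xtree_def)

lemma FE_plus:
  assumes "A \<in> carrier (FE X)"
  shows "fe_plus A \<in> carrier (FE X)" "fe_rel (fe_plus A) G = Id_on (Domain (fe_rel A G))"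
proof -
  obtain T :: "(nat, 'a) xtree" where T: "is_xtree X T" "A = pruning T"
    using assms(1) by (rule FE_carrierE)
  have "fe_plus A = pruning (T\<lparr>tgt := src T\<rparr>)"
    unfolding fe_plus_def T(2)
    by (rule UN_const_pruning[OF T(1)]) (auto simp: den_plus is_xtree_plus)
  then show "fe_plus A \<in> carrier (FE X)" "fe_rel (fe_plus A) G = Id_on (Domain (fe_rel A G))"
    using is_xtree_plus[OF T(1)] is_xtree_finite_graph[OF T(1)] is_xtree_finite_graph[OF is_xtree_plus[OF T(1)]]
    by (simp_all add: pruning_in_FE fe_rel_pruning den_plus T(2))
qed

lemma FE_star:
  assumes "A \<in> carrier (FE X)"
  shows "fe_star A \<in> carrier (FE X)" "fe_rel (fe_star A) G = Id_on (Range (fe_rel A G))"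
proof -
  obtain T :: "(nat, 'a) xtree" where T: "is_xtree X T" "A = pruning T"
    using assms(1) by (rule FE_carrierE)
  have "fe_star A = pruning (T\<lparr>src := tgt T\<rparr>)"
    unfolding fe_star_def T(2)
    by (rule UN_const_pruning[OF T(1)]) (auto simp: den_star is_xtree_star)
  then show "fe_star A \<in> carrier (FE X)" "fe_rel (fe_star A) G = Id_on (Range (fe_rel A G))"
    using is_xtree_star[OF T(1)] is_xtree_finite_graph[OF T(1)] is_xtree_finite_graph[OF is_xtree_star[OF T(1)]]
    by (simp_all add: pruning_in_FE fe_rel_pruning den_star T(2))
qed

lemma FE_one: "\<one>\<^bsub>FE X\<^esub> \<in> carrier (FE X)" "fe_rel \<one>\<^bsub>FE X\<^esub> G = Id"
proof -
  let ?T = "\<lparr>verts = {0}, edges = {}, src = 0, tgt = 0\<rparr> :: (nat, 'a) xtree"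
  have T: "is_xtree X ?T"
    by (simp add: is_xtree_iff finite_graph_def connected_graph_def all_bridges_def)
  have "pruned ?T" by (auto simp: pruned_def retraction_def xtree_mor_def)
  then have "\<one>\<^bsub>FE X\<^esub> = pruning ?T"
    using iso_type_pruned is_xtree_finite_graph[OF T] by (auto simp: FE_def)
  moreover have "den ?T G = Id" by (auto simp: den_def)
  ultimately show "\<one>\<^bsub>FE X\<^esub> \<in> carrier (FE X)" "fe_rel \<one>\<^bsub>FE X\<^esub> G = Id"
    using T is_xtree_finite_graph[OF T] by (simp_all add: pruning_in_FE fe_rel_pruning)
qed

lemma FE_gen:
  assumes "x \<in> X"
  shows "fe_gen x \<in> carrier (FE X)" "fe_rel (fe_gen x) G = {(p, q). (p, x, q) \<in> G}"
proof -
  let ?T = "\<lparr>verts = {0, 1}, edges = {(0, x, 1)}, src = 0, tgt = 1\<rparr> :: (nat, 'a) xtree"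
  have adj: "dir_adj ?T = {(0, Suc 0)}" by (auto simp: dir_adj_def)
  then have "undir_adj ?T = {(0, 1), (1, 0)}" by (auto simp: undir_adj_def)
  then have "connected_graph ?T" by (auto simp: connected_graph_def)
  moreover have "all_bridges ?T" by (auto simp: all_bridges_def intro!: exI[of _ "{1}"])
  ultimately have T: "is_xtree X ?T"
    using assms adj by (auto simp: is_xtree_iff finite_graph_def)
  have "pruned ?T" by (auto simp: pruned_def retraction_def xtree_mor_def)
  then have "fe_gen x = pruning ?T"
    using iso_type_pruned is_xtree_finite_graph[OF T] by (auto simp: fe_gen_def)
  moreover have "den ?T G = {(p, q). (p, x, q) \<in> G}"
  proof (intro equalityI subrelI)
    fix p q assume "(p, q) \<in> {(p, q). (p, x, q) \<in> G}"
    then show "(p, q) \<in> den ?T G"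
      by (intro denI[where f = "\<lambda>i. if i = 0 then p else q"]) auto
  qed (auto simp: den_def)
  ultimately show "fe_gen x \<in> carrier (FE X)" "fe_rel (fe_gen x) G = {(p, q). (p, x, q) \<in> G}"
    using T is_xtree_finite_graph[OF T] by (simp_all add: pruning_in_FE fe_rel_pruning)
qed

subsection \<open>Idempotents are the trees with equal start and end\<close>

text \<open>
  In the graph of integers with all edges from \<open>i\<close> to \<open>i + 1\<close>, a tree whose trunk has length \<open>n\<close>
  denotes the translation by \<open>n\<close>. For an idempotent, \<open>2 n = n\<close>, so that start and end coincide.
\<close>

lemma E_rel_Id:
  assumes "e \<in> carrier (E_sl X)"
  shows "fe_rel e G \<subseteq> Id"
proof -
  have e: "e \<in> carrier (FE X)" "e \<otimes>\<^bsub>FE X\<^esub> e = e" using assms by (auto simp: E_sl_def)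
  then obtain T :: "(nat, 'a) xtree" where T: "is_xtree X T" "e = pruning T"
    by (metis FE_carrierE)
  then have rel: "fe_rel e G = den T G" for G :: "('g \<times> 'a \<times> 'g) set"
    using fe_rel_pruning is_xtree_finite_graph by blast
  obtain l :: "nat \<Rightarrow> int" where l: "\<And>u x v. (u, x, v) \<in> edges T \<Longrightarrow> l v = l u + 1"
    using xtree_grading[OF T(1)] by blast
  obtain n where n: "(src T, tgt T) \<in> dir_adj T ^^ n"
    using T(1) rtrancl_power by (metis is_xtree_iff)
  have trans: "f v = f u + int k"
    if "(u, v) \<in> dir_adj T ^^ k" "\<And>u x v. (u, x, v) \<in> edges T \<Longrightarrow> f v = f u + 1" for f k u v
    using that(1)
  proof (induction k arbitrary: v)
    case (Suc k)
    then obtain w where "(u, w) \<in> dir_adj T ^^ k" "(w, v) \<in> dir_adj T" by auto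
    then show ?case using Suc.IH that(2) by (fastforce simp: dir_adj_def)
  qed simp
  \<comment> \<open>the test graph: integers with an edge of every label from \<open>i\<close> to \<open>i + 1\<close>\<close>
  define G0 where "G0 = {(i, x :: 'a, i + 1) | (i :: int) x. True}"
  have d: "den T G0 = {(i, i + int n) | i. True}"
  proof (intro equalityI subrelI)
    fix p q assume "(p, q) \<in> den T G0"
    then obtain f where "\<And>u x v. (u, x, v) \<in> edges T \<Longrightarrow> (f u, x, f v) \<in> G0" "f (src T) = p" "f (tgt T) = q"
      by (rule denE) blast
    then show "(p, q) \<in> {(i, i + int n) | i. True}"
      using trans[OF n, of f] by (auto simp: G0_def)
  next
    fix p q assume "(p, q) \<in> {(i, i + int n) | i. True}"
    then show "(p, q) \<in> den T G0"
      using l trans[OF n, of l]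
      by (intro denI[where f = "\<lambda>v. l v - l (src T) + p"]) (auto simp: G0_def)
  qed
  have "den T G0 O den T G0 = den T G0"
    using FE_mult(2)[OF e(1) e(1), of G0] e(2) by (simp add: rel)
  moreover have "(0, int n) \<in> den T G0" "(int n, int n + int n) \<in> den T G0"
    by (auto simp: d)
  ultimately have "(0, int n + int n) \<in> den T G0" by blast
  then have "src T = tgt T" using n by (auto simp: d)
  then show ?thesis unfolding rel by (auto simp: den_def)
qed

lemma E_in_FE: "e \<in> carrier (E_sl X) \<Longrightarrow> e \<in> carrier (FE X)"
  by (simp add: E_sl_def)

lemma E_slI:
  fixes e :: "'a fe"
  assumes "e \<in> carrier (FE X)" "\<And>G :: (nat \<times> 'a \<times> nat) set. fe_rel e G \<subseteq> Id"
  shows "e \<in> carrier (E_sl X)"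
proof -
  have "fe_rel e G O fe_rel e G = fe_rel e G" for G :: "(nat \<times> 'a \<times> nat) set"
    using assms(2)[of G] by auto
  then have "e \<otimes>\<^bsub>FE X\<^esub> e = e"
    by (intro FE_eqI[of _ X]) (auto simp: FE_mult assms(1))
  then show ?thesis using assms(1) by (simp add: E_sl_def)
qed

lemma E_one: "\<one>\<^bsub>FE X\<^esub> \<in> carrier (E_sl X)"
  by (rule E_slI) (auto simp: FE_one)

lemma E_mult_rel:
  assumes "e \<in> carrier (E_sl X)" "f \<in> carrier (E_sl X)"
  shows "fe_rel (e \<otimes>\<^bsub>FE X\<^esub> f) G = fe_rel e G \<inter> fe_rel f G"
  using E_rel_Id[OF assms(1), of G] E_rel_Id[OF assms(2), of G] assms
  by (auto simp: FE_mult E_in_FE)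

lemma E_mult_in:
  assumes "e \<in> carrier (E_sl X)" "f \<in> carrier (E_sl X)"
  shows "e \<otimes>\<^bsub>FE X\<^esub> f \<in> carrier (E_sl X)"
proof (rule E_slI)
  show "e \<otimes>\<^bsub>FE X\<^esub> f \<in> carrier (FE X)" using assms by (simp add: FE_mult E_in_FE)
  show "fe_rel (e \<otimes>\<^bsub>FE X\<^esub> f) G \<subseteq> Id" for G :: "(nat \<times> 'a \<times> nat) set"
    using E_rel_Id[OF assms(1), of G] by (auto simp: E_mult_rel[OF assms])
qed

lemmas E_mult = E_mult_in E_mult_rel

lemma E_plus: "A \<in> carrier (FE X) \<Longrightarrow> fe_plus A \<in> carrier (E_sl X)"
  by (rule E_slI) (auto simp: FE_plus)

lemma E_star: "A \<in> carrier (FE X) \<Longrightarrow> fe_star A \<in> carrier (E_sl X)"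
  by (rule E_slI) (auto simp: FE_star)

lemma E_eqI:
  fixes e :: "'a fe"
  assumes "e \<in> carrier (E_sl X)" "f \<in> carrier (E_sl X)"
    and "\<And>G :: (nat \<times> 'a \<times> nat) set. fe_rel e G = fe_rel f G"
  shows "e = f"
  using assms FE_eqI E_in_FE by blast


section \<open>Words in letters and idempotents\<close>

text \<open>
  These are the words that represent the elements of the free product \<open>C\<^sub>X\<close>.
\<close>

definition cwords :: "'a set \<Rightarrow> 'a cword set" where
  "cwords X = lists (carrier (free_mon X) <+> carrier (E_sl X))"

lemma cwords_simps [simp]:
  "[] \<in> cwords X"
  "Inl w # u \<in> cwords X \<longleftrightarrow> set w \<subseteq> X \<and> u \<in> cwords X"
  "Inr e # u \<in> cwords X \<longleftrightarrow> e \<in> carrier (E_sl X) \<and> u \<in> cwords X"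
  "u @ v \<in> cwords X \<longleftrightarrow> u \<in> cwords X \<and> v \<in> cwords X"
  by (auto simp: cwords_def free_mon_def)

lemma cwords_induct [consumes 1, case_names Nil Inl Inr]:
  assumes "u \<in> cwords X" "P []"
    and "\<And>w u. set w \<subseteq> X \<Longrightarrow> u \<in> cwords X \<Longrightarrow> P u \<Longrightarrow> P (Inl w # u)"
    and "\<And>e u. e \<in> carrier (E_sl X) \<Longrightarrow> u \<in> cwords X \<Longrightarrow> P u \<Longrightarrow> P (Inr e # u)"
  shows "P u"
  using assms(1)
proof (induction u)
  case (Cons s u)
  then show ?case using assms(3,4) by (cases s) auto
qed (rule assms(2))

fun path_rel :: "'a list \<Rightarrow> ('g \<times> 'a \<times> 'g) set \<Rightarrow> ('g \<times> 'g) set" where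
  "path_rel [] G = Id"
| "path_rel (x # w) G = {(p, q). (p, x, q) \<in> G} O path_rel w G"

fun word_rel :: "'a cword \<Rightarrow> ('g \<times> 'a \<times> 'g) set \<Rightarrow> ('g \<times> 'g) set" where
  "word_rel [] G = Id"
| "word_rel (Inl w # u) G = path_rel w G O word_rel u G"
| "word_rel (Inr e # u) G = fe_rel e G O word_rel u G"

fun trunk :: "'a cword \<Rightarrow> 'a list" where
  "trunk [] = []"
| "trunk (Inl w # u) = w @ trunk u"
| "trunk (Inr e # u) = trunk u"

fun fe_eval :: "'a set \<Rightarrow> 'a cword \<Rightarrow> 'a fe" where
  "fe_eval X [] = \<one>\<^bsub>FE X\<^esub>"
| "fe_eval X (Inl w # u) = fe_word X w \<otimes>\<^bsub>FE X\<^esub> fe_eval X u"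
| "fe_eval X (Inr e # u) = e \<otimes>\<^bsub>FE X\<^esub> fe_eval X u"

lemma path_rel_append: "path_rel (v @ w) G = path_rel v G O path_rel w G"
  by (induction v) auto

lemma word_rel_append: "word_rel (u @ v) G = word_rel u G O word_rel v G"
  by (induction u G rule: word_rel.induct) auto

lemma trunk_append [simp]: "trunk (u @ v) = trunk u @ trunk v"
  by (induction u rule: trunk.induct) auto

lemma trunk_in: "u \<in> cwords X \<Longrightarrow> set (trunk u) \<subseteq> X"
  by (induction u rule: cwords_induct) auto

lemma FE_word:
  assumes "set w \<subseteq> X"
  shows "fe_word X w \<in> carrier (FE X)" "fe_rel (fe_word X w) G = path_rel w G"
  using assms by (induction w) (auto simp: fe_word_def FE_one FE_mult FE_gen)

lemma FE_eval:
  assumes "u \<in> cwords X"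
  shows "fe_eval X u \<in> carrier (FE X)" "fe_rel (fe_eval X u) G = word_rel u G"
  using assms by (induction u rule: cwords_induct) (auto simp: FE_one FE_mult FE_word E_in_FE)

lemma fe_eval_append:
  assumes "u \<in> cwords X" "v \<in> cwords X"
  shows "fe_eval X (u @ v) = fe_eval X u \<otimes>\<^bsub>FE X\<^esub> fe_eval X v"
  using assms by (intro FE_eqI[of _ X]) (auto simp: FE_eval FE_mult word_rel_append)

text \<open>
  A word of this form can be split at every place of its trunk.
\<close>

definition letter_word :: "'a cword \<Rightarrow> bool" where
  "letter_word u \<longleftrightarrow> (\<forall>w. Inl w \<in> set u \<longrightarrow> (\<exists>x. w = [x]))"

lemma letter_word_append [simp]: "letter_word (u @ v) \<longleftrightarrow> letter_word u \<and> letter_word v"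
  by (auto simp: letter_word_def)

text \<open>
  Up to homomorphic equivalence, a tree with trunk vertices \<open>v\<^sub>0, \<dots>, v\<^sub>n\<close> and trunk labels
  \<open>x\<^sub>1, \<dots>, x\<^sub>n\<close> is the product \<open>e\<^sub>0 x\<^sub>1 e\<^sub>1 \<dots> x\<^sub>n e\<^sub>n\<close>, where \<open>e\<^sub>i\<close> is the whole tree with start and end
  moved to \<open>v\<^sub>i\<close>.
\<close>

lemma FE_eval_surj:
  assumes "A \<in> carrier (FE X)"
  obtains u where "u \<in> cwords X" "letter_word u" "fe_eval X u = A"
proof -
  obtain T :: "(nat, 'a) xtree" where T: "is_xtree X T" "A = pruning T"
    using assms(1) by (rule FE_carrierE)
  have V: "u \<in> verts T \<and> v \<in> verts T \<and> x \<in> X" if "(u, x, v) \<in> edges T" for u x v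
    using that T(1) unfolding is_xtree_def by blast
  let ?at = "\<lambda>v. pruning (T\<lparr>src := v, tgt := v\<rparr>)"
  have at: "?at v \<in> carrier (E_sl X)" "\<And>G :: (nat \<times> 'a \<times> nat) set. fe_rel (?at v) G = den (T\<lparr>src := v, tgt := v\<rparr>) G"
    if "v \<in> verts T" for v
  proof -
    have x: "is_xtree X (T\<lparr>src := v, tgt := v\<rparr>)" using is_xtree_reroot[OF T(1) that that] by simp
    show rel: "fe_rel (?at v) G = den (T\<lparr>src := v, tgt := v\<rparr>) G" for G :: "(nat \<times> 'a \<times> nat) set"
      using fe_rel_pruning[OF is_xtree_finite_graph[OF x]] .
    show "?at v \<in> carrier (E_sl X)"
      using pruning_in_FE[OF x] by (rule E_slI) (auto simp: rel den_def)
  qed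
  have "(src T, tgt T) \<in> (dir_adj T)\<^sup>*" "src T \<in> verts T" "tgt T \<in> verts T"
    using T(1) by (auto simp: is_xtree_iff finite_graph_def)
  then have "\<exists>u. u \<in> cwords X \<and> letter_word u \<and>
     (\<forall>G :: (nat \<times> 'a \<times> nat) set. word_rel u G = den (T\<lparr>src := src T, tgt := tgt T\<rparr>) G)"
  proof (induction rule: converse_rtrancl_induct)
    case base
    then show ?case
      using at[of "tgt T"]
      by (intro exI[of _ "[Inr (?at (tgt T))]"]) (simp add: letter_word_def)
  next
    case (step s v)
    then obtain x where e: "(s, x, v) \<in> edges T" by (auto simp: dir_adj_def)
    obtain u where u: "u \<in> cwords X" "letter_word u"
      "\<And>G :: (nat \<times> 'a \<times> nat) set. word_rel u G = den (T\<lparr>src := v, tgt := tgt T\<rparr>) G"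
      using step V[OF e] by auto
    let ?u = "Inr (?at s) # Inl [x] # u"
    have "word_rel ?u G = den (T\<lparr>src := s, tgt := tgt T\<rparr>) G" for G :: "(nat \<times> 'a \<times> nat) set"
      unfolding den_cut[OF T(1) e step(2), of G] using u(3)[of G] at(2)[of s G] V[OF e]
      by (simp add: O_assoc)
    moreover have "?u \<in> cwords X" "letter_word ?u"
      using u(1,2) at(1) V[OF e] by (auto simp: letter_word_def)
    ultimately show ?case by blast
  qed
  then obtain u where u: "u \<in> cwords X" "letter_word u"
    "\<And>G :: (nat \<times> 'a \<times> nat) set. word_rel u G = den T G"
    by auto
  have "fe_eval X u = A"
    using u T assms by (intro FE_eqI[of _ X])
      (auto simp: FE_eval fe_rel_pruning is_xtree_finite_graph)
  then show ?thesis using u that by blast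
qed

lemma Domain_relcomp_Id_on: "Domain (R O Id_on (Domain S)) = Domain (R O S)"
  by blast

lemma Range_relcomp_Id_on: "Range (Id_on (Range R) O S) = Range (R O S)"
  by blast

lemma subid_relcomp_Id_on: "E \<subseteq> Id \<Longrightarrow> E O Id_on (Domain R) = Id_on (Domain (E O R))"
  by (fastforce simp: Id_on_def)

lemma left_fold_E:
  assumes "u \<in> cwords X" "f \<in> carrier (E_sl X)"
  shows "foldr (left_gen X) u f \<in> carrier (E_sl X)"
  using assms
  by (induction u rule: cwords_induct) (auto simp: E_mult E_plus FE_mult FE_word E_in_FE)

lemma left_fold_rel:
  assumes "u \<in> cwords X" "f \<in> carrier (E_sl X)"
  shows "fe_rel (foldr (left_gen X) u f) G = Id_on (Domain (word_rel u G O fe_rel f G))"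
  using assms
proof (induction u rule: cwords_induct)
  case Nil
  then show ?case using E_rel_Id[OF Nil, of G] by auto
next
  case (Inl w u)
  then show ?case
    using left_fold_E[OF Inl(2,4)] FE_plus(2)[where G = G, OF FE_mult(1)[OF FE_word(1)[OF Inl(1)]]]
    by (simp add: FE_mult FE_word E_in_FE Domain_relcomp_Id_on O_assoc)
next
  case (Inr e u)
  then show ?case
    using left_fold_E[OF Inr(2,4)] E_rel_Id[OF Inr(1), of G]
    by (simp add: FE_mult E_in_FE subid_relcomp_Id_on O_assoc)
qed

lemma right_fold_E:
  assumes "u \<in> cwords X" "f \<in> carrier (E_sl X)"
  shows "foldl (right_gen X) f u \<in> carrier (E_sl X)"
  using assms
  by (induction u arbitrary: f rule: cwords_induct) (auto simp: E_mult E_star FE_mult FE_word E_in_FE)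

lemma right_fold_rel:
  assumes "u \<in> cwords X" "f \<in> carrier (E_sl X)"
  shows "fe_rel (foldl (right_gen X) f u) G = Id_on (Range (fe_rel f G O word_rel u G))"
  using assms
proof (induction u arbitrary: f rule: cwords_induct)
  case Nil
  then show ?case using E_rel_Id[OF Nil, of G] by auto
next
  case (Inl w u)
  have E: "fe_star (f \<otimes>\<^bsub>FE X\<^esub> fe_word X w) \<in> carrier (E_sl X)"
    using Inl by (simp add: E_star FE_mult FE_word E_in_FE)
  have "fe_rel (fe_star (f \<otimes>\<^bsub>FE X\<^esub> fe_word X w)) G = Id_on (Range (fe_rel f G O path_rel w G))"
    using Inl FE_star(2)[where G = G, OF FE_mult(1)[OF _ FE_word(1)[OF Inl(1)]]] by (simp add: FE_mult FE_word E_in_FE)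
  then show ?case using Inl.IH[OF E] by (simp add: Range_relcomp_Id_on O_assoc)
next
  case (Inr e u)
  then show ?case
    using Inr.IH[OF E_mult(1)[OF Inr(4,1)]] by (simp add: FE_mult E_in_FE O_assoc)
qed

definition word_plus :: "'a set \<Rightarrow> 'a cword \<Rightarrow> 'a fe" where
  "word_plus X u = foldr (left_gen X) u \<one>\<^bsub>FE X\<^esub>"

definition word_star :: "'a set \<Rightarrow> 'a cword \<Rightarrow> 'a fe" where
  "word_star X u = foldl (right_gen X) \<one>\<^bsub>FE X\<^esub> u"

lemma word_plus:
  assumes "u \<in> cwords X"
  shows "word_plus X u \<in> carrier (E_sl X)" "fe_rel (word_plus X u) G = Id_on (Domain (word_rel u G))"
  using left_fold_E[OF assms E_one] left_fold_rel[OF assms E_one, of G]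
  by (simp_all add: word_plus_def FE_one)

lemma word_star:
  assumes "u \<in> cwords X"
  shows "word_star X u \<in> carrier (E_sl X)" "fe_rel (word_star X u) G = Id_on (Range (word_rel u G))"
  using right_fold_E[OF assms E_one] right_fold_rel[OF assms E_one, of G]
  by (simp_all add: word_star_def FE_one)


section \<open>Quotient monoids\<close>

lemma gen_cong_in_carrier:
  assumes "monoid M" "(a, b) \<in> gen_cong M R"
  shows "a \<in> carrier M" "b \<in> carrier M"
proof -
  have "a \<in> carrier M \<and> b \<in> carrier M"
    using assms(2) by induction (auto intro: monoid.m_closed[OF assms(1)])
  then show "a \<in> carrier M" "b \<in> carrier M" by auto
qed

lemma equiv_gen_cong: "monoid M \<Longrightarrow> equiv (carrier M) (gen_cong M R)"
  by (rule equivI)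
    (auto intro!: refl_onI symI transI dest: gen_cong_in_carrier intro: gen_cong.intros(2,3,4))

lemma cong_class_eq_iff:
  assumes "monoid M" "a \<in> carrier M" "b \<in> carrier M"
  shows "cong_class M R a = cong_class M R b \<longleftrightarrow> (a, b) \<in> gen_cong M R"
  unfolding cong_class_def using equiv_class_eq_iff[OF equiv_gen_cong[OF assms(1)]] assms(2,3) by blast

lemma mem_cong_class: "b \<in> cong_class M R a \<longleftrightarrow> (a, b) \<in> gen_cong M R"
  by (simp add: cong_class_def)

lemma self_mem_cong_class: "a \<in> carrier M \<Longrightarrow> a \<in> cong_class M R a"
  by (simp add: mem_cong_class gen_cong.intros(2))

lemma quot_mon_carrier: "carrier (quot_mon M R) = cong_class M R ` carrier M"
  by (auto simp: quot_mon_def quotient_def cong_class_def)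

lemma quot_mon_one: "\<one>\<^bsub>quot_mon M R\<^esub> = cong_class M R \<one>\<^bsub>M\<^esub>"
  by (simp add: quot_mon_def)

lemma quot_mon_mult:
  assumes "monoid M" "a \<in> carrier M" "b \<in> carrier M"
  shows "cong_class M R a \<otimes>\<^bsub>quot_mon M R\<^esub> cong_class M R b = cong_class M R (a \<otimes>\<^bsub>M\<^esub> b)"
proof -
  have "cong_class M R (a' \<otimes>\<^bsub>M\<^esub> b') = cong_class M R (a \<otimes>\<^bsub>M\<^esub> b)"
    if "a' \<in> cong_class M R a" "b' \<in> cong_class M R b" for a' b'
  proof -
    have "(a', a) \<in> gen_cong M R" "(b', b) \<in> gen_cong M R"
      using that by (auto simp: mem_cong_class intro: gen_cong.intros(3))
    then have "(a' \<otimes>\<^bsub>M\<^esub> b', a \<otimes>\<^bsub>M\<^esub> b) \<in> gen_cong M R"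
      by (rule gen_cong.intros(5))
    then show ?thesis
      using cong_class_eq_iff[OF assms(1)] gen_cong_in_carrier[OF assms(1)] by metis
  qed
  then have "(\<Union>a'\<in>cong_class M R a. \<Union>b'\<in>cong_class M R b. cong_class M R (a' \<otimes>\<^bsub>M\<^esub> b')) =
      (\<Union>a'\<in>cong_class M R a. \<Union>b'\<in>cong_class M R b. cong_class M R (a \<otimes>\<^bsub>M\<^esub> b))"
    by (intro SUP_cong[OF HOL.refl]) blast
  then show ?thesis
    using self_mem_cong_class[OF assms(2), of R] self_mem_cong_class[OF assms(3), of R]
    by (auto simp: quot_mon_def)
qed

lemma monoid_quot_mon:
  assumes "monoid M"
  shows "monoid (quot_mon M R)"
proof -
  interpret monoid M by fact
  show ?thesis
    by (rule monoidI) (auto simp: quot_mon_carrier quot_mon_one quot_mon_mult[OF assms] m_assoc)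
qed

lemma quot_map_cong_class:
  assumes "monoid M" "a \<in> carrier M"
    and "\<And>a b. (a, b) \<in> gen_cong M R \<Longrightarrow> (\<phi> a, \<phi> b) \<in> gen_cong M R"
  shows "quot_map M R \<phi> (cong_class M R a) = cong_class M R (\<phi> a)"
proof -
  have "cong_class M R (\<phi> b) = cong_class M R (\<phi> a)" if "b \<in> cong_class M R a" for b
  proof -
    have "(\<phi> a, \<phi> b) \<in> gen_cong M R" using that assms(3) by (simp add: mem_cong_class)
    then show ?thesis
      using cong_class_eq_iff[OF assms(1) gen_cong_in_carrier[OF assms(1)]] by metis
  qed
  then have "quot_map M R \<phi> (cong_class M R a) = (\<Union>b\<in>cong_class M R a. cong_class M R (\<phi> a))"
    unfolding quot_map_def by (intro SUP_cong[OF HOL.refl])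
  moreover have "cong_class M R a \<noteq> {}"
    using self_mem_cong_class[OF assms(2), of R] by blast
  ultimately show ?thesis by simp
qed

lemma gen_cong_endo:
  assumes "monoid M" "(a, b) \<in> gen_cong M R"
    and "\<And>a. a \<in> carrier M \<Longrightarrow> \<phi> a \<in> carrier M"
    and "\<And>a b. a \<in> carrier M \<Longrightarrow> b \<in> carrier M \<Longrightarrow> \<phi> (a \<otimes>\<^bsub>M\<^esub> b) = \<phi> a \<otimes>\<^bsub>M\<^esub> \<phi> b"
    and "\<And>a b. (a, b) \<in> R \<Longrightarrow> a \<in> carrier M \<Longrightarrow> b \<in> carrier M \<Longrightarrow> (\<phi> a, \<phi> b) \<in> gen_cong M R"
  shows "(\<phi> a, \<phi> b) \<in> gen_cong M R"
  using assms(2)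
proof induction
  case (mult a b c d)
  then show ?case
    using assms(4)[OF gen_cong_in_carrier(1)[OF assms(1) mult(1)] gen_cong_in_carrier(1)[OF assms(1) mult(2)]]
      assms(4)[OF gen_cong_in_carrier(2)[OF assms(1) mult(1)] gen_cong_in_carrier(2)[OF assms(1) mult(2)]]
    by (simp add: gen_cong.intros(5))
qed (auto intro: assms(3,5) gen_cong.intros(2,3,4))

text \<open>
  If \<open>f\<close> turns the product of \<open>M\<close> into \<open>g\<close>, then its kernel is a congruence.
\<close>

lemma gen_cong_kernel:
  assumes "monoid M" "(a, b) \<in> gen_cong M R"
    and "\<And>a b. a \<in> carrier M \<Longrightarrow> b \<in> carrier M \<Longrightarrow> f (a \<otimes>\<^bsub>M\<^esub> b) = g (f a) (f b)"
    and "\<And>a b. (a, b) \<in> R \<Longrightarrow> a \<in> carrier M \<Longrightarrow> b \<in> carrier M \<Longrightarrow> f a = f b"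
  shows "f a = f b"
  using assms(2)
proof induction
  case (mult a b c d)
  then show ?case
    using assms(3)[OF gen_cong_in_carrier(1)[OF assms(1) mult(1)] gen_cong_in_carrier(1)[OF assms(1) mult(2)]]
      assms(3)[OF gen_cong_in_carrier(2)[OF assms(1) mult(1)] gen_cong_in_carrier(2)[OF assms(1) mult(2)]]
    by simp
qed (auto intro: assms(4))

lemma the_elem_cong_class:
  assumes "a \<in> carrier M" "\<And>b. (a, b) \<in> gen_cong M R \<Longrightarrow> f a = f b"
  shows "the_elem (f ` cong_class M R a) = f a"
proof -
  have "f ` cong_class M R a = (\<lambda>_. f a) ` cong_class M R a"
    using assms(2) by (intro image_cong) (simp_all add: mem_cong_class)
  also have "\<dots> = {f a}"
    using self_mem_cong_class[OF assms(1), of R] by (rule image_constant)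
  finally have "f ` cong_class M R a = {f a}" .
  then show ?thesis by simp
qed

lemma free_mon_simps [simp]:
  "carrier (free_mon A) = lists A" "u \<otimes>\<^bsub>free_mon A\<^esub> v = u @ v" "\<one>\<^bsub>free_mon A\<^esub> = []"
  by (simp_all add: free_mon_def)

lemma monoid_free_mon: "monoid (free_mon A)"
  by (rule monoidI) auto

lemma Pair_True_lists: "map (Pair True) w \<in> lists (UNIV \<times> X) \<longleftrightarrow> set w \<subseteq> X"
  by auto


section \<open>The free group\<close>

lemma monoid_FG: "monoid (FG X)"
  unfolding FG_def by (intro monoid_quot_mon monoid_free_mon)

lemma fgrp_word_in: "set w \<subseteq> X \<Longrightarrow> fgrp_word X w \<in> carrier (FG X)"
  by (simp add: fgrp_word_def FG_def quot_mon_carrier Pair_True_lists)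

lemma fgrp_word_Nil: "fgrp_word X [] = \<one>\<^bsub>FG X\<^esub>"
  by (simp add: fgrp_word_def FG_def quot_mon_one)

lemma fgrp_word_append:
  assumes "set v \<subseteq> X" "set w \<subseteq> X"
  shows "fgrp_word X (v @ w) = fgrp_word X v \<otimes>\<^bsub>FG X\<^esub> fgrp_word X w"
  using quot_mon_mult[OF monoid_free_mon, of "map (Pair True) v" "UNIV \<times> X" "map (Pair True) w" "fgrp_rel X"] assms
  by (simp add: fgrp_word_def FG_def Pair_True_lists)

text \<open>
  The exponent sum is the only invariant of \<open>F\<^sub>X\<close> that is used: it tells apart the prefixes of a
  positive word.
\<close>

definition exponent_sum :: "(bool \<times> 'a) list \<Rightarrow> int" where
  "exponent_sum w = (\<Sum>(b, x)\<leftarrow>w. if b then 1 else - 1)"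

definition fgrp_exp :: "'a fgrp \<Rightarrow> int" where
  "fgrp_exp h = the_elem (exponent_sum ` h)"

lemma fgrp_exp_class:
  assumes "w \<in> lists (UNIV \<times> X)"
  shows "fgrp_exp (cong_class (free_mon (UNIV \<times> X)) (fgrp_rel X) w) = exponent_sum w"
  unfolding fgrp_exp_def
proof (rule the_elem_cong_class)
  show "exponent_sum w = exponent_sum v" if "(w, v) \<in> gen_cong (free_mon (UNIV \<times> X)) (fgrp_rel X)" for v
    by (rule gen_cong_kernel[OF monoid_free_mon that, where g = "(+)"])
      (auto simp: exponent_sum_def fgrp_rel_def)
qed (use assms in simp)

lemma fgrp_exp_word: "set w \<subseteq> X \<Longrightarrow> fgrp_exp (fgrp_word X w) = int (length w)"
proof -
  assume "set w \<subseteq> X"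
  then have "map (Pair True) w \<in> lists (UNIV \<times> X)" by (simp only: Pair_True_lists)
  moreover have "exponent_sum (map (Pair True) w) = int (length w)"
    by (induction w) (auto simp: exponent_sum_def)
  ultimately show ?thesis by (simp add: fgrp_word_def fgrp_exp_class)
qed


section \<open>The semilattices Z and Y\<close>

abbreviation "zcong X \<equiv> gen_cong (S_sl X) (Z_rel X)"
abbreviation "zclass X \<equiv> cong_class (S_sl X) (Z_rel X)"
abbreviation "ycong X \<equiv> gen_cong (Z_sl X) (Y_rel X)"
abbreviation "zshift X h B \<equiv> zsym_act X h ` B"

definition zsyms :: "'a set \<Rightarrow> 'a zsym set" where
  "zsyms X = {Ysym x h | x h. x \<in> X \<and> h \<in> carrier (FG X)} \<union>
      {Esym f h | f h. f \<in> E_nontriv X \<and> h \<in> carrier (FG X)}"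

lemma S_sl_carrier: "B \<in> carrier (S_sl X) \<longleftrightarrow> finite B \<and> B \<subseteq> zsyms X"
  by (simp add: S_sl_def zsyms_def free_semilattice_def)

lemma S_sl_simps [simp]: "B \<otimes>\<^bsub>S_sl X\<^esub> C = B \<union> C" "\<one>\<^bsub>S_sl X\<^esub> = {}"
  by (simp_all add: S_sl_def free_semilattice_def)

lemma monoid_S_sl: "monoid (S_sl X)"
  by (rule monoidI) (auto simp: S_sl_carrier)

lemma monoid_Z_sl: "monoid (Z_sl X)"
  unfolding Z_sl_def by (intro monoid_quot_mon monoid_S_sl)

lemma zclass_in: "B \<in> carrier (S_sl X) \<Longrightarrow> zclass X B \<in> carrier (Z_sl X)"
  by (simp add: Z_sl_def quot_mon_carrier)

lemma Z_sl_mult: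
  "B \<in> carrier (S_sl X) \<Longrightarrow> C \<in> carrier (S_sl X) \<Longrightarrow> zclass X B \<otimes>\<^bsub>Z_sl X\<^esub> zclass X C = zclass X (B \<union> C)"
  using quot_mon_mult[OF monoid_S_sl, of B X C "Z_rel X"] by (simp add: Z_sl_def)

lemma Z_sl_one: "\<one>\<^bsub>Z_sl X\<^esub> = zclass X {}"
  by (simp add: Z_sl_def quot_mon_one)

lemma S_sl_union: "B \<union> C \<in> carrier (S_sl X) \<longleftrightarrow> B \<in> carrier (S_sl X) \<and> C \<in> carrier (S_sl X)"
  by (auto simp: S_sl_carrier)

lemma zshift_in:
  assumes "h \<in> carrier (FG X)" "B \<in> carrier (S_sl X)"
  shows "zshift X h B \<in> carrier (S_sl X)"
  using assms monoid.m_closed[OF monoid_FG, of h X] by (auto simp: S_sl_carrier zsyms_def)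

lemma zshift_zcong:
  assumes h: "h \<in> carrier (FG X)" and "(B, C) \<in> zcong X"
  shows "(zshift X h B, zshift X h C) \<in> zcong X"
proof (rule gen_cong_endo[OF monoid_S_sl assms(2)])
  fix B C assume BC: "(B, C) \<in> Z_rel X" "B \<in> carrier (S_sl X)" "C \<in> carrier (S_sl X)"
  obtain f f' k where f: "f \<in> E_nontriv X" "f' \<in> E_nontriv X" "k \<in> carrier (FG X)"
    and B: "B = {Esym f k, Esym f' k}" and C: "C = {Esym (f \<otimes>\<^bsub>FE X\<^esub> f') k}"
    using BC(1) by (auto simp: Z_rel_def)
  have "(zshift X h B, zshift X h C) \<in> Z_rel X"
    using f h monoid.m_closed[OF monoid_FG, of h X k] unfolding B C Z_rel_def by auto
  then show "(zshift X h B, zshift X h C) \<in> zcong X"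
    using BC zshift_in[OF h] by (intro gen_cong.intros(1))
qed (use h zshift_in in auto)

lemma Z_act_class:
  assumes "h \<in> carrier (FG X)" "B \<in> carrier (S_sl X)"
  shows "Z_act X h (zclass X B) = zclass X (zshift X h B)"
  unfolding Z_act_def using quot_map_cong_class[OF monoid_S_sl assms(2)] zshift_zcong[OF assms(1)] by blast

lemma E_mult_eq_oneD:
  assumes "e \<in> carrier (E_sl X)" "f \<in> carrier (E_sl X)" "e \<otimes>\<^bsub>FE X\<^esub> f = \<one>\<^bsub>FE X\<^esub>"
  shows "e = \<one>\<^bsub>FE X\<^esub>"
proof (rule E_eqI[OF assms(1) E_one])
  show "fe_rel e G = fe_rel \<one>\<^bsub>FE X\<^esub> G" for G :: "(nat \<times> 'a \<times> nat) set"
    using E_mult(2)[OF assms(1,2), of G] assms(3) E_rel_Id[OF assms(1), of G] by (auto simp: FE_one)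
qed

lemma E_nontriv_mult:
  assumes "e \<in> E_nontriv X" "f \<in> E_nontriv X"
  shows "e \<otimes>\<^bsub>FE X\<^esub> f \<in> E_nontriv X"
  using assms E_mult(1)[of e X f] E_mult_eq_oneD[of e X f] by (auto simp: E_nontriv_def)

text \<open>
  This is \<open>e\<^bsub>f,h\<^esub>\<close>, with the convention that \<open>e\<^bsub>1,h\<^esub>\<close> is the identity of the semilattice.
\<close>

definition Eset :: "'a set \<Rightarrow> 'a fe \<Rightarrow> 'a fgrp \<Rightarrow> 'a zsym set" where
  "Eset X e h = (if e = \<one>\<^bsub>FE X\<^esub> then {} else {Esym e h})"

lemma Eset_in: "e \<in> carrier (E_sl X) \<Longrightarrow> h \<in> carrier (FG X) \<Longrightarrow> Eset X e h \<in> carrier (S_sl X)"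
  by (auto simp: Eset_def S_sl_carrier zsyms_def E_nontriv_def)

lemma FE_one_left: "A \<in> carrier (FE X) \<Longrightarrow> \<one>\<^bsub>FE X\<^esub> \<otimes>\<^bsub>FE X\<^esub> A = A"
  by (rule FE_eqI[of _ X]) (auto simp: FE_one FE_mult)

lemma FE_one_right: "A \<in> carrier (FE X) \<Longrightarrow> A \<otimes>\<^bsub>FE X\<^esub> \<one>\<^bsub>FE X\<^esub> = A"
  by (rule FE_eqI[of _ X]) (auto simp: FE_one FE_mult)

lemma Eset_mult:
  assumes "e \<in> carrier (E_sl X)" "f \<in> carrier (E_sl X)" "h \<in> carrier (FG X)"
  shows "(Eset X e h \<union> Eset X f h, Eset X (e \<otimes>\<^bsub>FE X\<^esub> f) h) \<in> zcong X"
proof (cases "e = \<one>\<^bsub>FE X\<^esub> \<or> f = \<one>\<^bsub>FE X\<^esub>")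
  case True
  then have "Eset X e h \<union> Eset X f h = Eset X (e \<otimes>\<^bsub>FE X\<^esub> f) h"
    using assms by (auto simp: Eset_def FE_one_left FE_one_right E_in_FE)
  then show ?thesis
    using Eset_in[OF E_mult(1)[OF assms(1,2)] assms(3)] by (simp add: gen_cong.intros(2))
next
  case False
  then have n: "e \<in> E_nontriv X" "f \<in> E_nontriv X" using assms by (auto simp: E_nontriv_def)
  then have ef: "e \<otimes>\<^bsub>FE X\<^esub> f \<in> E_nontriv X" by (rule E_nontriv_mult)
  have "({Esym e h} \<union> {Esym f h}, {Esym (e \<otimes>\<^bsub>FE X\<^esub> f) h}) \<in> Z_rel X"
    using n assms(3) unfolding Z_rel_def by auto
  then have "({Esym e h} \<union> {Esym f h}, {Esym (e \<otimes>\<^bsub>FE X\<^esub> f) h}) \<in> zcong X"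
    using n ef assms(3) by (intro gen_cong.intros(1)) (auto simp: S_sl_carrier zsyms_def)
  then show ?thesis using False ef by (simp add: Eset_def E_nontriv_def)
qed

text \<open>
  The functions \<open>tau_set\<close> and \<open>theta_set\<close> compute representatives in the free semilattice \<open>S\<^sub>X\<close>, for
  \<open>\<tau>\<^bsub>w,h\<^esub>\<close> and for \<open>h \<cdot> \<gamma>\<theta>\<^sub>1\<close>.
\<close>

fun tau_set :: "'a set \<Rightarrow> 'a list \<Rightarrow> 'a fgrp \<Rightarrow> 'a zsym set" where
  "tau_set X [] h = {}"
| "tau_set X (x # w) h = {Ysym x h} \<union> tau_set X w (h \<otimes>\<^bsub>FG X\<^esub> fgrp_word X [x])"

fun theta_set :: "'a set \<Rightarrow> 'a cword \<Rightarrow> 'a fgrp \<Rightarrow> 'a zsym set" where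
  "theta_set X [] h = {}"
| "theta_set X (Inl w # u) h = tau_set X w h \<union> theta_set X u (h \<otimes>\<^bsub>FG X\<^esub> fgrp_word X w)"
| "theta_set X (Inr e # u) h = Eset X e h \<union> theta_set X u h"

context
  fixes X :: "'a set"
begin

interpretation F: monoid "FG X" by (rule monoid_FG)

lemma fgrp_word_Cons: "x \<in> X \<Longrightarrow> set w \<subseteq> X \<Longrightarrow> fgrp_word X (x # w) = fgrp_word X [x] \<otimes>\<^bsub>FG X\<^esub> fgrp_word X w"
  using fgrp_word_append[of "[x]" X w] by simp

lemma tau_set_in: "set w \<subseteq> X \<Longrightarrow> h \<in> carrier (FG X) \<Longrightarrow> tau_set X w h \<in> carrier (S_sl X)"
  by (induction w arbitrary: h) (auto simp: S_sl_carrier zsyms_def fgrp_word_in)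

lemma tau_set_append:
  "set v \<subseteq> X \<Longrightarrow> set w \<subseteq> X \<Longrightarrow> h \<in> carrier (FG X) \<Longrightarrow>
    tau_set X (v @ w) h = tau_set X v h \<union> tau_set X w (h \<otimes>\<^bsub>FG X\<^esub> fgrp_word X v)"
proof (induction v arbitrary: h)
  case (Cons x v)
  then show ?case using fgrp_word_Cons[of x v] by (simp add: fgrp_word_in F.m_assoc Un_assoc)
qed (simp add: fgrp_word_Nil)

lemma tau_class: "set w \<subseteq> X \<Longrightarrow> h \<in> carrier (FG X) \<Longrightarrow> tau X w h = zclass X (tau_set X w h)"
proof (induction w arbitrary: h)
  case (Cons x w)
  have "{Ysym x h} \<in> carrier (S_sl X)" using Cons by (simp add: S_sl_carrier zsyms_def)
  then show ?case
    using Cons Z_sl_mult[OF _ tau_set_in[of w "h \<otimes>\<^bsub>FG X\<^esub> fgrp_word X [x]"], of "{Ysym x h}"]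
    by (simp add: z_y_def fgrp_word_in)
qed (simp add: Z_sl_one)

lemma zshift_tau_set:
  "set w \<subseteq> X \<Longrightarrow> g \<in> carrier (FG X) \<Longrightarrow> h \<in> carrier (FG X) \<Longrightarrow>
    zshift X g (tau_set X w h) = tau_set X w (g \<otimes>\<^bsub>FG X\<^esub> h)"
  by (induction w arbitrary: h) (auto simp: fgrp_word_in F.m_assoc)

lemma zshift_Eset: "zshift X g (Eset X e h) = Eset X e (g \<otimes>\<^bsub>FG X\<^esub> h)"
  by (simp add: Eset_def)

lemma theta_set_in: "u \<in> cwords X \<Longrightarrow> h \<in> carrier (FG X) \<Longrightarrow> theta_set X u h \<in> carrier (S_sl X)"
  by (induction u arbitrary: h rule: cwords_induct)
    (auto simp: S_sl_union tau_set_in Eset_in fgrp_word_in, simp add: S_sl_carrier)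

lemma theta_set_append:
  "u \<in> cwords X \<Longrightarrow> v \<in> cwords X \<Longrightarrow> h \<in> carrier (FG X) \<Longrightarrow>
    theta_set X (u @ v) h = theta_set X u h \<union> theta_set X v (h \<otimes>\<^bsub>FG X\<^esub> fgrp_word X (trunk u))"
proof (induction u arbitrary: h rule: cwords_induct)
  case Nil
  then show ?case by (simp add: fgrp_word_Nil)
next
  case (Inl w u)
  then show ?case using trunk_in[OF Inl(2)]
    by (simp add: fgrp_word_in fgrp_word_append F.m_assoc Un_assoc)
next
  case (Inr e u)
  then show ?case by (simp add: Un_assoc)
qed

lemma zshift_theta_set:
  "u \<in> cwords X \<Longrightarrow> g \<in> carrier (FG X) \<Longrightarrow> h \<in> carrier (FG X) \<Longrightarrow>
    zshift X g (theta_set X u h) = theta_set X u (g \<otimes>\<^bsub>FG X\<^esub> h)"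
  by (induction u arbitrary: h rule: cwords_induct)
    (auto simp: image_Un zshift_tau_set zshift_Eset fgrp_word_in F.m_assoc)

lemma theta_fold:
  assumes "u \<in> cwords X"
  shows "foldr (\<lambda>s p. theta_gen X s \<otimes>\<^bsub>ZF X\<^esub> p) u \<one>\<^bsub>ZF X\<^esub> =
    (zclass X (theta_set X u \<one>\<^bsub>FG X\<^esub>), fgrp_word X (trunk u))"
  using assms
proof (induction u rule: cwords_induct)
  case Nil
  then show ?case by (simp add: ZF_def semidirect_def Z_sl_one fgrp_word_Nil)
next
  case (Inl w u)
  note w = fgrp_word_in[OF Inl(1)] and u = theta_set_in[OF Inl(2)]
  have "Z_act X (fgrp_word X w) (zclass X (theta_set X u \<one>\<^bsub>FG X\<^esub>)) = zclass X (theta_set X u (fgrp_word X w))"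
    using w u Inl(2) by (simp add: Z_act_class zshift_theta_set)
  then show ?case
    using w u Inl trunk_in[OF Inl(2)]
    by (simp add: ZF_def semidirect_def tau_class fgrp_word_append Z_sl_mult tau_set_in)
next
  case (Inr e u)
  note u = theta_set_in[OF Inr(2)]
  have act: "Z_act X \<one>\<^bsub>FG X\<^esub> (zclass X (theta_set X u \<one>\<^bsub>FG X\<^esub>)) = zclass X (theta_set X u \<one>\<^bsub>FG X\<^esub>)"
    using u Inr(2) by (simp add: Z_act_class zshift_theta_set)
  have gen: "theta_gen X (Inr e) = (zclass X (Eset X e \<one>\<^bsub>FG X\<^esub>), \<one>\<^bsub>FG X\<^esub>)"
    by (simp add: ZF_def semidirect_def Z_sl_one z_e_def Eset_def)
  show ?case
    using u Inr trunk_in[OF Inr(2)] Eset_in[OF Inr(1), of "\<one>\<^bsub>FG X\<^esub>"]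
    by (simp add: gen del: theta_gen.simps) (simp add: ZF_def semidirect_def act Z_sl_mult fgrp_word_in)
qed

lemma zcong_union:
  "(A, B) \<in> zcong X \<Longrightarrow> (C, D) \<in> zcong X \<Longrightarrow> (A \<union> C, B \<union> D) \<in> zcong X"
  using gen_cong.intros(5)[of A B "S_sl X" "Z_rel X" C D] by simp


subsection \<open>Elements of the free product\<close>

abbreviation "ccong \<equiv> gen_cong (free_mon (lists X <+> carrier (E_sl X))) (free_product_rel (free_mon X) (E_sl X))"
abbreviation "cclass \<equiv> cong_class (free_mon (lists X <+> carrier (E_sl X))) (free_product_rel (free_mon X) (E_sl X))"

text \<open>
  The actions and \<open>\<theta>\<close> are defined as common values over all representatives of an element of \<open>C\<^sub>X\<close>.
  This lemma is the reason why these common values exist.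
\<close>

lemma ccong_invariants:
  assumes "(u, v) \<in> ccong"
  shows "u \<in> cwords X \<and> v \<in> cwords X \<and> trunk u = trunk v \<and>
    (\<forall>G :: (nat \<times> 'a \<times> nat) set. word_rel u G = word_rel v G) \<and>
    (\<forall>h\<in>carrier (FG X). (theta_set X u h, theta_set X v h) \<in> zcong X)"
  using assms
proof induction
  case (base u v)
  have uv: "u \<in> cwords X" "v \<in> cwords X" using base by (auto simp: cwords_def)
  from base(1) uv consider
    (Inl) a b where "u = [Inl a, Inl b]" "v = [Inl (a @ b)]" "set a \<subseteq> X" "set b \<subseteq> X" |
    (Inr) e f where "u = [Inr e, Inr f]" "v = [Inr (e \<otimes>\<^bsub>FE X\<^esub> f)]"
      "e \<in> carrier (E_sl X)" "f \<in> carrier (E_sl X)" |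
    (one1) "u = [Inl []]" "v = []" | (one2) "u = [Inr \<one>\<^bsub>FE X\<^esub>]" "v = []"
    unfolding free_product_rel_def by (auto simp: E_sl_def)
  then show ?case
  proof cases
    case Inl
    have "theta_set X u h = theta_set X v h" if "h \<in> carrier (FG X)" for h
      using Inl that by (simp add: tau_set_append)
    then show ?thesis using uv Inl theta_set_in[OF uv(1)]
      by (auto simp: path_rel_append gen_cong.intros(2))
  next
    case Inr
    then show ?thesis using uv Eset_mult[of e X f] by (simp add: FE_mult E_in_FE)
  next
    case one1
    then show ?thesis using uv theta_set_in[OF uv(2)] by (auto simp: gen_cong.intros(2))
  next
    case one2
    then show ?thesis using uv theta_set_in[OF uv(2)]
      by (auto simp: FE_one Eset_def gen_cong.intros(2))
  qed
next
  case (refl u)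
  then have "u \<in> cwords X" by (simp add: cwords_def)
  then show ?case using theta_set_in[of u] by (simp add: gen_cong.intros(2))
next
  case (sym u v)
  then show ?case using gen_cong.intros(3) by metis
next
  case (trans u v w)
  then show ?case using gen_cong.intros(4) by metis
next
  case (mult a b c d)
  have "(theta_set X (a @ c) h, theta_set X (b @ d) h) \<in> zcong X" if "h \<in> carrier (FG X)" for h
    using mult.IH that trunk_in[of b X] by (simp add: theta_set_append zcong_union fgrp_word_in)
  then show ?case using mult.IH by (simp add: word_rel_append)
qed

lemma C_mon_carrier: "carrier (C_mon X) = cclass ` cwords X"
  by (simp add: C_mon_def free_product_def quot_mon_carrier cwords_def)

lemma cword_carrier: "u \<in> cwords X \<Longrightarrow> u \<in> carrier (free_mon (lists X <+> carrier (E_sl X)))"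
  by (simp add: cwords_def)

lemma theta_class:
  assumes "u \<in> cwords X"
  shows "theta X (cclass u) = (zclass X (theta_set X u \<one>\<^bsub>FG X\<^esub>), fgrp_word X (trunk u))"
proof -
  have "theta X (cclass u) = foldr (\<lambda>s p. theta_gen X s \<otimes>\<^bsub>ZF X\<^esub> p) u \<one>\<^bsub>ZF X\<^esub>"
    unfolding theta_def
  proof (rule the_elem_cong_class[OF cword_carrier[OF assms]])
    fix v assume "(u, v) \<in> ccong"
    note inv = ccong_invariants[OF this]
    then have "zclass X (theta_set X u \<one>\<^bsub>FG X\<^esub>) = zclass X (theta_set X v \<one>\<^bsub>FG X\<^esub>)"
      using cong_class_eq_iff[OF monoid_S_sl] theta_set_in by blast
    then show "foldr (\<lambda>s p. theta_gen X s \<otimes>\<^bsub>ZF X\<^esub> p) u \<one>\<^bsub>ZF X\<^esub> =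
        foldr (\<lambda>s p. theta_gen X s \<otimes>\<^bsub>ZF X\<^esub> p) v \<one>\<^bsub>ZF X\<^esub>"
      using inv theta_fold[of u] theta_fold[of v] by simp
  qed
  then show ?thesis using theta_fold[OF assms] by simp
qed

lemma C_plus_class:
  assumes "u \<in> cwords X"
  shows "C_plus X (cclass u) = cclass [Inr (word_plus X u)]"
proof -
  have "C_left X (cclass u) \<one>\<^bsub>FE X\<^esub> = foldr (left_gen X) u \<one>\<^bsub>FE X\<^esub>"
    unfolding C_left_def
  proof (rule the_elem_cong_class[OF cword_carrier[OF assms]])
    fix v assume "(u, v) \<in> ccong"
    note inv = ccong_invariants[OF this]
    show "foldr (left_gen X) u \<one>\<^bsub>FE X\<^esub> = foldr (left_gen X) v \<one>\<^bsub>FE X\<^esub>"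
      using inv word_plus(1) unfolding word_plus_def[symmetric]
      by (intro E_eqI[of _ X]) (auto simp: word_plus(2)[of _ X])
  qed
  then show ?thesis by (simp add: C_plus_def C_of_E_def word_plus_def)
qed

lemma C_star_class:
  assumes "u \<in> cwords X"
  shows "C_star X (cclass u) = cclass [Inr (word_star X u)]"
proof -
  have "C_right X \<one>\<^bsub>FE X\<^esub> (cclass u) = foldl (right_gen X) \<one>\<^bsub>FE X\<^esub> u"
    unfolding C_right_def
  proof (rule the_elem_cong_class[OF cword_carrier[OF assms]])
    fix v assume "(u, v) \<in> ccong"
    note inv = ccong_invariants[OF this]
    show "foldl (right_gen X) \<one>\<^bsub>FE X\<^esub> u = foldl (right_gen X) \<one>\<^bsub>FE X\<^esub> v"
      using inv word_star(1) unfolding word_star_def[symmetric]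
      by (intro E_eqI[of _ X]) (auto simp: word_star(2)[of _ X])
  qed
  then show ?thesis by (simp add: C_star_def C_of_E_def word_star_def)
qed

text \<open>
  Since \<open>h \<cdot> \<gamma>\<theta>\<^sub>1\<close> is the class of \<open>theta_set\<close> at \<open>h\<close>, the action of \<open>F\<^sub>X\<close> disappears from the
  defining pairs of \<open>Y\<^sub>X\<close>.
\<close>

lemma Y_rel_eq:
  "Y_rel X =
     {(zclass X (Eset X (word_plus X u) h \<union> theta_set X u h), zclass X (theta_set X u h)) | u h.
        u \<in> cwords X \<and> h \<in> carrier (FG X)}
   \<union> {(zclass X (theta_set X u h \<union> Eset X (word_star X u) (h \<otimes>\<^bsub>FG X\<^esub> fgrp_word X (trunk u))),
       zclass X (theta_set X u h)) | u h. u \<in> cwords X \<and> h \<in> carrier (FG X)}"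
proof -
  have act: "Z_act X h (theta1 X (cclass u)) = zclass X (theta_set X u h)"
    "Z_act X h (theta1 X (C_plus X (cclass u)) \<otimes>\<^bsub>Z_sl X\<^esub> theta1 X (cclass u)) =
      zclass X (Eset X (word_plus X u) h \<union> theta_set X u h)"
    "Z_act X h (theta1 X (cclass u) \<otimes>\<^bsub>Z_sl X\<^esub> Z_act X (theta2 X (cclass u)) (theta1 X (C_star X (cclass u)))) =
      zclass X (theta_set X u h \<union> Eset X (word_star X u) (h \<otimes>\<^bsub>FG X\<^esub> fgrp_word X (trunk u)))"
    if "u \<in> cwords X" "h \<in> carrier (FG X)" for u h
    using that word_plus(1)[of u X] word_star(1)[of u X] trunk_in[of u X]
    by (simp_all add: theta_class C_plus_class C_star_class Z_act_class zshift_in zshift_theta_set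
        zshift_Eset theta_set_in Eset_in Z_sl_mult S_sl_union image_Un fgrp_word_in)
  have image: "{(f \<gamma> h, g \<gamma> h) | \<gamma> h. \<gamma> \<in> cclass ` cwords X \<and> h \<in> carrier (FG X)} =
      {(f (cclass u) h, g (cclass u) h) | u h. u \<in> cwords X \<and> h \<in> carrier (FG X)}"
    for f g :: "'a cword set \<Rightarrow> 'a fgrp \<Rightarrow> 'a zel"
    by blast
  show ?thesis
    unfolding Y_rel_def C_mon_carrier image
    by (intro arg_cong2[where f = "(\<union>)"] Collect_cong) (metis act)+
qed

end


section \<open>Graphs as models of Y\<close>

text \<open>
  A map \<open>p\<close> from \<open>F\<^sub>X\<close> to the vertices of a graph \<open>G\<close> defines a truth value for each generator of \<open>Z\<^sub>X\<close>.
  It is the restriction to generators of a morphism from \<open>Z\<^sub>X\<close> to the two-element semilattice.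
\<close>

definition zsym_holds :: "'a set \<Rightarrow> ('g \<times> 'a \<times> 'g) set \<Rightarrow> ('a fgrp \<Rightarrow> 'g) \<Rightarrow> 'a zsym \<Rightarrow> bool" where
  "zsym_holds X G p s = (case s of
      Ysym x h \<Rightarrow> (p h, x, p (h \<otimes>\<^bsub>FG X\<^esub> fgrp_word X [x])) \<in> G
    | Esym f h \<Rightarrow> (p h, p h) \<in> fe_rel f G)"

abbreviation "holds X G p B \<equiv> \<forall>s\<in>B. zsym_holds X G p s"

lemma holds_Eset: "holds X G p (Eset X e h) \<longleftrightarrow> (p h, p h) \<in> fe_rel e G"
  by (simp add: Eset_def zsym_holds_def FE_one)

lemma holds_zcong:
  assumes "(B, C) \<in> zcong X"
  shows "holds X G p B = holds X G p C"
proof (rule gen_cong_kernel[OF monoid_S_sl assms, where g = "(\<and>)"])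
  fix B C assume "(B, C) \<in> Z_rel X"
  then obtain f f' h where f: "f \<in> carrier (E_sl X)" "f' \<in> carrier (E_sl X)"
    and BC: "B = {Esym f h, Esym f' h}" "C = {Esym (f \<otimes>\<^bsub>FE X\<^esub> f') h}"
    by (auto simp: Z_rel_def E_nontriv_def)
  show "holds X G p B = holds X G p C"
    using E_mult(2)[OF f, of G] by (simp add: BC zsym_holds_def)
qed auto

text \<open>
  By \<open>holds_zcong\<close>, the truth value is the same for all representatives of a class.
\<close>

definition zel_holds :: "'a set \<Rightarrow> ('g \<times> 'a \<times> 'g) set \<Rightarrow> ('a fgrp \<Rightarrow> 'g) \<Rightarrow> 'a zel \<Rightarrow> bool" where
  "zel_holds X G p z \<longleftrightarrow> (\<exists>B\<in>z. holds X G p B)"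

lemma zel_holds_class:
  assumes "B \<in> carrier (S_sl X)"
  shows "zel_holds X G p (zclass X B) \<longleftrightarrow> holds X G p B"
proof
  assume "zel_holds X G p (zclass X B)"
  then obtain C where "(B, C) \<in> zcong X" "holds X G p C"
    by (auto simp: zel_holds_def mem_cong_class)
  then show "holds X G p B" using holds_zcong by blast
next
  assume "holds X G p B"
  then show "zel_holds X G p (zclass X B)"
    using self_mem_cong_class[OF assms] by (auto simp: zel_holds_def)
qed

lemma Z_sl_carrierE:
  assumes "z \<in> carrier (Z_sl X)"
  obtains B where "B \<in> carrier (S_sl X)" "z = zclass X B"
  using assms by (auto simp: Z_sl_def quot_mon_carrier)

context
  fixes X :: "'a set"
begin

interpretation F: monoid "FG X" by (rule monoid_FG)

lemma holds_tau_set: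
  "set w \<subseteq> X \<Longrightarrow> h \<in> carrier (FG X) \<Longrightarrow> holds X G p (tau_set X w h) \<Longrightarrow>
    (p h, p (h \<otimes>\<^bsub>FG X\<^esub> fgrp_word X w)) \<in> path_rel w G"
proof (induction w arbitrary: h)
  case (Cons x w)
  let ?k = "h \<otimes>\<^bsub>FG X\<^esub> fgrp_word X [x]"
  have "(p h, x, p ?k) \<in> G" using Cons.prems by (simp add: zsym_holds_def)
  moreover have "(p ?k, p (?k \<otimes>\<^bsub>FG X\<^esub> fgrp_word X w)) \<in> path_rel w G"
    using Cons by (simp add: fgrp_word_in)
  ultimately show ?case
    using Cons.prems fgrp_word_Cons[of x X w] by (auto simp: fgrp_word_in F.m_assoc)
qed (simp add: fgrp_word_Nil)

lemma holds_theta_set: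
  "u \<in> cwords X \<Longrightarrow> h \<in> carrier (FG X) \<Longrightarrow> holds X G p (theta_set X u h) \<Longrightarrow>
    (p h, p (h \<otimes>\<^bsub>FG X\<^esub> fgrp_word X (trunk u))) \<in> word_rel u G"
proof (induction u arbitrary: h rule: cwords_induct)
  case Nil
  then show ?case by (simp add: fgrp_word_Nil)
next
  case (Inl w u)
  let ?k = "h \<otimes>\<^bsub>FG X\<^esub> fgrp_word X w"
  have "(p h, p ?k) \<in> path_rel w G" using Inl by (intro holds_tau_set) auto
  moreover have "(p ?k, p (?k \<otimes>\<^bsub>FG X\<^esub> fgrp_word X (trunk u))) \<in> word_rel u G"
    using Inl by (simp add: fgrp_word_in)
  ultimately show ?case
    using Inl trunk_in[OF Inl(2)] by (auto simp: fgrp_word_in fgrp_word_append F.m_assoc)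
next
  case (Inr e u)
  then show ?case using holds_Eset[where X = X and G = G and p = p and e = e and h = h] by auto
qed

lemma Y_relE:
  assumes "(y, z) \<in> Y_rel X"
  obtains u h where "u \<in> cwords X" "h \<in> carrier (FG X)" "z = zclass X (theta_set X u h)"
    "y = zclass X (Eset X (word_plus X u) h \<union> theta_set X u h) \<or>
      y = zclass X (theta_set X u h \<union> Eset X (word_star X u) (h \<otimes>\<^bsub>FG X\<^esub> fgrp_word X (trunk u)))"
  using assms unfolding Y_rel_eq by blast

text \<open>
  If \<open>h \<cdot> u\<theta>\<^sub>1\<close> holds, then \<open>u\<close> relates \<open>p(h)\<close> to \<open>p(h (u\<theta>\<^sub>2))\<close>. Hence \<open>p(h)\<close> is in the domain of its
  relation and \<open>p(h (u\<theta>\<^sub>2))\<close> in the range, which is what the additional factors in the defining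
  pairs of \<open>Y\<^sub>X\<close> say.
\<close>

lemma zel_holds_ycong:
  assumes "(y, z) \<in> ycong X"
  shows "zel_holds X G p y = zel_holds X G p z"
proof (rule gen_cong_kernel[OF monoid_Z_sl assms, where g = "(\<and>)"])
  fix y z assume "y \<in> carrier (Z_sl X)" "z \<in> carrier (Z_sl X)"
  then show "zel_holds X G p (y \<otimes>\<^bsub>Z_sl X\<^esub> z) = (zel_holds X G p y \<and> zel_holds X G p z)"
    by (elim Z_sl_carrierE) (auto simp: Z_sl_mult zel_holds_class S_sl_union)
next
  fix y z assume "(y, z) \<in> Y_rel X"
  then obtain u h where u: "u \<in> cwords X" and h: "h \<in> carrier (FG X)" and z: "z = zclass X (theta_set X u h)"
    and "y = zclass X (Eset X (word_plus X u) h \<union> theta_set X u h) \<or>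
      y = zclass X (theta_set X u h \<union> Eset X (word_star X u) (h \<otimes>\<^bsub>FG X\<^esub> fgrp_word X (trunk u)))"
    by (rule Y_relE) blast
  then obtain B where y: "y = zclass X (theta_set X u h \<union> B)" and B: "B = Eset X (word_plus X u) h \<or>
      B = Eset X (word_star X u) (h \<otimes>\<^bsub>FG X\<^esub> fgrp_word X (trunk u))"
    by (metis Un_commute)
  have "holds X G p B" if "holds X G p (theta_set X u h)"
    using B holds_theta_set[OF u h that] word_plus(2)[OF u, of G] word_star(2)[OF u, of G]
    by (elim disjE) (simp_all add: holds_Eset, blast+)
  moreover have "B \<in> carrier (S_sl X)"
    using B h u word_plus(1)[OF u] word_star(1)[OF u] trunk_in[OF u] by (auto simp: Eset_in fgrp_word_in)
  ultimately show "zel_holds X G p y = zel_holds X G p z"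
    using theta_set_in[OF u h] by (auto simp: y z zel_holds_class S_sl_union)
qed

end


section \<open>Injectivity\<close>

text \<open>
  The vertices \<open>q i, q (i + 1), \<dots>\<close> form a walk in \<open>G\<close> that witnesses that its ends are related by the
  word: the letters of the word label its steps, and each idempotent holds at its place.
\<close>

fun sat :: "'a cword \<Rightarrow> ('g \<times> 'a \<times> 'g) set \<Rightarrow> (nat \<Rightarrow> 'g) \<Rightarrow> nat \<Rightarrow> bool" where
  "sat [] G q i \<longleftrightarrow> True"
| "sat (Inl w # u) G q i \<longleftrightarrow> (\<forall>j<length w. (q (i + j), w ! j, q (Suc (i + j))) \<in> G) \<and> sat u G q (i + length w)"
| "sat (Inr e # u) G q i \<longleftrightarrow> (q i, q i) \<in> fe_rel e G \<and> sat u G q i"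

lemma letter_word_simps [simp]:
  "letter_word []"
  "letter_word (Inl w # u) \<longleftrightarrow> (\<exists>x. w = [x]) \<and> letter_word u"
  "letter_word (Inr e # u) \<longleftrightarrow> letter_word u"
  by (auto simp: letter_word_def)

lemma letter_word_induct [consumes 2, case_names Nil Inl Inr]:
  assumes "u \<in> cwords X" "letter_word u" "P []"
    and "\<And>x u. x \<in> X \<Longrightarrow> u \<in> cwords X \<Longrightarrow> letter_word u \<Longrightarrow> P u \<Longrightarrow> P (Inl [x] # u)"
    and "\<And>e u. e \<in> carrier (E_sl X) \<Longrightarrow> u \<in> cwords X \<Longrightarrow> letter_word u \<Longrightarrow> P u \<Longrightarrow> P (Inr e # u)"
  shows "P u"
  using assms(1,2) by (induction u rule: cwords_induct) (auto intro: assms(3,4,5))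

lemma sat_append: "sat (u @ v) G q i \<longleftrightarrow> sat u G q i \<and> sat v G q (i + length (trunk u))"
  by (induction u G q i rule: sat.induct) (auto simp: add.assoc)

lemma sat_cong:
  assumes "u \<in> cwords X" "letter_word u" "\<And>j. i \<le> j \<Longrightarrow> j \<le> i + length (trunk u) \<Longrightarrow> q j = q' j"
  shows "sat u G q i = sat u G q' i"
  using assms by (induction u arbitrary: i rule: letter_word_induct) auto

lemma sat_exists:
  assumes "u \<in> cwords X" "letter_word u" "(a, b) \<in> word_rel u G"
  shows "\<exists>q. q i = a \<and> q (i + length (trunk u)) = b \<and> sat u G q i"
  using assms
proof (induction u arbitrary: i a rule: letter_word_induct)
  case Nil
  then show ?case by auto
next
  case (Inl x u)
  then obtain c where c: "(a, x, c) \<in> G" "(c, b) \<in> word_rel u G" by auto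
  from Inl.IH[OF c(2), of "Suc i"] obtain q where
    q: "q (Suc i) = c" "q (Suc i + length (trunk u)) = b" "sat u G q (Suc i)" by blast
  define q' where "q' = q(i := a)"
  have q': "q' i = a" "\<And>j. j > i \<Longrightarrow> q' j = q j" by (auto simp: q'_def)
  then have "sat u G q' (Suc i) = sat u G q (Suc i)"
    by (intro sat_cong[OF Inl(2,3)]) auto
  then show ?case using c(1) q q' by (intro exI[of _ q']) auto
next
  case (Inr e u)
  then have "(a, a) \<in> fe_rel e G" "(a, b) \<in> word_rel u G" using E_rel_Id[OF Inr(1), of G] by auto
  then show ?case using Inr.IH[of a i] by auto
qed

text \<open>
  The map from \<open>F\<^sub>X\<close> depends on the exponent sum alone. It visits the vertex \<open>q j\<close> at the prefix of
  length \<open>j\<close> of any positive word.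
\<close>

lemma holds_theta_set_iff_sat:
  assumes "u \<in> cwords X" "letter_word u" "set v \<subseteq> X"
  shows "holds X G (\<lambda>h. q (nat (fgrp_exp h))) (theta_set X u (fgrp_word X v)) \<longleftrightarrow> sat u G q (length v)"
  using assms
proof (induction u arbitrary: v rule: letter_word_induct)
  case (Inl x u)
  have k: "fgrp_word X v \<otimes>\<^bsub>FG X\<^esub> fgrp_word X [x] = fgrp_word X (v @ [x])"
    using Inl by (simp add: fgrp_word_append)
  then show ?case
    using Inl Inl.IH[of "v @ [x]"] fgrp_exp_word[of "v @ [x]" X] fgrp_exp_word[of v X]
    by (simp add: zsym_holds_def nat_add_distrib)
next
  case (Inr e u)
  then show ?case
    using holds_Eset[where X = X and G = G and p = "\<lambda>h. q (nat (fgrp_exp h))" and e = e and h = "fgrp_word X v"] fgrp_exp_word[of v X] by (simp add: ball_Un)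
qed simp

text \<open>
  A walk for \<open>u\<close> defines a model of \<open>Y\<^sub>X\<close> in which \<open>u\<theta>\<^sub>1\<close> and therefore \<open>v\<theta>\<^sub>1\<close> is true. It is then
  a walk for \<open>v\<close>, with the same ends because the exponent sums of the trunks agree.
\<close>

lemma word_rel_le_of_ycong:
  assumes u: "u \<in> cwords X" "letter_word u" and v: "v \<in> cwords X"
    and trunk: "fgrp_word X (trunk u) = fgrp_word X (trunk v)"
    and cong: "(zclass X (theta_set X u \<one>\<^bsub>FG X\<^esub>), zclass X (theta_set X v \<one>\<^bsub>FG X\<^esub>)) \<in> ycong X"
  shows "word_rel u G \<subseteq> word_rel v G"
proof (intro subrelI)
  fix a b assume "(a, b) \<in> word_rel u G"
  with sat_exists[OF u, of a b G 0] obtain q where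
    q: "q 0 = a" "q (length (trunk u)) = b" "sat u G q 0" by auto
  let ?p = "\<lambda>h. q (nat (fgrp_exp h))"
  interpret F: monoid "FG X" by (rule monoid_FG)
  have one: "\<one>\<^bsub>FG X\<^esub> = fgrp_word X []" by (simp add: fgrp_word_Nil)
  have p: "?p (fgrp_word X w) = q (length w)" if "set w \<subseteq> X" for w
    using fgrp_exp_word[OF that] by simp
  have "holds X G ?p (theta_set X u \<one>\<^bsub>FG X\<^esub>)"
    using holds_theta_set_iff_sat[OF u, of "[]" G q] q by (simp add: one)
  then have "holds X G ?p (theta_set X v \<one>\<^bsub>FG X\<^esub>)"
    using zel_holds_ycong[OF cong, of G ?p] theta_set_in[OF u(1) F.one_closed] theta_set_in[OF v F.one_closed]
    by (simp add: zel_holds_class)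
  then have "(?p \<one>\<^bsub>FG X\<^esub>, ?p (fgrp_word X (trunk v))) \<in> word_rel v G"
    using holds_theta_set[OF v F.one_closed, of G ?p] trunk_in[OF v] by (simp add: fgrp_word_in)
  then show "(a, b) \<in> word_rel v G"
    using p[of "[]"] p[OF trunk_in[OF u(1)]] q(1,2) trunk unfolding one by simp
qed


section \<open>Unrolling a walk\<close>

text \<open>
  The walk \<open>q\<close> with labels \<open>w\<close> is made the only walk between its ends. The graph consists of copies of
  \<open>G\<close>, indexed by \<open>i\<close>, in which every step raises the level \<open>d\<close>. The copies are joined only by the
  steps of the walk, all of which take place at level 0.
\<close>

definition unroll :: "('g \<times> 'a \<times> 'g) set \<Rightarrow> (nat \<Rightarrow> 'g) \<Rightarrow> 'a list \<Rightarrow>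
    (('g \<times> nat \<times> int) \<times> 'a \<times> ('g \<times> nat \<times> int)) set" where
  "unroll G q w = {((g, i, d), x, (g', i, d + 1)) | g x g' i d. (g, x, g') \<in> G} \<union>
     {((q i, i, 0), w ! i, (q (Suc i), Suc i, 0)) | i. i < length w \<and> (q i, w ! i, q (Suc i)) \<in> G}"

text \<open>
  A homomorphism into \<open>G\<close> is lifted to one of the copies by means of a grading of the tree.
\<close>

lemma fe_rel_unroll:
  assumes e: "e \<in> carrier (E_sl X)" and g: "(g, g) \<in> fe_rel e G"
  shows "((g, i, d), (g, i, d)) \<in> fe_rel e (unroll G q w)"
proof -
  obtain T :: "(nat, 'a) xtree" where T: "is_xtree X T" "e = pruning T"
    using E_in_FE[OF e] by (rule FE_carrierE)
  note rel = fe_rel_pruning[OF is_xtree_finite_graph[OF T(1)]]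
  obtain l :: "nat \<Rightarrow> int" where l: "\<And>u x v. (u, x, v) \<in> edges T \<Longrightarrow> l v = l u + 1"
    using xtree_grading[OF T(1)] by blast
  obtain f where f: "\<And>u x v. (u, x, v) \<in> edges T \<Longrightarrow> (f u, x, f v) \<in> G" "f (src T) = g" "f (tgt T) = g"
    using g unfolding T rel by (rule denE) blast
  have "((g, i, d), (g, i, d + l (tgt T) - l (src T))) \<in> fe_rel e (unroll G q w)"
    unfolding T rel
    by (rule denI[where f = "\<lambda>v. (f v, i, d + l v - l (src T))"])
      (use f l in \<open>auto simp: unroll_def\<close>)
  then show ?thesis using E_rel_Id[OF e, of "unroll G q w"] by auto
qed

lemma fe_rel_unrollD:
  assumes e: "e \<in> carrier (E_sl X)" and g: "((g, i, d), z) \<in> fe_rel e (unroll G q w)"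
  shows "z = (g, i, d)" "(g, g) \<in> fe_rel e G"
proof -
  show z: "z = (g, i, d)" using E_rel_Id[OF e, of "unroll G q w"] g by auto
  obtain T :: "(nat, 'a) xtree" where T: "is_xtree X T" "e = pruning T"
    using E_in_FE[OF e] by (rule FE_carrierE)
  note rel = fe_rel_pruning[OF is_xtree_finite_graph[OF T(1)]]
  obtain f where f: "\<And>u x v. (u, x, v) \<in> edges T \<Longrightarrow> (f u, x, f v) \<in> unroll G q w"
    "f (src T) = (g, i, d)" "f (tgt T) = (g, i, d)"
    using g unfolding z T rel by (rule denE) blast
  show "(g, g) \<in> fe_rel e G"
    unfolding T rel
  proof (rule denI[where f = "\<lambda>v. fst (f v)"])
    fix u x v assume "(u, x, v) \<in> edges T"
    from f(1)[OF this] show "(fst (f u), x, fst (f v)) \<in> G" by (auto simp: unroll_def)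
  qed (use f in auto)
qed

lemma word_rel_unroll:
  assumes "u \<in> cwords X" "letter_word u" "sat u G q i" "trunk u = drop i w" "i \<le> length w"
  shows "((q i, i, 0), (q (length w), length w, 0)) \<in> word_rel u (unroll G q w)"
  using assms
proof (induction u arbitrary: i rule: letter_word_induct)
  case Nil
  then show ?case by simp
next
  case (Inl x u)
  have i: "i < length w" using Inl.prems by (cases "i < length w") auto
  then have x: "x = w ! i" "trunk u = drop (Suc i) w"
    using Inl.prems by (auto simp: Cons_nth_drop_Suc[symmetric])
  have "((q i, i, 0), x, (q (Suc i), Suc i, 0)) \<in> unroll G q w"
    using i x Inl.prems by (auto simp: unroll_def)
  moreover have "((q (Suc i), Suc i, 0), (q (length w), length w, 0)) \<in> word_rel u (unroll G q w)"
    using Inl x i by (intro Inl.IH) auto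
  ultimately show ?case by auto
next
  case (Inr e u)
  then show ?case using fe_rel_unroll[OF Inr(1), of "q i" G i 0 q w] by auto
qed

text \<open>A walk that has left the trunk does not come back to it.\<close>

lemma word_rel_unroll_off_trunk:
  assumes "u \<in> cwords X" "letter_word u" "((g, i, d), (g', i', d')) \<in> word_rel u (unroll G q w)" "d > 0"
  shows "d' > 0"
  using assms
proof (induction u arbitrary: g i d rule: letter_word_induct)
  case Nil
  then show ?case by simp
next
  case (Inl x u)
  then obtain z where z: "((g, i, d), x, z) \<in> unroll G q w" "(z, (g', i', d')) \<in> word_rel u (unroll G q w)"
    by auto
  then obtain g1 where "z = (g1, i, d + 1)" using \<open>d > 0\<close> by (auto simp: unroll_def)
  then show ?case using Inl.IH z(2) \<open>d > 0\<close> by auto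
next
  case (Inr e u)
  then show ?case using fe_rel_unrollD[OF Inr(1)] by fastforce
qed

lemma sat_of_word_rel_unroll:
  assumes "u \<in> cwords X" "letter_word u"
    and "((q i, i, 0), (q (length w), length w, 0)) \<in> word_rel u (unroll G q w)" "i \<le> length w"
  shows "trunk u = drop i w \<and> sat u G q i"
  using assms
proof (induction u arbitrary: i rule: letter_word_induct)
  case Nil
  then show ?case by simp
next
  case (Inl x u)
  then obtain z where z: "((q i, i, 0), x, z) \<in> unroll G q w"
    "(z, (q (length w), length w, 0)) \<in> word_rel u (unroll G q w)"
    by auto
  \<comment> \<open>the first step cannot leave the trunk, since the walk ends at level 0\<close>
  have "z \<noteq> (g, i, 1)" for g
    using z(2) word_rel_unroll_off_trunk[OF Inl(2,3), of g i 1] by fastforce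
  then have i: "i < length w" "x = w ! i" "z = (q (Suc i), Suc i, 0)" "(q i, x, q (Suc i)) \<in> G"
    using z(1) by (auto simp: unroll_def)
  then show ?case
    using Inl.IH[of "Suc i"] z(2) by (auto simp: Cons_nth_drop_Suc)
next
  case (Inr e u)
  then obtain z where z: "((q i, i, 0), z) \<in> fe_rel e (unroll G q w)"
    "(z, (q (length w), length w, 0)) \<in> word_rel u (unroll G q w)"
    by auto
  then show ?case using fe_rel_unrollD[OF Inr(1) z(1)] Inr.IH[of i] Inr.prems by auto
qed

text \<open>
  In the unrolled graph the word \<open>v\<close> must use the same walk as \<open>u\<close>, and the walk is then projected
  to \<open>G\<close>. So equality in \<open>FE X\<close> transfers complete walks and not only their ends.
\<close>

lemma sat_transfer:
  assumes u: "u \<in> cwords X" "letter_word u" and v: "v \<in> cwords X" "letter_word v"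
    and eq: "fe_eval X u = fe_eval X v" and sat: "sat u G q 0"
  shows "trunk v = trunk u" "sat v G q 0"
proof -
  let ?G = "unroll G q (trunk u)"
  have "((q 0, 0, 0), (q (length (trunk u)), length (trunk u), 0)) \<in> word_rel u ?G"
    using u sat by (intro word_rel_unroll) auto
  then have "((q 0, 0, 0), (q (length (trunk u)), length (trunk u), 0)) \<in> word_rel v ?G"
    using FE_eval(2)[OF u(1), of ?G] FE_eval(2)[OF v(1), of ?G] eq by simp
  from sat_of_word_rel_unroll[OF v this] show "trunk v = trunk u" "sat v G q 0" by auto
qed

lemma fe_rel_complete_graph:
  assumes "e \<in> carrier (FE X)"
  shows "(p, p) \<in> fe_rel e UNIV"
proof -
  obtain T :: "(nat, 'a) xtree" where T: "is_xtree X T" "e = pruning T"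
    using assms by (rule FE_carrierE)
  show ?thesis
    unfolding T fe_rel_pruning[OF is_xtree_finite_graph[OF T(1)]]
    by (rule denI[where f = "\<lambda>_. p"]) auto
qed

lemma sat_complete_graph: "u \<in> cwords X \<Longrightarrow> sat u UNIV (\<lambda>_. p) i"
  by (induction u arbitrary: i rule: cwords_induct) (auto intro: fe_rel_complete_graph E_in_FE)

text \<open>
  In the complete graph with one vertex every word is satisfied, so \<open>sat_transfer\<close> applies.
\<close>

lemma trunk_eq_of_fe_eval_eq:
  assumes "u \<in> cwords X" "letter_word u" "v \<in> cwords X" "letter_word v" "fe_eval X u = fe_eval X v"
  shows "trunk u = trunk v"
  using sat_transfer(1)[OF assms sat_complete_graph[OF assms(1), of "()"]] by simp

text \<open>
  A vertex \<open>g\<close> at which \<open>r\<^sup>*\<close> and \<open>t\<^sup>+\<close> hold is the end of a walk for \<open>r\<close> and the beginning of a walk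
  for \<open>t\<close>. The combined walk for \<open>u = r t\<close> is also one for \<open>v\<close>, so \<open>e\<close> holds where it passes \<open>g\<close>.
\<close>

lemma star_plus_le:
  assumes u: "r @ t \<in> cwords X" "letter_word (r @ t)" and v: "r' @ Inr e # t' \<in> cwords X" "letter_word (r' @ Inr e # t')"
    and eq: "fe_eval X (r @ t) = fe_eval X (r' @ Inr e # t')" and tr: "trunk r = trunk r'"
  shows "(word_star X r \<otimes>\<^bsub>FE X\<^esub> word_plus X t) \<otimes>\<^bsub>FE X\<^esub> e = word_star X r \<otimes>\<^bsub>FE X\<^esub> word_plus X t"
proof -
  have r: "r \<in> cwords X" "letter_word r" and t: "t \<in> cwords X" "letter_word t" and e: "e \<in> carrier (E_sl X)"
    using u v by auto
  note E = word_star(1)[OF r(1)] word_plus(1)[OF t(1)]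
  have "fe_rel (word_star X r) G \<inter> fe_rel (word_plus X t) G \<subseteq> fe_rel e G" for G :: "(nat \<times> 'a \<times> nat) set"
  proof (intro subrelI)
    fix g g' assume "(g, g') \<in> fe_rel (word_star X r) G \<inter> fe_rel (word_plus X t) G"
    then obtain a b where ab: "(a, g) \<in> word_rel r G" "(g, b) \<in> word_rel t G" and g': "g' = g"
      by (auto simp: word_star(2)[OF r(1)] word_plus(2)[OF t(1)])
    let ?n = "length (trunk r)"
    obtain q1 where q1: "q1 ?n = g" "sat r G q1 0"
      using sat_exists[OF r ab(1), of 0] by auto
    obtain q2 where q2: "q2 ?n = g" "sat t G q2 ?n"
      using sat_exists[OF t ab(2), of ?n] by auto
    \<comment> \<open>the two walks agree at the place where they are joined\<close>
    define q where "q j = (if j < ?n then q1 j else q2 j)" for j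
    have "sat r G q 0 = sat r G q1 0" "sat t G q ?n = sat t G q2 ?n"
      using q1(1) q2(1) by (auto intro!: sat_cong[OF r] sat_cong[OF t] simp: q_def)
    then have "sat (r @ t) G q 0" using q1 q2 by (simp add: sat_append)
    from sat_transfer(2)[OF u v eq this] have "(q ?n, q ?n) \<in> fe_rel e G"
      by (simp add: sat_append tr)
    then show "(g, g') \<in> fe_rel e G" by (simp add: q_def q2(1) g')
  qed
  moreover note E12 = E_mult(1)[OF E]
  ultimately show ?thesis
    using E_mult(1)[OF E12 e] by (intro E_eqI[OF _ E12]) (auto simp: E_mult(2)[OF E12 e] E_mult(2)[OF E])
qed

lemma trunk_split:
  assumes "u \<in> cwords X" "letter_word u" "trunk u = w1 @ w2"
  shows "\<exists>r t. u = r @ t \<and> trunk r = w1 \<and> trunk t = w2"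
  using assms
proof (induction u arbitrary: w1 rule: letter_word_induct)
  case (Inl x u)
  show ?case
  proof (cases w1)
    case Nil
    then have "Inl [x] # u = [] @ (Inl [x] # u) \<and> trunk [] = w1 \<and> trunk (Inl [x] # u) = w2"
      using Inl.prems by simp
    then show ?thesis by blast
  next
    case (Cons y w)
    then obtain r t where "u = r @ t" "trunk r = w" "trunk t = w2" using Inl.IH[of w] Inl.prems by auto
    then show ?thesis using Cons Inl.prems by (intro exI[of _ "Inl [x] # r"] exI[of _ t]) auto
  qed
next
  case (Inr e u)
  then obtain r t where "u = r @ t" "trunk r = w1" "trunk t = w2" using Inr.IH[of w1] by auto
  then show ?case by (intro exI[of _ "Inr e # r"] exI[of _ t]) auto
qed simp


section \<open>The map into Y is well defined\<close>

text \<open>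
  The order of the semilattice \<open>Y\<^sub>X\<close> (and below its equality), expressed on representatives in \<open>S\<^sub>X\<close>.
\<close>

definition yle :: "'a set \<Rightarrow> 'a zsym set \<Rightarrow> 'a zsym set \<Rightarrow> bool" where
  "yle X B C \<longleftrightarrow> B \<in> carrier (S_sl X) \<and> C \<in> carrier (S_sl X) \<and> (zclass X (B \<union> C), zclass X B) \<in> ycong X"

definition yeq :: "'a set \<Rightarrow> 'a zsym set \<Rightarrow> 'a zsym set \<Rightarrow> bool" where
  "yeq X B C \<longleftrightarrow> B \<in> carrier (S_sl X) \<and> C \<in> carrier (S_sl X) \<and> (zclass X B, zclass X C) \<in> ycong X"

lemma yeq_refl: "B \<in> carrier (S_sl X) \<Longrightarrow> yeq X B B"
  by (simp add: yeq_def gen_cong.intros(2) zclass_in)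

lemma yeq_sym: "yeq X B C \<Longrightarrow> yeq X C B"
  by (simp add: yeq_def gen_cong.intros(3))

lemma yeq_trans: "yeq X B C \<Longrightarrow> yeq X C D \<Longrightarrow> yeq X B D"
  unfolding yeq_def using gen_cong.intros(4) by metis

lemma yeq_union: "yeq X A B \<Longrightarrow> yeq X C D \<Longrightarrow> yeq X (A \<union> C) (B \<union> D)"
  unfolding yeq_def using gen_cong.intros(5)[of "zclass X A" "zclass X B" "Z_sl X" "Y_rel X" "zclass X C" "zclass X D"]
  by (simp add: Z_sl_mult S_sl_union)

lemma yeq_zcong: "(B, C) \<in> zcong X \<Longrightarrow> yeq X B C"
  using gen_cong_in_carrier[OF monoid_S_sl, of B C X "Z_rel X"] cong_class_eq_iff[OF monoid_S_sl, of B X C "Z_rel X"]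
    yeq_refl[of B X] by (simp add: yeq_def)

lemma yle_iff: "yle X B C \<longleftrightarrow> B \<in> carrier (S_sl X) \<and> C \<in> carrier (S_sl X) \<and> yeq X (B \<union> C) B"
  by (auto simp: yle_def yeq_def S_sl_union)

lemma yle_union: "yle X B C \<Longrightarrow> yle X B D \<Longrightarrow> yle X B (C \<union> D)"
  unfolding yle_iff using yeq_union[of X "B \<union> C" B D D] yeq_refl[of D X] yeq_trans
  by (metis S_sl_union Un_assoc)

lemma yle_subset: "B \<in> carrier (S_sl X) \<Longrightarrow> C \<subseteq> B \<Longrightarrow> yle X B C"
  by (simp add: yle_iff Un_absorb2 yeq_refl) (auto simp: S_sl_carrier finite_subset)

lemma yle_mono: "yle X B C \<Longrightarrow> B \<subseteq> B' \<Longrightarrow> B' \<in> carrier (S_sl X) \<Longrightarrow> yle X B' C"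
  unfolding yle_iff using yeq_union[of X B' B' "B \<union> C" B] yeq_refl[of B' X]
  by (simp add: Un_absorb2 Un_absorb1 flip: Un_assoc)

lemma yle_antisym: "yle X B C \<Longrightarrow> yle X C B \<Longrightarrow> yeq X B C"
  unfolding yle_iff by (metis Un_commute yeq_sym yeq_trans)

lemma yle_yeq: "yle X B C \<Longrightarrow> yeq X C D \<Longrightarrow> yle X B D"
proof -
  assume B: "yle X B C" and CD: "yeq X C D"
  then have D: "D \<in> carrier (S_sl X)" "B \<in> carrier (S_sl X)" by (auto simp: yeq_def yle_iff)
  have "yeq X (B \<union> D) (B \<union> C)" using yeq_union[OF yeq_refl[OF D(2)] yeq_sym[OF CD]] .
  then show "yle X B D" using B D yeq_trans by (auto simp: yle_iff)
qed

lemma yle_Eset_mult: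
  assumes "yle X B (Eset X e h)" "yle X B (Eset X f h)"
    and "e \<in> carrier (E_sl X)" "f \<in> carrier (E_sl X)" "h \<in> carrier (FG X)"
  shows "yle X B (Eset X (e \<otimes>\<^bsub>FE X\<^esub> f) h)"
  using yle_yeq[OF yle_union[OF assms(1,2)] yeq_zcong[OF Eset_mult[OF assms(3-5)]]] .

lemma yle_Eset_mono:
  assumes "yle X B (Eset X a h)" "a \<otimes>\<^bsub>FE X\<^esub> e = a"
    and "a \<in> carrier (E_sl X)" "e \<in> carrier (E_sl X)" "h \<in> carrier (FG X)"
  shows "yle X B (Eset X e h)"
proof -
  have "yeq X (Eset X a h \<union> Eset X e h) (Eset X a h)"
    using yeq_zcong[OF Eset_mult[OF assms(3-5)]] assms(2) by simp
  then have "yle X B (Eset X a h \<union> Eset X e h)"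
    using yle_yeq[OF assms(1)] yeq_sym by blast
  then have 1: "yeq X (B \<union> (Eset X a h \<union> Eset X e h)) B" by (simp add: yle_iff)
  have B: "B \<in> carrier (S_sl X)" "Eset X e h \<in> carrier (S_sl X)"
    using assms by (auto simp: yle_iff Eset_in)
  have "yeq X (B \<union> Eset X a h \<union> Eset X e h) (B \<union> Eset X e h)"
    using assms(1) B by (intro yeq_union yeq_refl) (auto simp: yle_iff)
  then have "yeq X (B \<union> Eset X e h) (B \<union> (Eset X a h \<union> Eset X e h))"
    by (simp add: Un_assoc yeq_sym)
  then show ?thesis using 1 B yeq_trans by (auto simp: yle_iff)
qed

context
  fixes X :: "'a set"
begin

interpretation F: monoid "FG X" by (rule monoid_FG)

lemma yle_word_plus:
  assumes "u \<in> cwords X" "h \<in> carrier (FG X)"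
  shows "yle X (theta_set X u h) (Eset X (word_plus X u) h)"
proof -
  have S: "theta_set X u h \<in> carrier (S_sl X)" "Eset X (word_plus X u) h \<in> carrier (S_sl X)"
    using assms word_plus(1)[OF assms(1)] by (auto simp: theta_set_in Eset_in)
  have "(zclass X (Eset X (word_plus X u) h \<union> theta_set X u h), zclass X (theta_set X u h)) \<in> Y_rel X"
    using assms unfolding Y_rel_eq by blast
  then have "(zclass X (Eset X (word_plus X u) h \<union> theta_set X u h), zclass X (theta_set X u h)) \<in> ycong X"
    using S by (intro gen_cong.intros(1) zclass_in) (auto simp: S_sl_union)
  then show ?thesis using S by (simp add: yle_def Un_commute)
qed

lemma yle_word_star:
  assumes "u \<in> cwords X" "h \<in> carrier (FG X)"
  shows "yle X (theta_set X u h) (Eset X (word_star X u) (h \<otimes>\<^bsub>FG X\<^esub> fgrp_word X (trunk u)))"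
proof -
  let ?E = "Eset X (word_star X u) (h \<otimes>\<^bsub>FG X\<^esub> fgrp_word X (trunk u))"
  have S: "theta_set X u h \<in> carrier (S_sl X)" "?E \<in> carrier (S_sl X)"
    using assms word_star(1)[OF assms(1)] trunk_in[OF assms(1)] by (auto simp: theta_set_in Eset_in fgrp_word_in)
  have "(zclass X (theta_set X u h \<union> ?E), zclass X (theta_set X u h)) \<in> Y_rel X"
    using assms unfolding Y_rel_eq by blast
  then have "(zclass X (theta_set X u h \<union> ?E), zclass X (theta_set X u h)) \<in> ycong X"
    using S by (intro gen_cong.intros(1) zclass_in) (auto simp: S_sl_union)
  then show ?thesis using S by (simp add: yle_def)
qed

text \<open>
  The defining relations of \<open>Y\<^sub>X\<close> are used twice at the place between \<open>r\<close> and \<open>t\<close>: for \<open>r\<close> with its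
  star, and for \<open>t\<close>, translated by the trunk of \<open>r\<close>, with its plus.
\<close>

lemma yle_local:
  assumes "r @ t \<in> cwords X"
  shows "yle X (theta_set X (r @ t) \<one>\<^bsub>FG X\<^esub>)
    (Eset X (word_star X r \<otimes>\<^bsub>FE X\<^esub> word_plus X t) (fgrp_word X (trunk r)))"
proof -
  have r: "r \<in> cwords X" and t: "t \<in> cwords X" using assms by auto
  have h: "fgrp_word X (trunk r) \<in> carrier (FG X)" using fgrp_word_in trunk_in[OF r] by blast
  have th: "theta_set X (r @ t) \<one>\<^bsub>FG X\<^esub> = theta_set X r \<one>\<^bsub>FG X\<^esub> \<union> theta_set X t (fgrp_word X (trunk r))"
    using theta_set_append[OF r t F.one_closed] h by simp
  have S: "theta_set X (r @ t) \<one>\<^bsub>FG X\<^esub> \<in> carrier (S_sl X)" using theta_set_in[OF assms] by simp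
  have "yle X (theta_set X r \<one>\<^bsub>FG X\<^esub>) (Eset X (word_star X r) (fgrp_word X (trunk r)))"
    using yle_word_star[OF r F.one_closed] h by simp
  then have 1: "yle X (theta_set X (r @ t) \<one>\<^bsub>FG X\<^esub>) (Eset X (word_star X r) (fgrp_word X (trunk r)))"
    by (rule yle_mono[OF _ _ S]) (simp add: th)
  have 2: "yle X (theta_set X (r @ t) \<one>\<^bsub>FG X\<^esub>) (Eset X (word_plus X t) (fgrp_word X (trunk r)))"
    by (rule yle_mono[OF yle_word_plus[OF t h] _ S]) (simp add: th)
  show ?thesis
    by (rule yle_Eset_mult[OF 1 2 word_star(1)[OF r] word_plus(1)[OF t] h])
qed

lemma Ysym_in_theta_set:
  assumes "t \<in> cwords X" "letter_word t" "trunk t = x # w"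
  shows "Ysym x h \<in> theta_set X t h"
  using assms by (induction t rule: letter_word_induct) auto

text \<open>
  Each generator in \<open>v\<theta>\<^sub>1\<close> is treated separately. The word \<open>u\<close> is split at the place of the trunk where
  the generator occurs in \<open>v\<close>. A letter of the trunk occurs there in \<open>u\<close> as well, and an
  idempotent is implied by the two parts of \<open>u\<close>.
\<close>

lemma yle_of_fe_eval_eq:
  assumes u: "u \<in> cwords X" "letter_word u" and v: "v \<in> cwords X" "letter_word v"
    and eq: "fe_eval X u = fe_eval X v"
  shows "yle X (theta_set X u \<one>\<^bsub>FG X\<^esub>) (theta_set X v \<one>\<^bsub>FG X\<^esub>)"
proof -
  let ?B = "theta_set X u \<one>\<^bsub>FG X\<^esub>"
  have B: "?B \<in> carrier (S_sl X)" using theta_set_in[OF u(1)] by simp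
  have tr: "trunk u = trunk v" by (rule trunk_eq_of_fe_eval_eq[OF u v eq])
  have "yle X ?B (theta_set X v2 (fgrp_word X (trunk v1)))"
    if "v2 \<in> cwords X" "letter_word v2" "v = v1 @ v2" for v1 v2
    using that
  proof (induction v2 arbitrary: v1 rule: letter_word_induct)
    case Nil
    show ?case using yle_subset[OF B] by simp
  next
    case (Inl x v2)
    have v1: "v1 \<in> cwords X" "set (trunk v1) \<subseteq> X" using v Inl.prems trunk_in[of v1 X] by auto
    obtain r t where rt: "u = r @ t" "trunk r = trunk v1" "trunk t = x # trunk v2"
      using trunk_split[OF u, of "trunk v1" "x # trunk v2"] tr Inl.prems by auto
    then have "Ysym x (fgrp_word X (trunk v1)) \<in> theta_set X t (fgrp_word X (trunk r))"
      using u Ysym_in_theta_set[of t] by simp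
    then have "{Ysym x (fgrp_word X (trunk v1))} \<subseteq> ?B"
      using theta_set_append[of r X t "\<one>\<^bsub>FG X\<^esub>"] u rt v1 by (simp add: fgrp_word_in)
    then have "yle X ?B {Ysym x (fgrp_word X (trunk v1))}" by (rule yle_subset[OF B])
    moreover have "yle X ?B (theta_set X v2 (fgrp_word X (trunk (v1 @ [Inl [x]]))))"
      using Inl.prems by (intro Inl.IH) simp
    moreover have "fgrp_word X (trunk (v1 @ [Inl [x]])) = fgrp_word X (trunk v1) \<otimes>\<^bsub>FG X\<^esub> fgrp_word X [x]"
      using fgrp_word_append[OF v1(2), of "[x]"] Inl(1) by simp
    ultimately show ?case using yle_union[of X ?B "{Ysym x (fgrp_word X (trunk v1))}"] by simp
  next
    case (Inr e v2)
    have v1: "v1 \<in> cwords X" "set (trunk v1) \<subseteq> X" using v Inr.prems trunk_in[of v1 X] by auto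
    obtain r t where rt: "u = r @ t" "trunk r = trunk v1"
      using trunk_split[OF u, of "trunk v1" "trunk v2"] tr Inr.prems by auto
    have E: "word_star X r \<otimes>\<^bsub>FE X\<^esub> word_plus X t \<in> carrier (E_sl X)"
      using u rt by (intro E_mult(1) word_star(1) word_plus(1)) auto
    have "yle X ?B (Eset X (word_star X r \<otimes>\<^bsub>FE X\<^esub> word_plus X t) (fgrp_word X (trunk v1)))"
      using yle_local[of r t] u rt by simp
    moreover have "(word_star X r \<otimes>\<^bsub>FE X\<^esub> word_plus X t) \<otimes>\<^bsub>FE X\<^esub> e = word_star X r \<otimes>\<^bsub>FE X\<^esub> word_plus X t"
      using u v eq rt Inr.prems by (intro star_plus_le[of r t X v1 e v2]) auto
    ultimately have "yle X ?B (Eset X e (fgrp_word X (trunk v1)))"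
      using yle_Eset_mono E Inr(1) fgrp_word_in[OF v1(2)] by blast
    moreover have "yle X ?B (theta_set X v2 (fgrp_word X (trunk (v1 @ [Inr e]))))"
      using Inr.prems by (intro Inr.IH) simp
    ultimately show ?case using yle_union by simp
  qed
  from this[OF v, of "[]"] show ?thesis by (simp add: fgrp_word_Nil)
qed

end


section \<open>The embedding\<close>

abbreviation "yclass X \<equiv> cong_class (Z_sl X) (Y_rel X)"

text \<open>
  Translation by \<open>g\<close> turns the defining pair for \<open>u\<close> and \<open>h\<close> into the one for \<open>u\<close> and \<open>gh\<close>.
\<close>

lemma Z_act_ycong:
  assumes g: "g \<in> carrier (FG X)" and "(y, z) \<in> ycong X"
  shows "(Z_act X g y, Z_act X g z) \<in> ycong X"
proof (rule gen_cong_endo[OF monoid_Z_sl assms(2)])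
  fix y assume "y \<in> carrier (Z_sl X)"
  then show "Z_act X g y \<in> carrier (Z_sl X)"
    using g by (elim Z_sl_carrierE) (simp add: Z_act_class zshift_in zclass_in)
next
  fix y z assume "y \<in> carrier (Z_sl X)" "z \<in> carrier (Z_sl X)"
  then show "Z_act X g (y \<otimes>\<^bsub>Z_sl X\<^esub> z) = Z_act X g y \<otimes>\<^bsub>Z_sl X\<^esub> Z_act X g z"
    using g by (elim Z_sl_carrierE) (simp add: Z_act_class zshift_in Z_sl_mult S_sl_union image_Un)
next
  interpret F: monoid "FG X" by (rule monoid_FG)
  fix y z assume yz: "(y, z) \<in> Y_rel X"
  then obtain u h where u: "u \<in> cwords X" and h: "h \<in> carrier (FG X)" and z: "z = zclass X (theta_set X u h)"
    and y: "y = zclass X (Eset X (word_plus X u) h \<union> theta_set X u h) \<or>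
      y = zclass X (theta_set X u h \<union> Eset X (word_star X u) (h \<otimes>\<^bsub>FG X\<^esub> fgrp_word X (trunk u)))"
    by (rule Y_relE) blast
  have "fgrp_word X (trunk u) \<in> carrier (FG X)" using fgrp_word_in trunk_in[OF u] by blast
  then have act: "Z_act X g (zclass X (theta_set X u h)) = zclass X (theta_set X u (g \<otimes>\<^bsub>FG X\<^esub> h))"
    "Z_act X g (zclass X (Eset X (word_plus X u) h \<union> theta_set X u h)) =
      zclass X (Eset X (word_plus X u) (g \<otimes>\<^bsub>FG X\<^esub> h) \<union> theta_set X u (g \<otimes>\<^bsub>FG X\<^esub> h))"
    "Z_act X g (zclass X (theta_set X u h \<union> Eset X (word_star X u) (h \<otimes>\<^bsub>FG X\<^esub> fgrp_word X (trunk u)))) =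
      zclass X (theta_set X u (g \<otimes>\<^bsub>FG X\<^esub> h) \<union>
        Eset X (word_star X u) ((g \<otimes>\<^bsub>FG X\<^esub> h) \<otimes>\<^bsub>FG X\<^esub> fgrp_word X (trunk u)))"
    using g h u word_plus(1)[OF u] word_star(1)[OF u]
    by (simp_all add: Z_act_class S_sl_union theta_set_in Eset_in image_Un zshift_theta_set zshift_Eset F.m_assoc)
  have "g \<otimes>\<^bsub>FG X\<^esub> h \<in> carrier (FG X)" using g h by simp
  then have "yle X (theta_set X u (g \<otimes>\<^bsub>FG X\<^esub> h)) (Eset X (word_plus X u) (g \<otimes>\<^bsub>FG X\<^esub> h))"
    "yle X (theta_set X u (g \<otimes>\<^bsub>FG X\<^esub> h)) (Eset X (word_star X u) ((g \<otimes>\<^bsub>FG X\<^esub> h) \<otimes>\<^bsub>FG X\<^esub> fgrp_word X (trunk u)))"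
    using u yle_word_plus yle_word_star by blast+
  then show "(Z_act X g y, Z_act X g z) \<in> ycong X"
    using y unfolding z yle_def by (auto simp only: act Un_commute[of "Eset X (word_plus X u) (g \<otimes>\<^bsub>FG X\<^esub> h)"])
qed

lemma Y_act_class:
  assumes "g \<in> carrier (FG X)" "B \<in> carrier (S_sl X)"
  shows "Y_act X g (yclass X (zclass X B)) = yclass X (zclass X (zshift X g B))"
  unfolding Y_act_def
  by (subst quot_map_cong_class[OF monoid_Z_sl zclass_in[OF assms(2)]])
    (simp_all add: Z_act_ycong Z_act_class assms)

definition word_embedding :: "'a set \<Rightarrow> 'a cword \<Rightarrow> 'a zel set \<times> 'a fgrp" where
  "word_embedding X u = (yclass X (zclass X (theta_set X u \<one>\<^bsub>FG X\<^esub>)), fgrp_word X (trunk u))"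

lemma word_embedding_in:
  assumes "u \<in> cwords X"
  shows "word_embedding X u \<in> carrier (semidirect (Y_sl X) (FG X) (Y_act X))"
  using theta_set_in[OF assms monoid.one_closed[OF monoid_FG]] fgrp_word_in[OF trunk_in[OF assms]]
  by (simp add: word_embedding_def semidirect_def Y_sl_def quot_mon_carrier zclass_in)

lemma word_embedding_append:
  assumes u: "u \<in> cwords X" and v: "v \<in> cwords X"
  shows "word_embedding X (u @ v) =
    word_embedding X u \<otimes>\<^bsub>semidirect (Y_sl X) (FG X) (Y_act X)\<^esub> word_embedding X v"
proof -
  interpret F: monoid "FG X" by (rule monoid_FG)
  let ?g = "fgrp_word X (trunk u)"
  have g: "?g \<in> carrier (FG X)" using fgrp_word_in trunk_in[OF u] by blast
  note S = theta_set_in[OF u F.one_closed] theta_set_in[OF v F.one_closed] theta_set_in[OF v g]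
  have "yclass X (zclass X (theta_set X u \<one>\<^bsub>FG X\<^esub>)) \<otimes>\<^bsub>Y_sl X\<^esub> Y_act X ?g (yclass X (zclass X (theta_set X v \<one>\<^bsub>FG X\<^esub>)))
      = yclass X (zclass X (theta_set X (u @ v) \<one>\<^bsub>FG X\<^esub>))"
    using g u v S quot_mon_mult[OF monoid_Z_sl zclass_in[OF S(1)] zclass_in[OF S(3)], of "Y_rel X"]
    by (simp add: Y_act_class zshift_theta_set theta_set_append Z_sl_mult Y_sl_def)
  then show ?thesis
    using trunk_in[OF u] trunk_in[OF v] by (simp add: word_embedding_def semidirect_def fgrp_word_append)
qed

lemma word_embedding_eq_iff:
  assumes u: "u \<in> cwords X" "letter_word u" and v: "v \<in> cwords X" "letter_word v"
  shows "word_embedding X u = word_embedding X v \<longleftrightarrow> fe_eval X u = fe_eval X v"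
proof -
  have one: "\<one>\<^bsub>FG X\<^esub> \<in> carrier (FG X)" using monoid.one_closed[OF monoid_FG] .
  note S = theta_set_in[OF u(1) one] theta_set_in[OF v(1) one]
  note Y = cong_class_eq_iff[OF monoid_Z_sl zclass_in[OF S(1)] zclass_in[OF S(2)], of "Y_rel X"]
  show ?thesis
  proof
    assume "word_embedding X u = word_embedding X v"
    then have tr: "fgrp_word X (trunk u) = fgrp_word X (trunk v)"
      and y: "(zclass X (theta_set X u \<one>\<^bsub>FG X\<^esub>), zclass X (theta_set X v \<one>\<^bsub>FG X\<^esub>)) \<in> ycong X"
      using Y by (simp_all add: word_embedding_def)
    have "word_rel u G = word_rel v G" for G :: "(nat \<times> 'a \<times> nat) set"
      using word_rel_le_of_ycong[OF u v(1) tr y] word_rel_le_of_ycong[OF v u(1) tr[symmetric] gen_cong.intros(3)[OF y]]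
      by blast
    then show "fe_eval X u = fe_eval X v"
      using u v by (intro FE_eqI[of _ X]) (simp_all add: FE_eval)
  next
    assume eq: "fe_eval X u = fe_eval X v"
    have "yeq X (theta_set X u \<one>\<^bsub>FG X\<^esub>) (theta_set X v \<one>\<^bsub>FG X\<^esub>)"
      using yle_antisym[OF yle_of_fe_eval_eq[OF u v eq] yle_of_fe_eval_eq[OF v u eq[symmetric]]] .
    then show "word_embedding X u = word_embedding X v"
      using Y trunk_eq_of_fe_eval_eq[OF u v eq] by (simp add: word_embedding_def yeq_def)
  qed
qed

theorem theorem7p18:
  fixes X :: "'a set"
  shows "\<exists>\<phi> \<in> hom (FE X) (semidirect (Y_sl X) (FG X) (Y_act X)).
    \<phi> \<one>\<^bsub>FE X\<^esub> = \<one>\<^bsub>semidirect (Y_sl X) (FG X) (Y_act X)\<^esub> \<and> inj_on \<phi> (carrier (FE X))"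
proof -
  let ?P = "semidirect (Y_sl X) (FG X) (Y_act X)"
  have "\<forall>A\<in>carrier (FE X). \<exists>u. u \<in> cwords X \<and> letter_word u \<and> fe_eval X u = A"
    using FE_eval_surj by metis
  then obtain word where word: "\<And>A. A \<in> carrier (FE X) \<Longrightarrow> word A \<in> cwords X"
    "\<And>A. A \<in> carrier (FE X) \<Longrightarrow> letter_word (word A)"
    "\<And>A. A \<in> carrier (FE X) \<Longrightarrow> fe_eval X (word A) = A"
    by metis
  define \<phi> where "\<phi> A = word_embedding X (word A)" for A
  have \<phi>: "\<phi> (fe_eval X u) = word_embedding X u" if "u \<in> cwords X" "letter_word u" for u
    using word[OF FE_eval(1)[OF that(1)]] word_embedding_eq_iff[of "word (fe_eval X u)" X u] that
    by (simp add: \<phi>_def)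
  have "\<phi> (A \<otimes>\<^bsub>FE X\<^esub> B) = \<phi> A \<otimes>\<^bsub>?P\<^esub> \<phi> B" if "A \<in> carrier (FE X)" "B \<in> carrier (FE X)" for A B
  proof -
    have "A \<otimes>\<^bsub>FE X\<^esub> B = fe_eval X (word A @ word B)"
      using word that by (simp add: fe_eval_append)
    then show ?thesis
      using \<phi>[of "word A @ word B"] word that word_embedding_append[of "word A" X "word B"]
      unfolding \<phi>_def by simp
  qed
  moreover have "\<phi> A \<in> carrier ?P" if "A \<in> carrier (FE X)" for A
    using word_embedding_in word that unfolding \<phi>_def by blast
  ultimately have "\<phi> \<in> hom (FE X) ?P" by (simp add: hom_def)
  moreover have "\<phi> \<one>\<^bsub>FE X\<^esub> = \<one>\<^bsub>?P\<^esub>"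
    using \<phi>[of "[]"]
    by (simp add: word_embedding_def semidirect_def Y_sl_def quot_mon_one Z_sl_one fgrp_word_Nil)
  moreover have "inj_on \<phi> (carrier (FE X))"
  proof (rule inj_onI)
    fix A B assume "A \<in> carrier (FE X)" "B \<in> carrier (FE X)" "\<phi> A = \<phi> B"
    then show "A = B"
      using word[of A] word[of B] word_embedding_eq_iff[of "word A" X "word B"] by (simp add: \<phi>_def)
  qed
  ultimately show ?thesis by blast
qed

end
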